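(* $\mathcal{W}^\sharp$ is isomorphic to $\mathcal{W}/\mathcal{J}$ as a Hopf algebra, and for each $n$, $\mathcal{W}_n^\sharp$ is isomorphic to $\mathcal{W}_n/\mathcal{J}_n$ as an algebra for the internal product $*$, with $D_n=S_n^\sharp=\mathbf{N}_{1^n}^\sharp$ as neutral element of $(\mathcal{W}_n^\sharp,* )$.
   Context: Let $\mathbb{K}$ be a field of characteristic $0$. A packed word is a word $u$ over the positive integers whose set of letters is $\{1,\dots,m\}$ for some $m=\max(u)$; $\mathrm{pack}(w)$ is obtained from $w$ by replacing each occurrence of its $k$-th smallest letter by $k$. $\mathcal{W}=\mathbf{WQSym}^*=\bigoplus_n\mathcal{W}_n$ is the graded Hopf algebra with basis $\mathbf{N}_u$ over packed words $u$, $\mathcal{W}_n$ being spanned by those of length $n$. Product: $\mathbf{N}_u\mathbf{N}_v=\sum_w\mathbf{N}_w$, over the words $w$ in the shuffle of $u$ with $v$ shifted by $\max(u)$. Coproduct: $\Delta\mathbf{N}_w=\sum_{w=w'w''}\mathbf{N}_{\mathrm{pack}(w')}\otimes\mathbf{N}_{\mathrm{pack}(w'')}$ (deconcatenation). Internal product: for $u,v$ of the same length $\mathbf{N}_u*\mathbf{N}_v=\mathbf{N}_{\mathrm{pack}(u,v)}$, where $\mathrm{pack}(u,v)$ is the packed word obtained by replacing each biletter $(u_i,v_i)$ by its rank in the lexicographically ordered set of distinct occurring biletters; it is $0$ for different lengths. Write $S_n=\mathbf{N}_{1^n}$ and $S_n^\sharp=\sum_{i=0}^n(-1)^i\frac{\mathbf{N}_1^i}{i!}\mathbf{N}_{1^{n-i}}$.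 For $F\in\mathcal{W}_n$, $F^\sharp:=F*S_n^\sharp$ (extended linearly to $\mathcal{W}$), and $\mathcal{W}^\sharp=\bigoplus_n\mathcal{W}_n^\sharp$ is the image of $F\mapsto F^\sharp$. $\mathcal{J}=\bigoplus_n\mathcal{J}_n$ is the two-sided ideal of $\mathcal{W}$ (for the ordinary product) generated by the $\mathbf{N}_u$ such that some letter occurs exactly once in $u$; it is also an ideal for $*$. *)

theory Defs
  imports
    "HOL-Algebra.QuotRing"
    "HOL-Algebra.Subrings"
    "HOL-Algebra.Module"
    "HOL-Library.Poly_Mapping"
    "HOL-Library.Product_Lexorder"
begin

section \<open>Free vector spaces and linear extension\<close>

text \<open>\<^typ>\<open>'b \<Rightarrow>\<^sub>0 'k\<close> is the vector space with basis \<^typ>\<open>'b\<close>;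
  \<^term>\<open>Poly_Mapping.single b 1\<close> is the basis vector of \<open>b\<close>.
  (The multiplication that the library puts on this type is not used.)\<close>

definition scale :: "'k::field \<Rightarrow> ('b \<Rightarrow>\<^sub>0 'k) \<Rightarrow> ('b \<Rightarrow>\<^sub>0 'k)"
  where "scale c = Poly_Mapping.map ((*) c)"

definition lin :: "('b \<Rightarrow> ('c \<Rightarrow>\<^sub>0 'k)) \<Rightarrow> ('b \<Rightarrow>\<^sub>0 'k::field) \<Rightarrow> ('c \<Rightarrow>\<^sub>0 'k)"
  where "lin f F = (\<Sum>b\<in>Poly_Mapping.keys F. scale (Poly_Mapping.lookup F b) (f b))"

definition scalars :: "'k::field ring"
  where "scalars = \<lparr>carrier = UNIV, monoid.mult = (*), one = 1, ring.zero = 0, add = (+)\<rparr>"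


section \<open>Algebras and Hopf algebras over a field\<close>

text \<open>The library's locale \<open>algebra\<close> covers commutative algebras only.\<close>

locale k_algebra =
  M?: module scalars A + R?: ring A
  for A :: "('k::field, 'a, 'm) module_scheme" (structure) +
  assumes smult_mult_left:
    "\<lbrakk>x \<in> carrier A; y \<in> carrier A\<rbrakk> \<Longrightarrow> (c \<odot> x) \<otimes> y = c \<odot> (x \<otimes> y)"
    and smult_mult_right:
    "\<lbrakk>x \<in> carrier A; y \<in> carrier A\<rbrakk> \<Longrightarrow> x \<otimes> (c \<odot> y) = c \<odot> (x \<otimes> y)"

definition k_algebra_iso ::
  "('k::field, 'a, 'm) module_scheme \<Rightarrow> ('k, 'b, 'n) module_scheme \<Rightarrow> ('a \<Rightarrow> 'b) set"
  where "k_algebra_iso A B =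
    {f \<in> ring_iso A B. \<forall>c. \<forall>x\<in>carrier A. f (c \<odot>\<^bsub>A\<^esub> x) = c \<odot>\<^bsub>B\<^esub> f x}"

text \<open>Elements of tensor powers of \<open>A\<close> are represented by formal linear combinations of words
  over \<open>carrier A\<close>, the word \<open>[x\<^sub>1, \<dots>, x\<^sub>n]\<close> standing for the pure tensor
  \<open>x\<^sub>1 \<otimes> \<dots> \<otimes> x\<^sub>n\<close>. Two of them are equal as tensors iff their difference lies in the
  subspace spanned by the multilinearity relations. That subspace is homogeneous for the length
  of words, so that all tensor powers can be treated at once.\<close>

definition tensors :: "nat \<Rightarrow> ('k::field, 'a, 'm) module_scheme \<Rightarrow> ('a list \<Rightarrow>\<^sub>0 'k) set"
  where "tensors n A = {t. \<forall>xs\<in>Poly_Mapping.keys t. length xs = n \<and> set xs \<subseteq> carrier A}"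

inductive_set tensor_null :: "('k::field, 'a, 'm) module_scheme \<Rightarrow> ('a list \<Rightarrow>\<^sub>0 'k) set"
  for A :: "('k, 'a, 'm) module_scheme" where
  zero: "0 \<in> tensor_null A"
| add: "\<lbrakk>s \<in> tensor_null A; t \<in> tensor_null A\<rbrakk> \<Longrightarrow> s + t \<in> tensor_null A"
| scale: "t \<in> tensor_null A \<Longrightarrow> scale c t \<in> tensor_null A"
| additive: "\<lbrakk>set p \<subseteq> carrier A; set q \<subseteq> carrier A; x \<in> carrier A; y \<in> carrier A\<rbrakk> \<Longrightarrow>
    Poly_Mapping.single (p @ [x \<oplus>\<^bsub>A\<^esub> y] @ q) 1
      - Poly_Mapping.single (p @ [x] @ q) 1 - Poly_Mapping.single (p @ [y] @ q) 1
      \<in> tensor_null A"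
| homogeneous: "\<lbrakk>set p \<subseteq> carrier A; set q \<subseteq> carrier A; x \<in> carrier A\<rbrakk> \<Longrightarrow>
    Poly_Mapping.single (p @ [c \<odot>\<^bsub>A\<^esub> x] @ q) 1 - Poly_Mapping.single (p @ [x] @ q) c
      \<in> tensor_null A"

definition tensor_eq ::
  "('k::field, 'a, 'm) module_scheme \<Rightarrow> ('a list \<Rightarrow>\<^sub>0 'k) \<Rightarrow> ('a list \<Rightarrow>\<^sub>0 'k) \<Rightarrow> bool"
  where "tensor_eq A s t \<longleftrightarrow> s - t \<in> tensor_null A"

definition tensor_cat ::
  "('a list \<Rightarrow>\<^sub>0 'k::field) \<Rightarrow> ('a list \<Rightarrow>\<^sub>0 'k) \<Rightarrow> ('a list \<Rightarrow>\<^sub>0 'k)"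
  where "tensor_cat s t = lin (\<lambda>p. lin (\<lambda>q. Poly_Mapping.single (p @ q) 1) t) s"

definition tensor_mult ::
  "('k::field, 'a, 'm) module_scheme \<Rightarrow> ('a list \<Rightarrow>\<^sub>0 'k) \<Rightarrow> ('a list \<Rightarrow>\<^sub>0 'k) \<Rightarrow> ('a list \<Rightarrow>\<^sub>0 'k)"
  where "tensor_mult A s t =
    lin (\<lambda>p. lin (\<lambda>q. Poly_Mapping.single (map2 (\<lambda>x y. x \<otimes>\<^bsub>A\<^esub> y) p q) 1) t) s"

definition tensor_map :: "('a \<Rightarrow> 'b) \<Rightarrow> ('a list \<Rightarrow>\<^sub>0 'k::field) \<Rightarrow> ('b list \<Rightarrow>\<^sub>0 'k)"
  where "tensor_map f = lin (\<lambda>xs. Poly_Mapping.single (map f xs) 1)"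

text \<open>Evaluation in \<open>A\<close> of a multilinear expression \<open>f\<close> on a formal tensor.\<close>

definition tensor_eval ::
  "('k::field, 'a, 'm) module_scheme \<Rightarrow> ('a list \<Rightarrow> 'a) \<Rightarrow> ('a list \<Rightarrow>\<^sub>0 'k) \<Rightarrow> 'a"
  where "tensor_eval A f t =
    (\<Oplus>\<^bsub>A\<^esub>xs\<in>Poly_Mapping.keys t. Poly_Mapping.lookup t xs \<odot>\<^bsub>A\<^esub> f xs)"

text \<open>The coproduct takes values in formal tensors; only their classes modulo
  \<^const>\<open>tensor_eq\<close> matter.\<close>

record (overloaded) ('k::zero, 'a) bialg = "('k, 'a) module" +
  comult :: "'a \<Rightarrow> ('a list \<Rightarrow>\<^sub>0 'k::zero)"
  counit :: "'a \<Rightarrow> 'k"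

locale bialgebra = k_algebra A
  for A :: "('k::field, 'a, 'm) bialg_scheme" (structure) +
  assumes comult_closed: "x \<in> carrier A \<Longrightarrow> comult A x \<in> tensors 2 A"
    and comult_add: "\<lbrakk>x \<in> carrier A; y \<in> carrier A\<rbrakk> \<Longrightarrow>
      tensor_eq A (comult A (x \<oplus> y)) (comult A x + comult A y)"
    and comult_smult: "x \<in> carrier A \<Longrightarrow>
      tensor_eq A (comult A (c \<odot> x)) (scale c (comult A x))"
    and counit_add: "\<lbrakk>x \<in> carrier A; y \<in> carrier A\<rbrakk> \<Longrightarrow>
      counit A (x \<oplus> y) = counit A x + counit A y"
    and counit_smult: "x \<in> carrier A \<Longrightarrow> counit A (c \<odot> x) = c * counit A x"
    and coassoc: "x \<in> carrier A \<Longrightarrow> tensor_eq A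
      (lin (\<lambda>xs. tensor_cat (comult A (xs ! 0)) (Poly_Mapping.single [xs ! 1] 1)) (comult A x))
      (lin (\<lambda>xs. tensor_cat (Poly_Mapping.single [xs ! 0] 1) (comult A (xs ! 1))) (comult A x))"
    and counit_left: "x \<in> carrier A \<Longrightarrow>
      tensor_eval A (\<lambda>xs. counit A (xs ! 0) \<odot> (xs ! 1)) (comult A x) = x"
    and counit_right: "x \<in> carrier A \<Longrightarrow>
      tensor_eval A (\<lambda>xs. counit A (xs ! 1) \<odot> (xs ! 0)) (comult A x) = x"
    and comult_one: "tensor_eq A (comult A \<one>) (Poly_Mapping.single [\<one>, \<one>] 1)"
    and comult_mult: "\<lbrakk>x \<in> carrier A; y \<in> carrier A\<rbrakk> \<Longrightarrow>
      tensor_eq A (comult A (x \<otimes> y)) (tensor_mult A (comult A x) (comult A y))"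
    and counit_one: "counit A \<one> = 1"
    and counit_mult: "\<lbrakk>x \<in> carrier A; y \<in> carrier A\<rbrakk> \<Longrightarrow>
      counit A (x \<otimes> y) = counit A x * counit A y"

definition antipode :: "('k::field, 'a, 'm) bialg_scheme \<Rightarrow> ('a \<Rightarrow> 'a) \<Rightarrow> bool"
  where "antipode A S \<longleftrightarrow>
    S \<in> carrier A \<rightarrow> carrier A \<and>
    (\<forall>x\<in>carrier A. \<forall>y\<in>carrier A. S (x \<oplus>\<^bsub>A\<^esub> y) = S x \<oplus>\<^bsub>A\<^esub> S y) \<and>
    (\<forall>c. \<forall>x\<in>carrier A. S (c \<odot>\<^bsub>A\<^esub> x) = c \<odot>\<^bsub>A\<^esub> S x) \<and>
    (\<forall>x\<in>carrier A.
      tensor_eval A (\<lambda>xs. S (xs ! 0) \<otimes>\<^bsub>A\<^esub> (xs ! 1)) (comult A x) = counit A x \<odot>\<^bsub>A\<^esub> \<one>\<^bsub>A\<^esub> \<and>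
      tensor_eval A (\<lambda>xs. (xs ! 0) \<otimes>\<^bsub>A\<^esub> S (xs ! 1)) (comult A x) = counit A x \<odot>\<^bsub>A\<^esub> \<one>\<^bsub>A\<^esub>)"

text \<open>The antipode is unique when it exists and is preserved by bialgebra morphisms, so it is
  not made part of the structure.\<close>

locale hopf_algebra = bialgebra A
  for A :: "('k::field, 'a, 'm) bialg_scheme" (structure) +
  assumes antipode_exists: "\<exists>S. antipode A S"

definition hopf_iso ::
  "('k::field, 'a, 'm) bialg_scheme \<Rightarrow> ('k, 'b, 'n) bialg_scheme \<Rightarrow> ('a \<Rightarrow> 'b) set"
  where "hopf_iso A B = {f \<in> k_algebra_iso A B. \<forall>x\<in>carrier A.
    counit B (f x) = counit A x \<and>
    tensor_eq B (comult B (f x)) (tensor_map f (comult A x))}"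


section \<open>Substructures and quotients\<close>

definition sub_bialgebra :: "'a set \<Rightarrow> ('k::field, 'a, 'm) bialg_scheme \<Rightarrow> bool"
  where "sub_bialgebra C A \<longleftrightarrow>
    subring C A \<and> submodule C scalars A \<and>
    (\<forall>x\<in>C. \<exists>t \<in> tensors 2 (A\<lparr>carrier := C\<rparr>). tensor_eq A t (comult A x))"

definition bialg_restrict :: "('k::field, 'a, 'm) bialg_scheme \<Rightarrow> 'a set \<Rightarrow> ('k, 'a, 'm) bialg_scheme"
  where "bialg_restrict A C = A\<lparr>carrier := C,
    comult := (\<lambda>x. SOME t. t \<in> tensors 2 (A\<lparr>carrier := C\<rparr>) \<and> tensor_eq A t (comult A x))\<rparr>"

definition bi_ideal :: "'a set \<Rightarrow> ('k::field, 'a, 'm) bialg_scheme \<Rightarrow> bool"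
  where "bi_ideal I A \<longleftrightarrow>
    ideal I A \<and> submodule I scalars A \<and>
    (\<forall>x\<in>I. counit A x = 0) \<and>
    (\<forall>x\<in>I. \<exists>t \<in> tensors 2 A. tensor_eq A t (comult A x) \<and>
      (\<forall>xs\<in>Poly_Mapping.keys t. xs ! 0 \<in> I \<or> xs ! 1 \<in> I))"

definition quot_smult :: "('k, 'a, 'm) module_scheme \<Rightarrow> 'a set \<Rightarrow> 'k \<Rightarrow> 'a set \<Rightarrow> 'a set"
  where "quot_smult A I c X = (\<Union>x\<in>X. I +>\<^bsub>A\<^esub> (c \<odot>\<^bsub>A\<^esub> x))"

definition quot_algebra :: "('k, 'a, 'm) module_scheme \<Rightarrow> 'a set \<Rightarrow> ('k, 'a set) module"
  where "quot_algebra A I =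
    \<lparr>carrier = carrier (A Quot I), monoid.mult = monoid.mult (A Quot I), one = one (A Quot I),
     ring.zero = ring.zero (A Quot I), add = add (A Quot I), smult = quot_smult A I\<rparr>"

definition quot_bialgebra :: "('k::field, 'a, 'm) bialg_scheme \<Rightarrow> 'a set \<Rightarrow> ('k, 'a set) bialg"
  where "quot_bialgebra A I =
    \<lparr>carrier = carrier (A Quot I), monoid.mult = monoid.mult (A Quot I), one = one (A Quot I),
     ring.zero = ring.zero (A Quot I), add = add (A Quot I), smult = quot_smult A I,
     comult = (\<lambda>X. tensor_map (\<lambda>x. I +>\<^bsub>A\<^esub> x) (comult A (SOME x. x \<in> X))),
     counit = (\<lambda>X. counit A (SOME x. x \<in> X))\<rparr>"


section \<open>Packed words\<close>

definition wmax :: "nat list \<Rightarrow> nat"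
  where "wmax u = Max (insert 0 (set u))"

definition packed :: "nat list \<Rightarrow> bool"
  where "packed u \<longleftrightarrow> set u = {1..wmax u}"

text \<open>The letter \<open>a\<close> is the \<open>k\<close>-th smallest one iff exactly \<open>k\<close> letters are \<open>\<le> a\<close>. Biletters
  are pairs, ordered lexicographically by \<^theory>\<open>HOL-Library.Product_Lexorder\<close>.\<close>

definition pack :: "'a::linorder list \<Rightarrow> nat list"
  where "pack w = map (\<lambda>a. card {b \<in> set w. b \<le> a}) w"


section \<open>The Hopf algebra of packed words\<close>

type_synonym 'k wspace = "nat list \<Rightarrow>\<^sub>0 'k"

definition N :: "nat list \<Rightarrow> 'k::field wspace"
  where "N u = Poly_Mapping.single u 1"

definition Wspace :: "'k::field wspace set"
  where "Wspace = {F. \<forall>u\<in>Poly_Mapping.keys F. packed u}"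

definition Wn :: "nat \<Rightarrow> 'k::field wspace set"
  where "Wn n = {F \<in> Wspace. \<forall>u\<in>Poly_Mapping.keys F. length u = n}"

text \<open>\<open>u\<close> and the shifted \<open>v\<close> have no common letter, so every word of their shuffle has
  multiplicity one and the set \<^const>\<open>shuffles\<close> loses nothing.\<close>

definition Wmult :: "'k::field wspace \<Rightarrow> 'k wspace \<Rightarrow> 'k wspace"
  where "Wmult F G =
    lin (\<lambda>u. lin (\<lambda>v. \<Sum>w\<in>shuffles u (map (\<lambda>a. a + wmax u) v). N w) G) F"

definition Wcomult :: "'k::field wspace \<Rightarrow> ('k wspace list \<Rightarrow>\<^sub>0 'k)"
  where "Wcomult = lin (\<lambda>w. \<Sum>i\<le>length w.
    Poly_Mapping.single [N (pack (take i w)), N (pack (drop i w))] 1)"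

text \<open>The counit is the only one compatible with the coproduct: the coefficient of the
  empty word.\<close>

definition W :: "('k::field, 'k wspace) bialg"
  where "W = \<lparr>carrier = Wspace, monoid.mult = Wmult, one = N [], ring.zero = 0, add = (+),
    smult = scale, comult = Wcomult, counit = (\<lambda>F. Poly_Mapping.lookup F [])\<rparr>"

definition star :: "'k::field wspace \<Rightarrow> 'k wspace \<Rightarrow> 'k wspace"
  where "star F G =
    lin (\<lambda>u. lin (\<lambda>v. if length u = length v then N (pack (zip u v)) else 0) G) F"


section \<open>The map sharp and the ideal J\<close>

definition Ssharp :: "nat \<Rightarrow> 'k::field_char_0 wspace"
  where "Ssharp n = (\<Sum>i\<le>n. scale ((-1) ^ i / fact i)
    (N [1] [^]\<^bsub>W\<^esub> i \<otimes>\<^bsub>W\<^esub> N (replicate (n - i) 1)))"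

definition sharp :: "'k::field_char_0 wspace \<Rightarrow> 'k wspace"
  where "sharp = lin (\<lambda>u. star (N u) (Ssharp (length u)))"

definition Wsharp :: "'k::field_char_0 wspace set"
  where "Wsharp = sharp ` Wspace"

definition Wsharp_n :: "nat \<Rightarrow> 'k::field_char_0 wspace set"
  where "Wsharp_n n = sharp ` Wn n"

definition J :: "'k::field_char_0 wspace set"
  where "J = Idl\<^bsub>W\<^esub> {N u | u. packed u \<and> (\<exists>a. count_list u a = 1)}"

definition Jn :: "nat \<Rightarrow> 'k::field_char_0 wspace set"
  where "Jn n = J \<inter> Wn n"

definition D :: "nat \<Rightarrow> 'k::field_char_0 wspace"
  where "D n = Ssharp n"

definition star_algebra :: "nat \<Rightarrow> ('k::field, 'k wspace) module"
  where "star_algebra n = \<lparr>carrier = Wn n, monoid.mult = star, one = N (replicate n 1),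
    ring.zero = 0, add = (+), smult = scale\<rparr>"

definition sharp_star_algebra :: "nat \<Rightarrow> ('k::field_char_0, 'k wspace) module"
  where "sharp_star_algebra n = (star_algebra n)\<lparr>carrier := Wsharp_n n, one := D n\<rparr>"

end

theory Submission
  imports Defs "HOL-Combinatorics.Multiset_Permutations"
begin

text \<open>The map \<open>F \<mapsto> F\<^sup>\<sharp>\<close> is an idempotent bialgebra endomorphism of \<open>W\<close> with kernel \<open>J\<close>, so its image is
  a Hopf algebra isomorphic to \<open>W / J\<close>.

  It respects the coproduct because \<open>\<Delta> S\<^sub>n\<^sup>\<sharp> = \<Sum> S\<^sub>i\<^sup>\<sharp> \<otimes> S\<^bsub>n-i\<^esub>\<^sup>\<sharp>\<close> and \<open>\<Delta> (F * G) = \<Delta> F * \<Delta> G\<close>. It respects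
  the product because, moreover, the coefficients of \<open>S\<^sub>n\<^sup>\<sharp>\<close> do not change when the positions of a word
  are permuted, so that the subwords of a summand of \<open>S\<^sub>n\<^sup>\<sharp>\<close> that meet the two factors of a shuffle may
  be moved to the front and to the back. The ideal \<open>J\<close> is spanned by the words \<open>u\<close> with a letter
  that occurs once. Such \<open>N\<^sub>u\<close> are killed: by the same symmetry \<open>u\<close> may be sorted, on sorted words
  \<open>\<sharp>\<close> is multiplicative for shifted concatenation, and \<open>N\<^sub>1\<^sup>\<sharp> = N\<^sub>1 - N\<^sub>1 = 0\<close>. Conversely
  \<open>S\<^sub>n\<^sup>\<sharp> - N\<^bsub>1^n\<^esub>\<close> lies in the span, hence so does \<open>F\<^sup>\<sharp> - F\<close>. The same facts make \<open>\<sharp>\<close> a homomorphism for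
  the internal product that sends the unit \<open>N\<^bsub>1^n\<^esub>\<close> to \<open>S\<^sub>n\<^sup>\<sharp>\<close>.\<close>

text \<open>As a formal series, the sum of all \<open>Ssharp n\<close> is the exponential of -N_1
  times the sum of all \<open>N (replicate n 1)\<close>. Both factors are group-like, the first
  because N_1 is primitive; this yields the coproduct formula, and the sign cancels degree 1. The
  coefficients are symmetric because the power N_1^i is the sum of all permutations of 1..i, so that
  each summand is the sum of all rearrangements of one multiset. The obstacle is that equality of
  tensors depends on the algebra: a smaller carrier has fewer relations in
  \<open>tensor_null\<close>, so an equality over \<open>W\<close> is not yet one over the image of
  \<open>sharp\<close>. Moreover the coproducts of the image and of the quotient involve a choice.
  The retraction \<open>sharp\<close> settles both: as a linear map it sends relations over
  \<open>W\<close> to relations over its image, and cosets of \<open>J\<close> correspond to values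
  of \<open>sharp\<close>. The Hopf axioms are then transferred by one lemma,
  \<open>hopf_algebra_image\<close>, applied to \<open>sharp\<close> and to the projection onto
  cosets.\<close>

abbreviation single :: "'b \<Rightarrow> 'k::zero \<Rightarrow> ('b \<Rightarrow>\<^sub>0 'k)"
  where "single \<equiv> Poly_Mapping.single"

abbreviation lookup :: "('b \<Rightarrow>\<^sub>0 'k::zero) \<Rightarrow> 'b \<Rightarrow> 'k"
  where "lookup \<equiv> Poly_Mapping.lookup"

abbreviation keys :: "('b \<Rightarrow>\<^sub>0 'k::zero) \<Rightarrow> 'b set"
  where "keys \<equiv> Poly_Mapping.keys"

section \<open>Linear extension from basis vectors\<close>

lemma lookup_scale [simp]: "lookup (scale c F) x = c * lookup F x"
  by (simp add: scale_def map.rep_eq when_def)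

interpretation pm: vector_space "scale :: 'k::field \<Rightarrow> ('b \<Rightarrow>\<^sub>0 'k) \<Rightarrow> _"
  by standard (auto simp: poly_mapping_eq_iff fun_eq_iff lookup_add algebra_simps)

lemma scale_single [simp]: "scale c (single x d) = single x (c * d)"
  by (rule poly_mapping_eqI) (simp add: lookup_single when_def)

lemma keys_scale: "keys (scale c F) \<subseteq> keys F"
  by (auto simp: in_keys_iff)

text \<open>The freedom in \<open>A\<close> lets the extensions at several vectors be written as
  sums over one common index set, as additivity requires; the surplus coefficients are 0.\<close>

lemma lin_eq_sum:
  assumes "finite A" "keys F \<subseteq> A"
  shows "lin f F = (\<Sum>b\<in>A. scale (lookup F b) (f b))"
  unfolding lin_def using assms
  by (intro sum.mono_neutral_left) (auto simp: in_keys_iff)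

lemma lin_zero [simp]: "lin f 0 = 0"
  by (simp add: lin_def)

lemma lin_add: "lin f (F + G) = lin f F + lin f G"
proof -
  let ?A = "keys F \<union> keys G"
  have "lin f H = (\<Sum>b\<in>?A. scale (lookup H b) (f b))"
    if "keys H \<subseteq> ?A" for H
    using that by (intro lin_eq_sum) auto
  moreover have "keys (F + G) \<subseteq> ?A"
    by (rule keys_add)
  ultimately show ?thesis
    by (simp add: lookup_add pm.scale_left_distrib sum.distrib)
qed

lemma lin_scale: "lin f (scale c F) = scale c (lin f F)"
  using lin_eq_sum[OF finite_keys keys_scale, of f c F]
  by (simp add: lin_def pm.scale_sum_right)

lemma lin_uminus: "lin f (- F) = - lin f F"
  using lin_scale[of f "-1" F] by simp

lemma lin_diff: "lin f (F - G) = lin f F - lin f G"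
  using lin_add[of f F "- G"] by (simp add: lin_uminus)

lemma lin_sum: "lin f (sum g A) = (\<Sum>x\<in>A. lin f (g x))"
  by (induction A rule: infinite_finite_induct) (auto simp: lin_add)

lemma lin_single [simp]: "lin f (single b c) = scale c (f b)"
  using lin_eq_sum[of "{b}" "single b c" f] by (simp add: lookup_single)

lemma lin_cong:
  "(\<And>b. b \<in> keys F \<Longrightarrow> f b = g b) \<Longrightarrow> lin f F = lin g F"
  by (simp add: lin_def)

lemma lin_fun_add: "lin (\<lambda>b. f b + g b) F = lin f F + lin g F"
  by (simp add: lin_def pm.scale_right_distrib sum.distrib)

lemma lin_fun_diff: "lin (\<lambda>b. f b - g b) F = lin f F - lin g F"
  by (simp add: lin_def pm.scale_right_diff_distrib sum_subtractf)

lemma lin_fun_scale: "lin (\<lambda>b. scale c (f b)) F = scale c (lin f F)"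
  by (simp add: lin_def pm.scale_sum_right mult.commute)

lemma lin_fun_zero [simp]: "lin (\<lambda>b. 0) F = 0"
  by (simp add: lin_def)

lemma lin_fun_sum: "lin (\<lambda>b. \<Sum>x\<in>A. f x b) F = (\<Sum>x\<in>A. lin (f x) F)"
  by (induction A rule: infinite_finite_induct) (auto simp: lin_fun_add)

lemma lin_lin: "lin f (lin g F) = lin (\<lambda>b. lin f (g b)) F"
  by (simp add: lin_def[of g] lin_sum lin_scale) (simp add: lin_def)

lemma lin_swap: "lin (\<lambda>b. lin (\<lambda>c. f b c) G) F = lin (\<lambda>c. lin (\<lambda>b. f b c) F) G"
  unfolding lin_def pm.scale_sum_right
  by (subst sum.swap) (simp add: mult.commute)

lemma lin_basis: "lin (\<lambda>b. single b 1) F = F"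
proof (rule poly_mapping_eqI)
  fix b
  have "lookup (lin (\<lambda>b. single b 1) F) b =
      (\<Sum>x\<in>keys F. if x = b then lookup F x else 0)"
    by (simp add: lin_def lookup_sum lookup_single when_def)
  then show "lookup (lin (\<lambda>b. single b 1) F) b = lookup F b"
    by (simp add: in_keys_iff)
qed

text \<open>Bounds on supports, closure of carriers and congruence of tensors are all membership in
  some subspace \<open>V\<close>, so this rule reduces each of them to basis vectors.\<close>

lemma lin_mem:
  assumes "pm.subspace V" "\<And>b. b \<in> keys F \<Longrightarrow> f b \<in> V"
  shows "lin f F \<in> V"
  unfolding lin_def using assms by (intro pm.subspace_sum pm.subspace_scale)

lemma lin_diff_mem:
  assumes "pm.subspace V" "\<And>b. b \<in> keys F \<Longrightarrow> f b - g b \<in> V"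
  shows "lin f F - lin g F \<in> V"
  unfolding lin_fun_diff[symmetric] using assms by (rule lin_mem)

lemma keys_lin:
  "keys (lin f F) \<subseteq> (\<Union>b\<in>keys F. keys (f b))"
proof -
  have "lin f F \<in> {G. keys G \<subseteq> (\<Union>b\<in>keys F. keys (f b))}"
  proof (rule lin_mem)
    show "pm.subspace {G. keys G \<subseteq> (\<Union>b\<in>keys F. keys (f b))}"
      unfolding pm.subspace_def by (auto dest!: subsetD[OF keys_add] subsetD[OF keys_scale])
  qed auto
  then show ?thesis by simp
qed

text \<open>Meant for \<open>tensor_eval\<close>, whose values lie in an abstract module, out of
  reach of \<open>lin_mem\<close>. The case \<open>add\<close> lets \<open>x\<close> occur in
  \<open>s\<close>, so the step is proved by additivity and not by adding a fresh key.\<close>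

lemma poly_mapping_keys_induct [consumes 1, case_names zero add]:
  fixes t :: "'b \<Rightarrow>\<^sub>0 'k::field"
  assumes "keys t \<subseteq> K" "P 0"
    and "\<And>x c s. x \<in> K \<Longrightarrow> keys s \<subseteq> K \<Longrightarrow> P s \<Longrightarrow> P (single x c + s)"
  shows "P t"
proof -
  let ?s = "\<lambda>L. \<Sum>x\<in>L. single x (lookup t x)"
  have "P (?s L) \<and> keys (?s L) \<subseteq> K" if "finite L" "L \<subseteq> K" for L
    using that
  proof induction
    case (insert x L)
    then have IH: "P (?s L)" "keys (?s L) \<subseteq> K" and x: "x \<in> K"
      by auto
    have "keys (single x (lookup t x) + ?s L) \<subseteq> K"
      by (rule order_trans[OF keys_add]) (use IH x in auto)
    moreover have "P (single x (lookup t x) + ?s L)"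
      by (rule assms(3)[OF x IH(2,1)])
    ultimately show ?case
      unfolding sum.insert[OF insert.hyps] by blast
  qed (use assms in auto)
  moreover have "?s (keys t) = t"
    using lin_basis[of t] by (simp add: lin_def)
  ultimately show ?thesis
    using assms(1) by (metis finite_keys)
qed


section \<open>Formal tensors and multilinear maps\<close>

lemma subspace_tensor_null: "pm.subspace (tensor_null A)"
  by (simp add: pm.subspace_def tensor_null.zero tensor_null.add tensor_null.scale)

lemma subspace_zero: "pm.subspace {0}"
  by (simp add: pm.subspace_def)

lemma tensor_eq_refl [simp]: "tensor_eq A s s"
  by (simp add: tensor_eq_def tensor_null.zero)

lemma tensor_eq_sym: "tensor_eq A s t \<Longrightarrow> tensor_eq A t s"
  unfolding tensor_eq_def using pm.subspace_neg[OF subspace_tensor_null] by fastforce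

lemma tensor_eq_trans [trans]: "tensor_eq A s t \<Longrightarrow> tensor_eq A t r \<Longrightarrow> tensor_eq A s r"
  unfolding tensor_eq_def using pm.subspace_add[OF subspace_tensor_null] by fastforce

lemma tensor_eq_eq_trans [trans]: "tensor_eq A s t \<Longrightarrow> t = r \<Longrightarrow> tensor_eq A s r"
  by simp

lemma eq_tensor_eq_trans [trans]: "s = t \<Longrightarrow> tensor_eq A t r \<Longrightarrow> tensor_eq A s r"
  by simp

lemma tensor_eq_add: "tensor_eq A s t \<Longrightarrow> tensor_eq A s' t' \<Longrightarrow> tensor_eq A (s + s') (t + t')"
  unfolding tensor_eq_def using pm.subspace_add[OF subspace_tensor_null]
  by (metis add_diff_add)

lemma tensor_eq_scale: "tensor_eq A s t \<Longrightarrow> tensor_eq A (scale c s) (scale c t)"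
  unfolding tensor_eq_def pm.scale_right_diff_distrib[symmetric] by (rule tensor_null.scale)

lemma tensor_eq_sum:
  "(\<And>x. x \<in> X \<Longrightarrow> tensor_eq A (f x) (g x)) \<Longrightarrow> tensor_eq A (sum f X) (sum g X)"
  unfolding tensor_eq_def sum_subtractf[symmetric]
  by (rule pm.subspace_sum[OF subspace_tensor_null])

lemma tensor_eq_lin:
  "(\<And>b. b \<in> keys F \<Longrightarrow> tensor_eq A (f b) (g b)) \<Longrightarrow> tensor_eq A (lin f F) (lin g F)"
  unfolding tensor_eq_def by (rule lin_diff_mem[OF subspace_tensor_null])

text \<open>Universal property of the tensor powers, relative to a subspace: \<open>V = {0}\<close>
  yields equations, \<open>V = tensor_null B\<close> yields equalities of tensors over another
  algebra.\<close>

lemma lin_tensor_null: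
  assumes V: "pm.subspace V"
    and add: "\<And>p q x y. \<lbrakk>set p \<subseteq> carrier A; set q \<subseteq> carrier A; x \<in> carrier A; y \<in> carrier A\<rbrakk> \<Longrightarrow>
      g (p @ [x \<oplus>\<^bsub>A\<^esub> y] @ q) - g (p @ [x] @ q) - g (p @ [y] @ q) \<in> V"
    and smult: "\<And>p q x c. \<lbrakk>set p \<subseteq> carrier A; set q \<subseteq> carrier A; x \<in> carrier A\<rbrakk> \<Longrightarrow>
      g (p @ [c \<odot>\<^bsub>A\<^esub> x] @ q) - scale c (g (p @ [x] @ q)) \<in> V"
    and t: "t \<in> tensor_null A"
  shows "lin g t \<in> V"
  using t
proof induction
  case (additive p q x y)
  then show ?case using add[of p q x y] by (simp add: lin_diff)
next
  case (homogeneous p q x c)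
  then show ?case using smult[of p q x c] by (simp add: lin_diff)
qed (use V in \<open>auto simp: lin_add lin_scale pm.subspace_add pm.subspace_scale pm.subspace_0\<close>)

lemma tensors_2D:
  assumes "t \<in> tensors 2 A" "xs \<in> keys t"
  shows "length xs = 2" "xs ! 0 \<in> carrier A" "xs ! 1 \<in> carrier A" "xs = [xs ! 0, xs ! 1]"
proof -
  show len: "length xs = 2"
    using assms by (auto simp: tensors_def)
  moreover have "set xs \<subseteq> carrier A"
    using assms by (auto simp: tensors_def)
  ultimately show "xs ! 0 \<in> carrier A" "xs ! 1 \<in> carrier A"
    by (auto simp: subset_iff)
  show "xs = [xs ! 0, xs ! 1]"
    using len by (intro nth_equalityI) (auto simp: less_Suc_eq numeral_2_eq_2)
qed

lemma append_Cons_length_2: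
  assumes "length (p @ x # q) = 2"
  obtains z where "p = []" "q = [z]" | z where "p = [z]" "q = []"
  using assms by (cases p; cases q) (auto simp: numeral_2_eq_2)

lemma lin_tensor_eq2:
  assumes V: "pm.subspace V"
    and add1: "\<And>x y z. \<lbrakk>x \<in> carrier A; y \<in> carrier A; z \<in> carrier A\<rbrakk> \<Longrightarrow>
      g (x \<oplus>\<^bsub>A\<^esub> y) z - (g x z + g y z) \<in> V"
    and add2: "\<And>x y z. \<lbrakk>x \<in> carrier A; y \<in> carrier A; z \<in> carrier A\<rbrakk> \<Longrightarrow>
      g z (x \<oplus>\<^bsub>A\<^esub> y) - (g z x + g z y) \<in> V"
    and smult1: "\<And>c x z. \<lbrakk>x \<in> carrier A; z \<in> carrier A\<rbrakk> \<Longrightarrow>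
      g (c \<odot>\<^bsub>A\<^esub> x) z - scale c (g x z) \<in> V"
    and smult2: "\<And>c x z. \<lbrakk>x \<in> carrier A; z \<in> carrier A\<rbrakk> \<Longrightarrow>
      g z (c \<odot>\<^bsub>A\<^esub> x) - scale c (g z x) \<in> V"
    and st: "s \<in> tensors 2 A" "t \<in> tensors 2 A" "tensor_eq A s t"
  shows "lin (\<lambda>xs. g (xs ! 0) (xs ! 1)) s - lin (\<lambda>xs. g (xs ! 0) (xs ! 1)) t \<in> V"
proof -
  \<comment> \<open>\<open>tensor_null\<close> contains relations between words of every length,
    while \<open>g\<close> takes two arguments; the default 0 makes the other relations hold
    trivially.\<close>
  let ?g = "\<lambda>xs. if length xs = 2 then g (xs ! 0) (xs ! 1) else 0"
  have "lin ?g (s - t) \<in> V"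
  proof (rule lin_tensor_null[OF V])
    show "s - t \<in> tensor_null A" using st by (simp add: tensor_eq_def)
  next
    fix p q x y
    assume *: "set p \<subseteq> carrier A" "set q \<subseteq> carrier A" "x \<in> carrier A" "y \<in> carrier A"
    show "?g (p @ [x \<oplus>\<^bsub>A\<^esub> y] @ q) - ?g (p @ [x] @ q) - ?g (p @ [y] @ q) \<in> V"
    proof (cases "length (p @ x # q) = 2")
      case True
      then show ?thesis
        by (rule append_Cons_length_2) (use * add1[of x y] add2[of x y] in \<open>auto simp: diff_diff_add\<close>)
    next
      case False
      then show ?thesis using V by (simp add: pm.subspace_0)
    qed
  next
    fix p q x c
    assume *: "set p \<subseteq> carrier A" "set q \<subseteq> carrier A" "x \<in> carrier A"
    show "?g (p @ [c \<odot>\<^bsub>A\<^esub> x] @ q) - scale c (?g (p @ [x] @ q)) \<in> V"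
    proof (cases "length (p @ x # q) = 2")
      case True
      then show ?thesis
        by (rule append_Cons_length_2) (use * smult1[of x] smult2[of x] in auto)
    next
      case False
      then show ?thesis using V by (auto simp: pm.subspace_0)
    qed
  qed
  moreover have "lin (\<lambda>xs. g (xs ! 0) (xs ! 1)) u = lin ?g u" if "u \<in> tensors 2 A" for u
    using tensors_2D[OF that] by (intro lin_cong) auto
  ultimately show ?thesis using st by (simp add: lin_diff)
qed

lemma tensors_0 [simp]: "0 \<in> tensors n A"
  by (simp add: tensors_def)

lemma tensors_add: "s \<in> tensors n A \<Longrightarrow> t \<in> tensors n A \<Longrightarrow> s + t \<in> tensors n A"
  using keys_add[of s t] by (auto simp: tensors_def)

lemma subspace_tensors: "pm.subspace (tensors n A :: ('a list \<Rightarrow>\<^sub>0 'k::field) set)"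
proof -
  have "scale c t \<in> tensors n A" if "t \<in> tensors n A" for c and t :: "'a list \<Rightarrow>\<^sub>0 'k::field"
    using that by (auto simp: tensors_def dest!: subsetD[OF keys_scale])
  then show ?thesis
    by (simp add: pm.subspace_def tensors_add)
qed

lemma tensors_single: "length xs = n \<Longrightarrow> set xs \<subseteq> carrier A \<Longrightarrow> single xs c \<in> tensors n A"
  by (auto simp: tensors_def)

lemma tensor_map_tensors:
  assumes "t \<in> tensors n A" "f ` carrier A \<subseteq> carrier B"
  shows "tensor_map f t \<in> tensors n B"
  unfolding tensor_map_def using assms
  by (intro lin_mem[OF subspace_tensors] tensors_single) (auto simp: tensors_def)

lemma tensor_map_map: "tensor_map f (tensor_map g t) = tensor_map (f \<circ> g) t"
  by (simp add: tensor_map_def lin_lin)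

lemma tensor_map_cong:
  assumes "t \<in> tensors n A" "\<And>x. x \<in> carrier A \<Longrightarrow> f x = g x"
  shows "tensor_map f t = tensor_map g t"
  unfolding tensor_map_def using assms
  by (intro lin_cong) (auto simp: tensors_def subset_iff intro: arg_cong[where f = "\<lambda>xs. single xs 1"])

lemma tensor_map_id:
  assumes "t \<in> tensors n A" "\<And>x. x \<in> carrier A \<Longrightarrow> f x = x"
  shows "tensor_map f t = t"
proof -
  have "tensor_map f t = tensor_map (\<lambda>x. x) t"
    using assms by (rule tensor_map_cong)
  then show ?thesis by (simp add: tensor_map_def lin_basis)
qed

section \<open>Linear maps between carriers and their action on tensors\<close>

definition lin_map :: "('k::field, 'a, 'm) module_scheme \<Rightarrow> ('k, 'b, 'n) module_scheme \<Rightarrow> ('a \<Rightarrow> 'b) \<Rightarrow> bool"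
  where "lin_map A B f \<longleftrightarrow> f ` carrier A \<subseteq> carrier B \<and>
    (\<forall>x\<in>carrier A. \<forall>y\<in>carrier A. f (x \<oplus>\<^bsub>A\<^esub> y) = f x \<oplus>\<^bsub>B\<^esub> f y) \<and>
    (\<forall>c. \<forall>x\<in>carrier A. f (c \<odot>\<^bsub>A\<^esub> x) = c \<odot>\<^bsub>B\<^esub> f x)"

lemma lin_mapD:
  assumes "lin_map A B f"
  shows "x \<in> carrier A \<Longrightarrow> f x \<in> carrier B"
    and "x \<in> carrier A \<Longrightarrow> y \<in> carrier A \<Longrightarrow> f (x \<oplus>\<^bsub>A\<^esub> y) = f x \<oplus>\<^bsub>B\<^esub> f y"
    and "x \<in> carrier A \<Longrightarrow> f (c \<odot>\<^bsub>A\<^esub> x) = c \<odot>\<^bsub>B\<^esub> f x"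
  using assms by (auto simp: lin_map_def)

text \<open>A linear \<open>f\<close> sends each generating relation over \<open>A\<close> to one
  over \<open>B\<close>. As \<open>B\<close> may have the smaller carrier, this is how equalities
  over \<open>W\<close> reach the image of \<open>sharp\<close>.\<close>

lemma tensor_map_eq:
  assumes f: "lin_map A B f" and st: "tensor_eq A s t"
  shows "tensor_eq B (tensor_map f s) (tensor_map f t)"
  unfolding tensor_eq_def tensor_map_def lin_diff[symmetric]
proof (rule lin_tensor_null[OF subspace_tensor_null])
  show "s - t \<in> tensor_null A" using st by (simp add: tensor_eq_def)
qed (use lin_mapD[OF f] in \<open>auto simp: image_subset_iff subset_iff
      intro!: tensor_null.additive[of _ B, simplified] tensor_null.homogeneous[of _ B, simplified]\<close>)

lemma tensor_single_add1: "\<lbrakk>x \<in> carrier A; y \<in> carrier A; z \<in> carrier A\<rbrakk> \<Longrightarrow>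
    tensor_eq A (single [x \<oplus>\<^bsub>A\<^esub> y, z] 1)
      (single [x, z] 1 + single [y, z] 1)"
  using tensor_null.additive[of "[]" A "[z]" x y] by (simp add: tensor_eq_def diff_diff_add)

lemma tensor_single_add2: "\<lbrakk>x \<in> carrier A; y \<in> carrier A; z \<in> carrier A\<rbrakk> \<Longrightarrow>
    tensor_eq A (single [z, x \<oplus>\<^bsub>A\<^esub> y] 1)
      (single [z, x] 1 + single [z, y] 1)"
  using tensor_null.additive[of "[z]" A "[]" x y] by (simp add: tensor_eq_def diff_diff_add)

lemma tensor_single_smult1: "\<lbrakk>x \<in> carrier A; z \<in> carrier A\<rbrakk> \<Longrightarrow>
    tensor_eq A (single [c \<odot>\<^bsub>A\<^esub> x, z] 1) (scale c (single [x, z] 1))"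
  using tensor_null.homogeneous[of "[]" A "[z]" x c] by (simp add: tensor_eq_def)

lemma tensor_single_smult2: "\<lbrakk>x \<in> carrier A; z \<in> carrier A\<rbrakk> \<Longrightarrow>
    tensor_eq A (single [z, c \<odot>\<^bsub>A\<^esub> x] 1) (scale c (single [z, x] 1))"
  using tensor_null.homogeneous[of "[z]" A "[]" x c] by (simp add: tensor_eq_def)

lemmas tensor_single_bilinear =
  tensor_single_add1 tensor_single_add2 tensor_single_smult1 tensor_single_smult2

lemma lin_tensor_eq2_tensor:
  assumes "\<And>x y z. \<lbrakk>x \<in> carrier A; y \<in> carrier A; z \<in> carrier A\<rbrakk> \<Longrightarrow>
      tensor_eq B (g (x \<oplus>\<^bsub>A\<^esub> y) z) (g x z + g y z)"
    and "\<And>x y z. \<lbrakk>x \<in> carrier A; y \<in> carrier A; z \<in> carrier A\<rbrakk> \<Longrightarrow>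
      tensor_eq B (g z (x \<oplus>\<^bsub>A\<^esub> y)) (g z x + g z y)"
    and "\<And>c x z. \<lbrakk>x \<in> carrier A; z \<in> carrier A\<rbrakk> \<Longrightarrow>
      tensor_eq B (g (c \<odot>\<^bsub>A\<^esub> x) z) (scale c (g x z))"
    and "\<And>c x z. \<lbrakk>x \<in> carrier A; z \<in> carrier A\<rbrakk> \<Longrightarrow>
      tensor_eq B (g z (c \<odot>\<^bsub>A\<^esub> x)) (scale c (g z x))"
    and "s \<in> tensors 2 A" "t \<in> tensors 2 A" "tensor_eq A s t"
  shows "tensor_eq B (lin (\<lambda>xs. g (xs ! 0) (xs ! 1)) s) (lin (\<lambda>xs. g (xs ! 0) (xs ! 1)) t)"
  unfolding tensor_eq_def
  by (rule lin_tensor_eq2[OF subspace_tensor_null]) (use assms in \<open>simp_all add: tensor_eq_def\<close>)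

lemma tensor_cat_eq_left:
  assumes st: "tensor_eq A s t" and q: "set q \<subseteq> carrier A"
  shows "tensor_eq A (tensor_cat s (single q 1)) (tensor_cat t (single q 1))"
  unfolding tensor_eq_def tensor_cat_def lin_diff[symmetric] lin_single pm.scale_one
proof (rule lin_tensor_null[OF subspace_tensor_null])
  show "s - t \<in> tensor_null A" using st by (simp add: tensor_eq_def)
qed (use q in \<open>auto intro!: tensor_null.additive[of _ A "_ @ q", simplified] 
  tensor_null.homogeneous[of _ A "_ @ q", simplified]\<close>)

lemma tensor_cat_eq_right:
  assumes st: "tensor_eq A s t" and q: "set q \<subseteq> carrier A"
  shows "tensor_eq A (tensor_cat (single q 1) s) (tensor_cat (single q 1) t)"
  unfolding tensor_eq_def tensor_cat_def lin_single pm.scale_one lin_diff[symmetric]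
proof (rule lin_tensor_null[OF subspace_tensor_null])
  show "s - t \<in> tensor_null A" using st by (simp add: tensor_eq_def)
qed (use q in \<open>auto intro!: tensor_null.additive[of "q @ _" A, simplified] 
  tensor_null.homogeneous[of "q @ _" A, simplified]\<close>)

lemma tensor_cat_add_left: "tensor_cat (s + t) r = tensor_cat s r + tensor_cat t r"
  by (simp add: tensor_cat_def lin_add)

lemma tensor_cat_add_right: "tensor_cat r (s + t) = tensor_cat r s + tensor_cat r t"
  by (simp add: tensor_cat_def lin_add lin_fun_add)

lemma tensor_cat_scale_left: "tensor_cat (scale c s) r = scale c (tensor_cat s r)"
  by (simp add: tensor_cat_def lin_scale)

lemma tensor_cat_scale_right: "tensor_cat r (scale c s) = scale c (tensor_cat r s)"
  by (simp add: tensor_cat_def lin_scale lin_fun_scale)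

text \<open>With its mirror image below, this makes the iterated coproduct bilinear in the two legs,
  as needed to transfer coassociativity.\<close>

lemma tensor_cat_single_right_bilinear:
  assumes t: "t \<in> tensors n A"
  shows "\<lbrakk>x \<in> carrier A; y \<in> carrier A\<rbrakk> \<Longrightarrow>
      tensor_eq A (tensor_cat t (single [x \<oplus>\<^bsub>A\<^esub> y] 1))
        (tensor_cat t (single [x] 1) + tensor_cat t (single [y] 1))"
    and "x \<in> carrier A \<Longrightarrow>
      tensor_eq A (tensor_cat t (single [c \<odot>\<^bsub>A\<^esub> x] 1))
        (scale c (tensor_cat t (single [x] 1)))"
proof -
  have p: "set p \<subseteq> carrier A" if "p \<in> keys t" for p
    using t that by (auto simp: tensors_def)
  show "tensor_eq A (tensor_cat t (single [x \<oplus>\<^bsub>A\<^esub> y] 1))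
        (tensor_cat t (single [x] 1) + tensor_cat t (single [y] 1))"
    if "x \<in> carrier A" "y \<in> carrier A"
    unfolding tensor_cat_def lin_single pm.scale_one lin_fun_add[symmetric]
    by (rule tensor_eq_lin) (use that tensor_null.additive[OF p, of _ "[]"] in
      \<open>simp add: tensor_eq_def diff_diff_add\<close>)
  show "tensor_eq A (tensor_cat t (single [c \<odot>\<^bsub>A\<^esub> x] 1))
        (scale c (tensor_cat t (single [x] 1)))" if "x \<in> carrier A"
    unfolding tensor_cat_def lin_single pm.scale_one lin_fun_scale[symmetric]
    by (rule tensor_eq_lin) (use that tensor_null.homogeneous[OF p, of _ "[]"] in
      \<open>simp add: tensor_eq_def\<close>)
qed

lemma tensor_cat_single_left_bilinear:
  assumes t: "t \<in> tensors n A"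
  shows "\<lbrakk>x \<in> carrier A; y \<in> carrier A\<rbrakk> \<Longrightarrow>
      tensor_eq A (tensor_cat (single [x \<oplus>\<^bsub>A\<^esub> y] 1) t)
        (tensor_cat (single [x] 1) t + tensor_cat (single [y] 1) t)"
    and "x \<in> carrier A \<Longrightarrow>
      tensor_eq A (tensor_cat (single [c \<odot>\<^bsub>A\<^esub> x] 1) t)
        (scale c (tensor_cat (single [x] 1) t))"
proof -
  have q: "set q \<subseteq> carrier A" if "q \<in> keys t" for q
    using t that by (auto simp: tensors_def)
  show "tensor_eq A (tensor_cat (single [x \<oplus>\<^bsub>A\<^esub> y] 1) t)
        (tensor_cat (single [x] 1) t + tensor_cat (single [y] 1) t)"
    if "x \<in> carrier A" "y \<in> carrier A"
    unfolding tensor_cat_def lin_single pm.scale_one lin_fun_add[symmetric]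
    by (rule tensor_eq_lin) (use that tensor_null.additive[OF _ q, of "[]"] in
      \<open>simp add: tensor_eq_def diff_diff_add\<close>)
  show "tensor_eq A (tensor_cat (single [c \<odot>\<^bsub>A\<^esub> x] 1) t)
        (scale c (tensor_cat (single [x] 1) t))" if "x \<in> carrier A"
    unfolding tensor_cat_def lin_single pm.scale_one lin_fun_scale[symmetric]
    by (rule tensor_eq_lin) (use that tensor_null.homogeneous[OF _ q, of "[]"] in
      \<open>simp add: tensor_eq_def\<close>)
qed

section \<open>Evaluation of formal tensors\<close>

lemma carrier_scalars [simp]: "carrier scalars = UNIV" "zero scalars = 0" "one scalars = 1"
    "monoid.mult scalars = (*)" "add scalars = (+)"
  by (simp_all add: scalars_def)

lemma cring_scalars: "cring (scalars :: 'k::field ring)"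
proof (rule cringI)
  show "abelian_group (scalars :: 'k ring)"
  proof (rule abelian_groupI)
    fix x :: 'k
    show "\<exists>y\<in>carrier scalars. y \<oplus>\<^bsub>scalars\<^esub> x = \<zero>\<^bsub>scalars\<^esub>"
      by (simp add: exI[of _ "- x"])
  qed (auto simp: algebra_simps)
  show "Group.comm_monoid (scalars :: 'k ring)"
    by (rule comm_monoidI) (auto simp: algebra_simps)
qed (auto simp: algebra_simps)

context k_algebra
begin

lemma smult_closed' [simp]: "x \<in> carrier A \<Longrightarrow> c \<odot> x \<in> carrier A"
  by (rule smult_closed) auto

lemma smult_add_left: "x \<in> carrier A \<Longrightarrow> (c + d) \<odot> x = c \<odot> x \<oplus> d \<odot> x"
  using smult_l_distr[of c d x] by simp

lemma smult_add_right: "x \<in> carrier A \<Longrightarrow> y \<in> carrier A \<Longrightarrow> c \<odot> (x \<oplus> y) = c \<odot> x \<oplus> c \<odot> y"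
  using smult_r_distr[of c x y] by simp

lemma smult_smult: "x \<in> carrier A \<Longrightarrow> (c * d) \<odot> x = c \<odot> (d \<odot> x)"
  using smult_assoc1[of c d x] by simp

lemma smult_unit [simp]: "x \<in> carrier A \<Longrightarrow> 1 \<odot> x = x"
  using smult_one[of x] by simp

lemma smult_zero_left [simp]: "x \<in> carrier A \<Longrightarrow> 0 \<odot> x = \<zero>"
  using smult_l_null[of x] by simp

lemma smult_zero_right [simp]: "c \<odot> \<zero> = \<zero>"
  using smult_r_null[of c] by simp

lemma tensor_eval_superset:
  assumes "finite K" "keys t \<subseteq> K" "f \<in> K \<rightarrow> carrier A"
  shows "tensor_eval A f t = (\<Oplus>xs\<in>K. lookup t xs \<odot> f xs)"
  unfolding tensor_eval_def
  using assms
  by (intro add.finprod_mono_neutral_cong_left) (auto simp: in_keys_iff Pi_iff)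

lemma tensor_eval_closed [simp]:
  "f \<in> keys t \<rightarrow> carrier A \<Longrightarrow> tensor_eval A f t \<in> carrier A"
  unfolding tensor_eval_def by (rule finsum_closed) auto

lemma tensor_eval_zero [simp]: "tensor_eval A f 0 = \<zero>"
  by (simp add: tensor_eval_def)

lemma tensor_eval_add:
  assumes "f \<in> keys s \<rightarrow> carrier A" "f \<in> keys t \<rightarrow> carrier A"
  shows "tensor_eval A f (s + t) = tensor_eval A f s \<oplus> tensor_eval A f t"
proof -
  let ?K = "keys s \<union> keys t"
  have f: "f \<in> ?K \<rightarrow> carrier A" using assms by auto
  have "tensor_eval A f (s + t) = (\<Oplus>xs\<in>?K. lookup (s + t) xs \<odot> f xs)"
    using f keys_add[of s t] by (intro tensor_eval_superset) auto
  also have "\<dots> = (\<Oplus>xs\<in>?K. lookup s xs \<odot> f xs \<oplus> lookup t xs \<odot> f xs)"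
    using f by (intro add.finprod_cong') (auto simp: lookup_add smult_add_left Pi_iff)
  also have "\<dots> = (\<Oplus>xs\<in>?K. lookup s xs \<odot> f xs) \<oplus> (\<Oplus>xs\<in>?K. lookup t xs \<odot> f xs)"
    using f by (intro finsum_addf) auto
  also have "\<dots> = tensor_eval A f s \<oplus> tensor_eval A f t"
    using f by (simp add: tensor_eval_superset[of ?K])
  finally show ?thesis .
qed

lemma tensor_eval_single:
  assumes "f xs \<in> carrier A"
  shows "tensor_eval A f (single xs c) = c \<odot> f xs"
  using tensor_eval_superset[of "{xs}" "single xs c" f] assms by auto

lemma tensor_eval_scale:
  assumes "f \<in> keys t \<rightarrow> carrier A"
  shows "tensor_eval A f (scale c t) = c \<odot> tensor_eval A f t"
proof -
  have "keys t \<subseteq> keys t" by simp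
  then have "f \<in> keys t \<rightarrow> carrier A \<Longrightarrow> ?thesis"
  proof (induction t rule: poly_mapping_keys_induct)
    case (add xs d s)
    then have s: "f \<in> keys s \<rightarrow> carrier A" and x: "f xs \<in> carrier A"
      and cs: "f \<in> keys (scale c s) \<rightarrow> carrier A"
      using assms keys_scale[of c s] by auto
    have x': "f \<in> keys (single xs e) \<rightarrow> carrier A" for e
      using x by auto
    have IH: "tensor_eval A f (scale c s) = c \<odot> tensor_eval A f s"
      using add s by simp
    then show ?case
      using s x x' cs
      by (simp add: pm.scale_right_distrib tensor_eval_add tensor_eval_single smult_smult smult_add_right)
  qed simp
  with assms show ?thesis by simp
qed

lemma tensor_eval_diff:
  assumes "f \<in> keys s \<rightarrow> carrier A" "f \<in> keys t \<rightarrow> carrier A"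
  shows "tensor_eval A f (s - t) = tensor_eval A f s \<oplus> (-1) \<odot> tensor_eval A f t"
  using tensor_eval_add[of f s "scale (-1) t"] tensor_eval_scale[of f t "-1"] assms
    keys_scale[of "-1" t] by auto

lemma smult_neg_cancel: "x \<in> carrier A \<Longrightarrow> x \<oplus> (-1) \<odot> x = \<zero>"
  using smult_add_left[of x 1 "-1"] by simp

lemma smult_neg_cancelD:
  assumes "x \<in> carrier A" "y \<in> carrier A" "x \<oplus> (-1) \<odot> y = \<zero>"
  shows "x = y"
proof -
  have "x = x \<oplus> ((-1) \<odot> y \<oplus> y)"
    using assms smult_neg_cancel[of y] by (simp add: a_comm)
  also have "\<dots> = y"
    using assms by (simp add: a_assoc[symmetric])
  finally show ?thesis .
qed

text \<open>Counterpart of \<open>lin_tensor_null\<close> for values in \<open>A\<close> itself,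
  whose addition is a record field and not the type class operation; differences become sums with a
  multiple by -1.\<close>

lemma tensor_eval_null:
  assumes f: "\<And>xs. f xs \<in> carrier A"
    and add: "\<And>p q x y. \<lbrakk>set p \<subseteq> carrier A; set q \<subseteq> carrier A; x \<in> carrier A; y \<in> carrier A\<rbrakk> \<Longrightarrow>
      f (p @ [x \<oplus> y] @ q) = f (p @ [x] @ q) \<oplus> f (p @ [y] @ q)"
    and smult: "\<And>p q x c. \<lbrakk>set p \<subseteq> carrier A; set q \<subseteq> carrier A; x \<in> carrier A\<rbrakk> \<Longrightarrow>
      f (p @ [c \<odot> x] @ q) = c \<odot> f (p @ [x] @ q)"
    and t: "t \<in> tensor_null A"
  shows "tensor_eval A f t = \<zero>"
proof -
  have Pi: "f \<in> K \<rightarrow> carrier A" for K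
    using f by auto
  show ?thesis using t
proof induction
  case (add s t)
  then show ?case by (simp add: tensor_eval_add Pi)
next
  case (scale t c)
  then show ?case by (simp add: tensor_eval_scale Pi)
next
  case (additive p q x y)
  let ?xy = "p @ [x \<oplus> y] @ q" and ?x = "p @ [x] @ q" and ?y = "p @ [y] @ q"
  have single: "tensor_eval A f (single xs 1) = f xs" for xs
    using f by (simp add: tensor_eval_single)
  have "tensor_eval A f (single ?xy 1 - (single ?x 1 + single ?y 1))
    = f ?xy \<oplus> (-1) \<odot> (f ?x \<oplus> f ?y)"
    by (simp only: tensor_eval_diff tensor_eval_add Pi single)
  also have "\<dots> = \<zero>"
    unfolding add[OF additive] by (rule smult_neg_cancel) (simp add: f)
  finally show ?case
    by (simp only: diff_diff_add)
next
  case (homogeneous p q x c)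
  let ?cx = "p @ [c \<odot> x] @ q" and ?x = "p @ [x] @ q"
  have "tensor_eval A f (single ?cx 1 - single ?x c)
     = f ?cx \<oplus> (-1) \<odot> (c \<odot> f ?x)"
    by (simp only: tensor_eval_diff Pi tensor_eval_single f smult_unit)
  also have "\<dots> = \<zero>"
    unfolding smult[OF homogeneous] by (rule smult_neg_cancel) (simp add: f)
  finally show ?case .
qed simp
qed

lemma tensor_eval_eq2:
  assumes g: "\<And>x y. \<lbrakk>x \<in> carrier A; y \<in> carrier A\<rbrakk> \<Longrightarrow> g x y \<in> carrier A"
    and add1: "\<And>x y z. \<lbrakk>x \<in> carrier A; y \<in> carrier A; z \<in> carrier A\<rbrakk> \<Longrightarrow> g (x \<oplus> y) z = g x z \<oplus> g y z"
    and add2: "\<And>x y z. \<lbrakk>x \<in> carrier A; y \<in> carrier A; z \<in> carrier A\<rbrakk> \<Longrightarrow> g z (x \<oplus> y) = g z x \<oplus> g z y"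
    and smult1: "\<And>c x z. \<lbrakk>x \<in> carrier A; z \<in> carrier A\<rbrakk> \<Longrightarrow> g (c \<odot> x) z = c \<odot> g x z"
    and smult2: "\<And>c x z. \<lbrakk>x \<in> carrier A; z \<in> carrier A\<rbrakk> \<Longrightarrow> g z (c \<odot> x) = c \<odot> g z x"
    and st: "s \<in> tensors 2 A" "t \<in> tensors 2 A" "tensor_eq A s t"
  shows "tensor_eval A (\<lambda>xs. g (xs ! 0) (xs ! 1)) s = tensor_eval A (\<lambda>xs. g (xs ! 0) (xs ! 1)) t"
proof -
  \<comment> \<open>\<open>tensor_eval_null\<close> asks for values in the carrier on all words and
    for relations of every length; the default zero supplies both away from two-letter words over
    the carrier.\<close>
  define g' where "g' = (\<lambda>xs. if length xs = 2 \<and> set xs \<subseteq> carrier A then g (xs ! 0) (xs ! 1) else \<zero>)"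
  have g'_closed: "g' xs \<in> carrier A" for xs
    unfolding g'_def by (simp add: g subset_iff)
  have Pi: "g' \<in> K \<rightarrow> carrier A" for K
    using g'_closed by auto
  have "tensor_eval A g' (s - t) = \<zero>"
  proof (rule tensor_eval_null[OF g'_closed])
    show "s - t \<in> tensor_null A" using st by (simp add: tensor_eq_def)
  next
    fix p q x y
    assume *: "set p \<subseteq> carrier A" "set q \<subseteq> carrier A" "x \<in> carrier A" "y \<in> carrier A"
    show "g' (p @ [x \<oplus> y] @ q) = g' (p @ [x] @ q) \<oplus> g' (p @ [y] @ q)"
    proof (cases "length (p @ x # q) = 2")
      case True
      then show ?thesis
        by (rule append_Cons_length_2) (use * add1[of x y] add2[of x y] in \<open>simp_all add: g'_def\<close>)
    qed (simp add: g'_def)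
  next
    fix p q x c
    assume *: "set p \<subseteq> carrier A" "set q \<subseteq> carrier A" "x \<in> carrier A"
    show "g' (p @ [c \<odot> x] @ q) = c \<odot> g' (p @ [x] @ q)"
    proof (cases "length (p @ x # q) = 2")
      case True
      then show ?thesis
        by (rule append_Cons_length_2) (use * smult1[of x] smult2[of x] in \<open>simp_all add: g'_def\<close>)
    qed (simp add: g'_def)
  qed
  then have "tensor_eval A g' s = tensor_eval A g' t"
    using smult_neg_cancelD by (simp add: tensor_eval_diff Pi)
  moreover have "tensor_eval A (\<lambda>xs. g (xs ! 0) (xs ! 1)) u = tensor_eval A g' u"
    if "u \<in> tensors 2 A" for u
    unfolding tensor_eval_def
  proof (rule add.finprod_cong')
    fix xs assume xs: "xs \<in> keys u"
    then show "lookup u xs \<odot> g (xs ! 0) (xs ! 1) = lookup u xs \<odot> g' xs"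
      using that by (simp add: tensors_def g'_def)
  qed (simp_all add: Pi g'_closed)
  ultimately show ?thesis using st by simp
qed

end

text \<open>\<open>K\<close> bounds the words that may occur. The exact keys of a tensor such as
  \<open>tensor_map e t\<close> are awkward, since terms can cancel, but they lie in an explicit
  set.\<close>

lemma lin_map_tensor_eval:
  assumes A: "k_algebra A" and B: "k_algebra B" and f: "lin_map A B f"
    and t: "keys t \<subseteq> K" and h: "\<And>xs. xs \<in> K \<Longrightarrow> h xs \<in> carrier A \<and> f (h xs) = g (map f xs)"
  shows "f (tensor_eval A h t) = tensor_eval B g (tensor_map f t)"
    and "tensor_eval A h t \<in> carrier A"
proof -
  interpret A: k_algebra A by fact
  interpret B: k_algebra B by fact
  have f0: "f \<zero>\<^bsub>A\<^esub> = \<zero>\<^bsub>B\<^esub>"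
    using lin_mapD(3)[OF f A.zero_closed, of 0] lin_mapD(1)[OF f A.zero_closed] by simp
  \<comment> \<open>The membership claims travel through the induction because additivity of
    \<open>tensor_eval\<close> presupposes values in the carrier on both supports.\<close>
  have "f (tensor_eval A h t) = tensor_eval B g (tensor_map f t) \<and> h \<in> keys t \<rightarrow> carrier A
    \<and> g \<in> keys (tensor_map f t) \<rightarrow> carrier B"
    using t
  proof (induction t rule: poly_mapping_keys_induct)
    case (add xs c s)
    have xs: "h xs \<in> carrier A" "f (h xs) = g (map f xs)" "g (map f xs) \<in> carrier B"
      using h[OF add(1)] lin_mapD(1)[OF f] by metis+
    have *: "tensor_map f (single xs c + s) = single (map f xs) c + tensor_map f s"
      by (simp add: tensor_map_def lin_add)
    have h': "h \<in> keys (single xs c) \<rightarrow> carrier A"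
      and g': "g \<in> keys (single (map f xs) c) \<rightarrow> carrier B"
      using xs by auto
    have "h \<in> keys (single xs c + s) \<rightarrow> carrier A"
      using add(3) h' by (auto dest!: subsetD[OF keys_add] split: if_splits)
    moreover have "g \<in> keys (tensor_map f (single xs c + s)) \<rightarrow> carrier B"
      unfolding * using add(3) g' by (auto dest!: subsetD[OF keys_add] split: if_splits)
    moreover have "f (tensor_eval A h (single xs c + s)) =
      tensor_eval B g (tensor_map f (single xs c + s))"
      unfolding *
      using add(3) h' g' xs lin_mapD[OF f]
      by (simp add: A.tensor_eval_add B.tensor_eval_add A.tensor_eval_single B.tensor_eval_single)
    ultimately show ?case by blast
  qed (simp add: f0 tensor_map_def)
  then show "f (tensor_eval A h t) = tensor_eval B g (tensor_map f t)" "tensor_eval A h t \<in> carrier A"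
    by auto
qed

section \<open>Images of algebras and Hopf algebras\<close>

text \<open>Apart from closure and negatives, which come from preimages, the axioms are equations
  between elements \<open>f x\<close> and are inherited from \<open>A\<close>. The unit is only
  required to be \<open>f\<close> of the unit of \<open>A\<close>, which admits images inside
  \<open>A\<close> with another unit, such as \<open>D n\<close>.\<close>

lemma k_algebra_image:
  assumes A: "k_algebra A" and f: "lin_map A B f" and surj: "f ` carrier A = carrier B"
    and mult: "\<And>x y. \<lbrakk>x \<in> carrier A; y \<in> carrier A\<rbrakk> \<Longrightarrow> f (x \<otimes>\<^bsub>A\<^esub> y) = f x \<otimes>\<^bsub>B\<^esub> f y"
    and one: "f \<one>\<^bsub>A\<^esub> = \<one>\<^bsub>B\<^esub>" and zero: "f \<zero>\<^bsub>A\<^esub> = \<zero>\<^bsub>B\<^esub>"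
  shows "k_algebra B"
proof -
  interpret A: k_algebra A by fact
  \<comment> \<open>Reversed, so that the simplifier moves the operations of \<open>B\<close> inside
    \<open>f\<close>, where the laws of \<open>A\<close> apply.\<close>
  note hom = lin_mapD(2,3)[OF f, symmetric] mult[symmetric] one[symmetric] zero[symmetric]
  have surj': "carrier B = f ` carrier A" by (simp add: surj)
  have ab: "abelian_group B"
  proof (rule abelian_groupI)
    fix x assume "x \<in> carrier B"
    then obtain x' where "x' \<in> carrier A" "x = f x'" by (auto simp: surj')
    then show "\<exists>y\<in>carrier B. y \<oplus>\<^bsub>B\<^esub> x = \<zero>\<^bsub>B\<^esub>"
      by (intro bexI[of _ "f (\<ominus>\<^bsub>A\<^esub> x')"]) (auto simp: hom surj' A.l_neg)
  qed (auto simp: hom surj' A.a_ac)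
  have ring: "ring B"
  proof (rule ringI[OF ab])
    show "monoid B"
      by (rule monoidI) (auto simp: hom surj' A.m_assoc)
  qed (auto simp: hom surj' A.l_distr A.r_distr)
  have mod: "module scalars B"
    by (rule moduleI[OF cring_scalars ab])
      (auto simp: hom surj' A.smult_add_left A.smult_add_right A.smult_smult)
  show ?thesis
    by (intro k_algebra.intro mod ring k_algebra_axioms.intro)
      (auto simp: hom surj' A.smult_mult_left A.smult_mult_right)
qed

text \<open>One factor is exchanged at a time: with the other one fixed, the product is bilinear in
  the two entries of a word.\<close>

lemma (in k_algebra) tensor_mult_eq:
  assumes "s \<in> tensors 2 A" "s' \<in> tensors 2 A" "tensor_eq A s s'"
    and "t \<in> tensors 2 A" "t' \<in> tensors 2 A" "tensor_eq A t t'"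
  shows "tensor_eq A (tensor_mult A s t) (tensor_mult A s' t')"
proof -
  let ?m = "\<lambda>x y xs. single [x \<otimes> xs ! 0, y \<otimes> xs ! 1] (1 :: 'k)"
  have eq: "tensor_mult A u v = lin (\<lambda>p. lin (?m (p ! 0) (p ! 1)) v) u"
    if u: "u \<in> tensors 2 A" and v: "v \<in> tensors 2 A" for u v :: "'a list \<Rightarrow>\<^sub>0 'k"
    unfolding tensor_mult_def
  proof (intro lin_cong)
    fix p q assume "p \<in> keys u" "q \<in> keys v"
    then obtain a b c d where "p = [a, b]" "q = [c, d]"
      using tensors_2D(4)[OF u] tensors_2D(4)[OF v] by blast
    then show "single (map2 (\<otimes>) p q) 1 = ?m (p ! 0) (p ! 1) q"
      by simp
  qed
  have "tensor_eq A (lin (\<lambda>p. lin (?m (p ! 0) (p ! 1)) t) s) (lin (\<lambda>p. lin (?m (p ! 0) (p ! 1)) t) s')"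
  proof (rule lin_tensor_eq2_tensor[where g = "\<lambda>x y. lin (?m x y) t"])
    fix x y z assume *: "x \<in> carrier A" "y \<in> carrier A" "z \<in> carrier A"
    show "tensor_eq A (lin (?m (x \<oplus> y) z) t) (lin (?m x z) t + lin (?m y z) t)"
      unfolding lin_fun_add[symmetric]
      by (rule tensor_eq_lin)
        (use * tensors_2D(2,3)[OF assms(4)] in \<open>simp add: l_distr tensor_single_add1\<close>)
    show "tensor_eq A (lin (?m z (x \<oplus> y)) t) (lin (?m z x) t + lin (?m z y) t)"
      unfolding lin_fun_add[symmetric]
      by (rule tensor_eq_lin)
        (use * tensors_2D(2,3)[OF assms(4)] in \<open>simp add: l_distr tensor_single_add2\<close>)
  next
    fix c x z assume *: "x \<in> carrier A" "z \<in> carrier A"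
    show "tensor_eq A (lin (?m (c \<odot> x) z) t) (scale c (lin (?m x z) t))"
      unfolding lin_fun_scale[symmetric]
      by (rule tensor_eq_lin)
        (use * tensors_2D(2,3)[OF assms(4)] in \<open>simp add: smult_mult_left tensor_single_smult1 del: scale_single\<close>)
    show "tensor_eq A (lin (?m z (c \<odot> x)) t) (scale c (lin (?m z x) t))"
      unfolding lin_fun_scale[symmetric]
      by (rule tensor_eq_lin)
        (use * tensors_2D(2,3)[OF assms(4)] in \<open>simp add: smult_mult_left tensor_single_smult2 del: scale_single\<close>)
  qed (use assms in auto)
  also have "tensor_eq A \<dots> (lin (\<lambda>p. lin (?m (p ! 0) (p ! 1)) t') s')"
  proof (rule tensor_eq_lin)
    fix p assume "p \<in> keys s'"
    then have p: "p ! 0 \<in> carrier A" "p ! 1 \<in> carrier A"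
      using tensors_2D(2,3)[OF assms(2)] by auto
    show "tensor_eq A (lin (?m (p ! 0) (p ! 1)) t) (lin (?m (p ! 0) (p ! 1)) t')"
    proof (rule lin_tensor_eq2_tensor[where g = "\<lambda>x y. single [p ! 0 \<otimes> x, p ! 1 \<otimes> y] 1"])
      show "tensor_eq A t t'" by fact
    qed (use p assms(4,5) in \<open>simp_all add: r_distr smult_mult_right tensor_single_bilinear del: scale_single\<close>)
  qed
  finally show ?thesis
    using assms by (simp only: eq)
qed

lemma tensor_map_mult:
  assumes mult: "\<And>x y. \<lbrakk>x \<in> carrier A; y \<in> carrier A\<rbrakk> \<Longrightarrow> f (x \<otimes>\<^bsub>A\<^esub> y) = f x \<otimes>\<^bsub>B\<^esub> f y"
    and s: "s \<in> tensors n A" and t: "t \<in> tensors n A"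
  shows "tensor_map f (tensor_mult A s t) = tensor_mult B (tensor_map f s) (tensor_map f t)"
  unfolding tensor_map_def tensor_mult_def lin_lin lin_single pm.scale_one
proof (intro lin_cong)
  fix p q assume "p \<in> keys s" "q \<in> keys t"
  then have "set p \<subseteq> carrier A" "set q \<subseteq> carrier A"
    using s t by (auto simp: tensors_def)
  then have "map f (map2 (\<otimes>\<^bsub>A\<^esub>) p q) = map2 (\<otimes>\<^bsub>B\<^esub>) (map f p) (map f q)"
    by (auto simp: zip_map_map subset_iff intro!: mult dest: set_zip_leftD set_zip_rightD)
  then show "single (map f (map2 (\<otimes>\<^bsub>A\<^esub>) p q)) 1 =
      single (map2 (\<otimes>\<^bsub>B\<^esub>) (map f p) (map f q)) 1"
    by simp
qed

lemma lin_tensor_map2: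
  assumes "t \<in> tensors 2 A"
  shows "lin (\<lambda>xs. g (xs ! 0) (xs ! 1)) (tensor_map f t) = lin (\<lambda>xs. g (f (xs ! 0)) (f (xs ! 1))) t"
  unfolding tensor_map_def lin_lin using tensors_2D(1)[OF assms]
  by (intro lin_cong) simp

text \<open>The projection \<open>e\<close> has the same fibres as \<open>f\<close>, so that \<open>T (f x) = f (S (e x))\<close> is well
  defined; being compatible with the coproduct, \<open>e\<close> turns the antipode \<open>S\<close> of \<open>A\<close> into an
  antipode \<open>T\<close> of \<open>B\<close>.\<close>

lemma hopf_algebra_image:
  fixes A :: "('k::field, 'a, 'm) bialg_scheme" and B :: "('k, 'b, 'n) bialg_scheme"
  assumes A: "hopf_algebra A" and f: "lin_map A B f" and surj: "f ` carrier A = carrier B"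
    and mult: "\<And>x y. \<lbrakk>x \<in> carrier A; y \<in> carrier A\<rbrakk> \<Longrightarrow> f (x \<otimes>\<^bsub>A\<^esub> y) = f x \<otimes>\<^bsub>B\<^esub> f y"
    and one: "f \<one>\<^bsub>A\<^esub> = \<one>\<^bsub>B\<^esub>" and zero: "f \<zero>\<^bsub>A\<^esub> = \<zero>\<^bsub>B\<^esub>"
    and e: "lin_map A A e"
    and e_comult: "\<And>x. x \<in> carrier A \<Longrightarrow> tensor_eq A (comult A (e x)) (tensor_map e (comult A x))"
    and e_counit: "\<And>x. x \<in> carrier A \<Longrightarrow> counit A (e x) = counit A x"
    and idem: "\<And>x. x \<in> carrier A \<Longrightarrow> e (e x) = e x"
    and ker: "\<And>x y. \<lbrakk>x \<in> carrier A; y \<in> carrier A\<rbrakk> \<Longrightarrow> f x = f y \<longleftrightarrow> e x = e y"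
    and counit: "\<And>x. x \<in> carrier A \<Longrightarrow> counit B (f x) = counit A x"
    and closed: "\<And>x. x \<in> carrier B \<Longrightarrow> comult B x \<in> tensors 2 B"
    and comult: "\<And>x. x \<in> carrier A \<Longrightarrow> tensor_eq B (comult B (f x)) (tensor_map f (comult A x))"
  shows "hopf_algebra B"
proof -
  interpret A: hopf_algebra A by fact
  note A_alg = A.k_algebra_axioms
  have B_alg: "k_algebra B"
    by (rule k_algebra_image[OF A_alg f surj mult one zero])
  interpret B: k_algebra B by fact
  note f_simps = lin_mapD[OF f] and e_simps = lin_mapD[OF e]
  have surj': "\<exists>y\<in>carrier A. x = f y" if "x \<in> carrier B" for x
    using that surj by auto
  have tm_closed: "tensor_map f t \<in> tensors 2 B" if "t \<in> tensors 2 A" for t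
    using that surj by (intro tensor_map_tensors) auto
  \<comment> \<open>\<open>e x\<close> and \<open>x\<close> have the same image under
    \<open>e\<close>, hence lie in the same fibre of \<open>f\<close>.\<close>
  have fe: "f (e x) = f x" if "x \<in> carrier A" for x
    using that ker[of "e x" x] idem e_simps(1) by simp

  have c_add: "tensor_eq B (comult B (x \<oplus>\<^bsub>B\<^esub> y)) (comult B x + comult B y)"
    if xy: "x \<in> carrier B" "y \<in> carrier B" for x y
  proof -
    obtain a b where ab: "a \<in> carrier A" "b \<in> carrier A" "x = f a" "y = f b"
      using xy[THEN surj'] by blast
    have "tensor_eq B (comult B (f (a \<oplus>\<^bsub>A\<^esub> b))) (tensor_map f (comult A (a \<oplus>\<^bsub>A\<^esub> b)))"
      using ab by (intro comult) simp
    also have "tensor_eq B \<dots> (tensor_map f (comult A a + comult A b))"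
      using ab by (intro tensor_map_eq[OF f] A.comult_add)
    also have "\<dots> = tensor_map f (comult A a) + tensor_map f (comult A b)"
      by (simp add: tensor_map_def lin_add)
    also have "tensor_eq B \<dots> (comult B (f a) + comult B (f b))"
      using ab by (intro tensor_eq_add comult[THEN tensor_eq_sym])
    finally show ?thesis using ab f_simps by simp
  qed
  have c_smult: "tensor_eq B (comult B (c \<odot>\<^bsub>B\<^esub> x)) (scale c (comult B x))"
    if x: "x \<in> carrier B" for c x
  proof -
    obtain a where a: "a \<in> carrier A" "x = f a"
      using x[THEN surj'] by blast
    have "tensor_eq B (comult B (f (c \<odot>\<^bsub>A\<^esub> a))) (tensor_map f (comult A (c \<odot>\<^bsub>A\<^esub> a)))"
      using a by (intro comult) simp
    also have "tensor_eq B \<dots> (tensor_map f (scale c (comult A a)))"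
      using a by (intro tensor_map_eq[OF f] A.comult_smult)
    also have "\<dots> = scale c (tensor_map f (comult A a))"
      by (simp add: tensor_map_def lin_scale)
    also have "tensor_eq B \<dots> (scale c (comult B (f a)))"
      using a by (intro tensor_eq_scale comult[THEN tensor_eq_sym])
    finally show ?thesis using a f_simps by simp
  qed
  have cu_add: "counit B (x \<oplus>\<^bsub>B\<^esub> y) = counit B x + counit B y"
    if xy: "x \<in> carrier B" "y \<in> carrier B" for x y
  proof -
    obtain a b where ab: "a \<in> carrier A" "b \<in> carrier A" "x = f a" "y = f b"
      using xy[THEN surj'] by blast
    then show ?thesis
      using counit[of "a \<oplus>\<^bsub>A\<^esub> b"] by (simp add: f_simps counit A.counit_add)
  qed
  have cu_smult: "counit B (c \<odot>\<^bsub>B\<^esub> x) = c * counit B x" if x: "x \<in> carrier B" for c x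
  proof -
    obtain a where a: "a \<in> carrier A" "x = f a"
      using x[THEN surj'] by blast
    then show ?thesis
      using counit[of "c \<odot>\<^bsub>A\<^esub> a"] by (simp add: f_simps counit A.counit_smult)
  qed
  \<comment> \<open>\<open>comult B (f a)\<close> is known only up to equality of tensors;
    evaluations of bilinear expressions do not see the difference.\<close>
  have eval: "tensor_eval B (\<lambda>xs. g (xs ! 0) (xs ! 1)) (comult B (f a)) =
      tensor_eval B (\<lambda>xs. g (xs ! 0) (xs ! 1)) (tensor_map f (comult A a))"
    if "a \<in> carrier A"
      and "\<And>x y. \<lbrakk>x \<in> carrier B; y \<in> carrier B\<rbrakk> \<Longrightarrow> g x y \<in> carrier B"
      and "\<And>x y z. \<lbrakk>x \<in> carrier B; y \<in> carrier B; z \<in> carrier B\<rbrakk> \<Longrightarrow> g (x \<oplus>\<^bsub>B\<^esub> y) z = g x z \<oplus>\<^bsub>B\<^esub> g y z"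
      and "\<And>x y z. \<lbrakk>x \<in> carrier B; y \<in> carrier B; z \<in> carrier B\<rbrakk> \<Longrightarrow> g z (x \<oplus>\<^bsub>B\<^esub> y) = g z x \<oplus>\<^bsub>B\<^esub> g z y"
      and "\<And>c x z. \<lbrakk>x \<in> carrier B; z \<in> carrier B\<rbrakk> \<Longrightarrow> g (c \<odot>\<^bsub>B\<^esub> x) z = c \<odot>\<^bsub>B\<^esub> g x z"
      and "\<And>c x z. \<lbrakk>x \<in> carrier B; z \<in> carrier B\<rbrakk> \<Longrightarrow> g z (c \<odot>\<^bsub>B\<^esub> x) = c \<odot>\<^bsub>B\<^esub> g z x" for g a
    by (rule B.tensor_eval_eq2[where g = g])
      (use that comult closed tm_closed A.comult_closed f_simps in auto)
  have smult_commute: "d \<odot>\<^bsub>B\<^esub> (c \<odot>\<^bsub>B\<^esub> z) = c \<odot>\<^bsub>B\<^esub> (d \<odot>\<^bsub>B\<^esub> z)" if "z \<in> carrier B" for c d z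
    using that by (simp add: B.smult_smult[symmetric] mult.commute)

  have bialg: "bialgebra B"
  proof (rule bialgebra.intro[OF B_alg bialgebra_axioms.intro])
    fix x assume "x \<in> carrier B"
    then obtain a where a: "a \<in> carrier A" "x = f a"
      using surj' by blast
    let ?\<Delta> = "comult A a"
    have \<Delta>: "?\<Delta> \<in> tensors 2 A" using a by (simp add: A.comult_closed)
    note \<Delta>2 = tensors_2D[OF \<Delta>]
    let ?L = "tensor_eval B (\<lambda>xs. counit B (xs ! 0) \<odot>\<^bsub>B\<^esub> xs ! 1)"
    have "?L (comult B (f a)) = ?L (tensor_map f ?\<Delta>)"
      using a by (intro eval[where g = "\<lambda>x y. counit B x \<odot>\<^bsub>B\<^esub> y"])
        (auto simp: cu_add cu_smult B.smult_add_left B.smult_add_right B.smult_smult smult_commute)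
    also have "\<dots> = f (tensor_eval A (\<lambda>xs. counit A (xs ! 0) \<odot>\<^bsub>A\<^esub> xs ! 1) ?\<Delta>)"
      using \<Delta>2 by (intro lin_map_tensor_eval(1)[OF A_alg B_alg f subset_refl, symmetric])
        (auto simp: f_simps counit)
    finally show "?L (comult B x) = x"
      by (simp only: a A.counit_left)
    let ?R = "tensor_eval B (\<lambda>xs. counit B (xs ! 1) \<odot>\<^bsub>B\<^esub> xs ! 0)"
    have "?R (comult B (f a)) = ?R (tensor_map f ?\<Delta>)"
      using a by (intro eval[where g = "\<lambda>x y. counit B y \<odot>\<^bsub>B\<^esub> x"])
        (auto simp: cu_add cu_smult B.smult_add_left B.smult_add_right B.smult_smult smult_commute)
    also have "\<dots> = f (tensor_eval A (\<lambda>xs. counit A (xs ! 1) \<odot>\<^bsub>A\<^esub> xs ! 0) ?\<Delta>)"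
      using \<Delta>2 by (intro lin_map_tensor_eval(1)[OF A_alg B_alg f subset_refl, symmetric])
        (auto simp: f_simps counit)
    finally show "?R (comult B x) = x"
      by (simp only: a A.counit_right)

    have cat_left: "set q \<subseteq> carrier B \<Longrightarrow> x \<in> carrier B \<Longrightarrow> y \<in> carrier B \<Longrightarrow>
        tensor_eq B (tensor_cat (comult B (x \<oplus>\<^bsub>B\<^esub> y)) (single q 1))
          (tensor_cat (comult B x) (single q 1) + tensor_cat (comult B y) (single q 1))"
      "set q \<subseteq> carrier B \<Longrightarrow> x \<in> carrier B \<Longrightarrow>
        tensor_eq B (tensor_cat (comult B (c \<odot>\<^bsub>B\<^esub> x)) (single q 1))
          (scale c (tensor_cat (comult B x) (single q 1)))" for q x y c
      unfolding tensor_cat_add_left[symmetric] tensor_cat_scale_left[symmetric]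
      by (intro tensor_cat_eq_left c_add c_smult; assumption)+
    have cat_right: "set q \<subseteq> carrier B \<Longrightarrow> x \<in> carrier B \<Longrightarrow> y \<in> carrier B \<Longrightarrow>
        tensor_eq B (tensor_cat (single q 1) (comult B (x \<oplus>\<^bsub>B\<^esub> y)))
          (tensor_cat (single q 1) (comult B x) + tensor_cat (single q 1) (comult B y))"
      "set q \<subseteq> carrier B \<Longrightarrow> x \<in> carrier B \<Longrightarrow>
        tensor_eq B (tensor_cat (single q 1) (comult B (c \<odot>\<^bsub>B\<^esub> x)))
          (scale c (tensor_cat (single q 1) (comult B x)))" for q x y c
      unfolding tensor_cat_add_right[symmetric] tensor_cat_scale_right[symmetric]
      by (intro tensor_cat_eq_right c_add c_smult; assumption)+
    let ?s = "\<lambda>x. single [x] (1 :: 'k)"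
    \<comment> \<open>The outer coproduct is replaced by the image of \<open>?\<Delta>\<close>, then
      the inner one by the image of a coproduct of \<open>A\<close>; coassociativity of
      \<open>A\<close> applies, and the replacements are undone.\<close>
    have "tensor_eq B (lin (\<lambda>xs. tensor_cat (comult B (xs ! 0)) (?s (xs ! 1))) (comult B (f a)))
      (lin (\<lambda>xs. tensor_cat (comult B (xs ! 0)) (?s (xs ! 1))) (tensor_map f ?\<Delta>))"
    proof (rule lin_tensor_eq2_tensor[where g = "\<lambda>x y. tensor_cat (comult B x) (?s y)"])
      show "comult B (f a) \<in> tensors 2 B" "tensor_map f ?\<Delta> \<in> tensors 2 B"
        "tensor_eq B (comult B (f a)) (tensor_map f ?\<Delta>)"
        using a \<Delta> closed tm_closed comult f_simps by auto
    qed (simp_all add: cat_left tensor_cat_single_right_bilinear[OF closed])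
    also have "\<dots> = lin (\<lambda>xs. tensor_cat (comult B (f (xs ! 0))) (?s (f (xs ! 1)))) ?\<Delta>"
      by (rule lin_tensor_map2[OF \<Delta>])
    also have "tensor_eq B \<dots> (lin (\<lambda>xs. tensor_cat (tensor_map f (comult A (xs ! 0))) (?s (f (xs ! 1)))) ?\<Delta>)"
      using \<Delta>2 by (intro tensor_eq_lin tensor_cat_eq_left comult) (auto simp: f_simps)
    also have "\<dots> = tensor_map f (lin (\<lambda>xs. tensor_cat (comult A (xs ! 0)) (?s (xs ! 1))) ?\<Delta>)"
      by (simp add: tensor_map_def lin_lin tensor_cat_def)
    also have "tensor_eq B \<dots> (tensor_map f (lin (\<lambda>xs. tensor_cat (?s (xs ! 0)) (comult A (xs ! 1))) ?\<Delta>))"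
      using a by (intro tensor_map_eq[OF f] A.coassoc)
    also have "\<dots> = lin (\<lambda>xs. tensor_cat (?s (f (xs ! 0))) (tensor_map f (comult A (xs ! 1)))) ?\<Delta>"
      by (simp add: tensor_map_def lin_lin tensor_cat_def)
    also have "tensor_eq B \<dots> (lin (\<lambda>xs. tensor_cat (?s (f (xs ! 0))) (comult B (f (xs ! 1)))) ?\<Delta>)"
      using \<Delta>2 by (intro tensor_eq_lin tensor_cat_eq_right comult[THEN tensor_eq_sym]) (auto simp: f_simps)
    also have "\<dots> = lin (\<lambda>xs. tensor_cat (?s (xs ! 0)) (comult B (xs ! 1))) (tensor_map f ?\<Delta>)"
      by (rule lin_tensor_map2[OF \<Delta>, symmetric])
    also have "tensor_eq B \<dots> (lin (\<lambda>xs. tensor_cat (?s (xs ! 0)) (comult B (xs ! 1))) (comult B (f a)))"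
    proof (rule lin_tensor_eq2_tensor[where g = "\<lambda>x y. tensor_cat (?s x) (comult B y)"])
      show "comult B (f a) \<in> tensors 2 B" "tensor_map f ?\<Delta> \<in> tensors 2 B"
        "tensor_eq B (tensor_map f ?\<Delta>) (comult B (f a))"
        using a \<Delta> closed tm_closed comult[THEN tensor_eq_sym] f_simps by auto
    qed (simp_all add: cat_right tensor_cat_single_left_bilinear[OF closed])
    finally show "tensor_eq B
      (lin (\<lambda>xs. tensor_cat (comult B (xs ! 0)) (single [xs ! 1] 1)) (comult B x))
      (lin (\<lambda>xs. tensor_cat (single [xs ! 0] 1) (comult B (xs ! 1))) (comult B x))"
      by (simp only: a)
  next
    have "tensor_eq B (comult B (f \<one>\<^bsub>A\<^esub>)) (tensor_map f (comult A \<one>\<^bsub>A\<^esub>))"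
      by (rule comult) simp
    also have "tensor_eq B \<dots> (tensor_map f (single [\<one>\<^bsub>A\<^esub>, \<one>\<^bsub>A\<^esub>] 1))"
      by (rule tensor_map_eq[OF f A.comult_one])
    finally show "tensor_eq B (comult B \<one>\<^bsub>B\<^esub>) (single [\<one>\<^bsub>B\<^esub>, \<one>\<^bsub>B\<^esub>] 1)"
      by (simp add: tensor_map_def one)
    show "counit B \<one>\<^bsub>B\<^esub> = 1"
      using counit[of "\<one>\<^bsub>A\<^esub>"] A.counit_one by (simp add: one)
  next
    fix x y assume xy: "x \<in> carrier B" "y \<in> carrier B"
    obtain a b where ab: "a \<in> carrier A" "b \<in> carrier A" "x = f a" "y = f b"
      using xy[THEN surj'] by blast
    then show "counit B (x \<otimes>\<^bsub>B\<^esub> y) = counit B x * counit B y"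
      using counit[of "a \<otimes>\<^bsub>A\<^esub> b"] by (simp add: mult counit A.counit_mult)
    have "tensor_eq B (comult B (f (a \<otimes>\<^bsub>A\<^esub> b))) (tensor_map f (comult A (a \<otimes>\<^bsub>A\<^esub> b)))"
      using ab by (intro comult) simp
    also have "tensor_eq B \<dots> (tensor_map f (tensor_mult A (comult A a) (comult A b)))"
      using ab by (intro tensor_map_eq[OF f] A.comult_mult)
    also have "\<dots> = tensor_mult B (tensor_map f (comult A a)) (tensor_map f (comult A b))"
      using ab by (intro tensor_map_mult[OF mult, where n = 2] A.comult_closed)
    also have "tensor_eq B \<dots> (tensor_mult B (comult B (f a)) (comult B (f b)))"
      using ab by (intro B.tensor_mult_eq tm_closed closed comult[THEN tensor_eq_sym] A.comult_closed f_simps)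
    finally show "tensor_eq B (comult B (x \<otimes>\<^bsub>B\<^esub> y)) (tensor_mult B (comult B x) (comult B y))"
      using ab by (simp add: mult)
  qed (fact closed c_add c_smult cu_add cu_smult)+
  interpret B: bialgebra B by fact

  obtain S where "antipode A S" using A.antipode_exists by blast
  then have S: "\<And>x. x \<in> carrier A \<Longrightarrow> S x \<in> carrier A"
    "\<And>x y. x \<in> carrier A \<Longrightarrow> y \<in> carrier A \<Longrightarrow> S (x \<oplus>\<^bsub>A\<^esub> y) = S x \<oplus>\<^bsub>A\<^esub> S y"
    "\<And>c x. x \<in> carrier A \<Longrightarrow> S (c \<odot>\<^bsub>A\<^esub> x) = c \<odot>\<^bsub>A\<^esub> S x"
    and S_left: "\<And>x. x \<in> carrier A \<Longrightarrow>
      tensor_eval A (\<lambda>xs. S (xs ! 0) \<otimes>\<^bsub>A\<^esub> xs ! 1) (comult A x) = counit A x \<odot>\<^bsub>A\<^esub> \<one>\<^bsub>A\<^esub>"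
    and S_right: "\<And>x. x \<in> carrier A \<Longrightarrow>
      tensor_eval A (\<lambda>xs. xs ! 0 \<otimes>\<^bsub>A\<^esub> S (xs ! 1)) (comult A x) = counit A x \<odot>\<^bsub>A\<^esub> \<one>\<^bsub>A\<^esub>"
    unfolding antipode_def by blast+
  define T where "T = (\<lambda>y. f (S (e (SOME x. x \<in> carrier A \<and> f x = y))))"
  have T: "T (f x) = f (S (e x))" if x: "x \<in> carrier A" for x
  proof -
    have "\<exists>z. z \<in> carrier A \<and> f z = f x" using x by blast
    from someI_ex[OF this] show ?thesis
      unfolding T_def using ker x by metis
  qed
  \<comment> \<open>\<open>T (f x) = f (S (e x))\<close> puts \<open>e\<close> on one leg. Since
    \<open>f \<circ> e = f\<close>, it may be put on the other leg as well, and both copies are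
    absorbed into \<open>comult A (e a)\<close>, where the antipode law of \<open>A\<close>
    applies.\<close>
  have T_eval: "tensor_eval B (\<lambda>xs. h (xs ! 0) (xs ! 1)) (tensor_map f (comult A a)) =
      f (tensor_eval A (\<lambda>xs. g (xs ! 0) (xs ! 1)) (comult A (e a)))"
    if a: "a \<in> carrier A"
      and g: "\<And>x y. \<lbrakk>x \<in> carrier A; y \<in> carrier A\<rbrakk> \<Longrightarrow> g x y \<in> carrier A"
      and add1: "\<And>x y z. \<lbrakk>x \<in> carrier A; y \<in> carrier A; z \<in> carrier A\<rbrakk> \<Longrightarrow> g (x \<oplus>\<^bsub>A\<^esub> y) z = g x z \<oplus>\<^bsub>A\<^esub> g y z"
      and add2: "\<And>x y z. \<lbrakk>x \<in> carrier A; y \<in> carrier A; z \<in> carrier A\<rbrakk> \<Longrightarrow> g z (x \<oplus>\<^bsub>A\<^esub> y) = g z x \<oplus>\<^bsub>A\<^esub> g z y"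
      and smult1: "\<And>c x z. \<lbrakk>x \<in> carrier A; z \<in> carrier A\<rbrakk> \<Longrightarrow> g (c \<odot>\<^bsub>A\<^esub> x) z = c \<odot>\<^bsub>A\<^esub> g x z"
      and smult2: "\<And>c x z. \<lbrakk>x \<in> carrier A; z \<in> carrier A\<rbrakk> \<Longrightarrow> g z (c \<odot>\<^bsub>A\<^esub> x) = c \<odot>\<^bsub>A\<^esub> g z x"
      and fg: "\<And>x y. \<lbrakk>x \<in> carrier A; y \<in> carrier A\<rbrakk> \<Longrightarrow> f (g (e x) (e y)) = h (f x) (f y)" for a g h
  proof -
    have \<Delta>: "comult A a \<in> tensors 2 A" using a by (rule A.comult_closed)
    note \<Delta>2 = tensors_2D[OF \<Delta>]
    have e\<Delta>: "tensor_map e (comult A a) \<in> tensors 2 A"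
      using \<Delta> e_simps(1) by (intro tensor_map_tensors) auto
    let ?K = "{map e xs | xs. xs \<in> keys (comult A a)}"
    have "tensor_eval A (\<lambda>xs. g (xs ! 0) (xs ! 1)) (comult A (e a)) =
        tensor_eval A (\<lambda>xs. g (xs ! 0) (xs ! 1)) (tensor_map e (comult A a))"
      by (rule A.tensor_eval_eq2[OF g add1 add2 smult1 smult2])
        (use a e\<Delta> in \<open>simp_all add: A.comult_closed e_comult e_simps\<close>)
    moreover have "f (tensor_eval A (\<lambda>xs. g (xs ! 0) (xs ! 1)) (tensor_map e (comult A a))) =
        tensor_eval B (\<lambda>xs. h (xs ! 0) (xs ! 1)) (tensor_map f (tensor_map e (comult A a)))"
    proof (rule lin_map_tensor_eval(1)[OF A_alg B_alg f])
      show "keys (tensor_map e (comult A a)) \<subseteq> ?K"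
        unfolding tensor_map_def by (rule order_trans[OF keys_lin]) auto
    next
      fix xs assume "xs \<in> ?K"
      then obtain ys where ys: "ys \<in> keys (comult A a)" "xs = map e ys" by blast
      show "g (xs ! 0) (xs ! 1) \<in> carrier A \<and> f (g (xs ! 0) (xs ! 1)) = h (map f xs ! 0) (map f xs ! 1)"
        using \<Delta>2(1-3)[OF ys(1)] g fg fe e_simps(1) unfolding ys(2) by simp
    qed
    moreover have "tensor_map f (tensor_map e (comult A a)) = tensor_map f (comult A a)"
      unfolding tensor_map_map by (rule tensor_map_cong[OF \<Delta>]) (simp add: fe)
    ultimately show ?thesis by simp
  qed
  have "antipode B T"
    unfolding antipode_def
  proof (intro conjI ballI allI)
    show "T \<in> carrier B \<rightarrow> carrier B"
      by (auto simp: T S f_simps e_simps dest!: surj')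
    fix x assume "x \<in> carrier B"
    then obtain a where a: "a \<in> carrier A" "x = f a"
      using surj' by blast
    have T_add: "T (x \<oplus>\<^bsub>B\<^esub> y) = T x \<oplus>\<^bsub>B\<^esub> T y" if xy: "x \<in> carrier B" "y \<in> carrier B" for x y
    proof -
      obtain a b where ab: "a \<in> carrier A" "b \<in> carrier A" "x = f a" "y = f b"
        using xy[THEN surj'] by blast
      then show ?thesis
        using T[of "a \<oplus>\<^bsub>A\<^esub> b"] by (simp add: T S f_simps e_simps)
    qed
    then show "T (x \<oplus>\<^bsub>B\<^esub> y) = T x \<oplus>\<^bsub>B\<^esub> T y" if "y \<in> carrier B" for y
      using \<open>x \<in> carrier B\<close> that by blast
    have T_smult: "T (c \<odot>\<^bsub>B\<^esub> x) = c \<odot>\<^bsub>B\<^esub> T x" if x: "x \<in> carrier B" for c x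
    proof -
      obtain a where "a \<in> carrier A" "x = f a"
        using x[THEN surj'] by blast
      then show ?thesis
        using T[of "c \<odot>\<^bsub>A\<^esub> a"] by (simp add: T S f_simps e_simps)
    qed
    then show "T (c \<odot>\<^bsub>B\<^esub> x) = c \<odot>\<^bsub>B\<^esub> T x" for c
      using \<open>x \<in> carrier B\<close> by blast
    have T_closed: "T x \<in> carrier B" if "x \<in> carrier B" for x
      using that by (auto simp: T S f_simps e_simps dest!: surj')
    have unit: "f (counit A (e a) \<odot>\<^bsub>A\<^esub> \<one>\<^bsub>A\<^esub>) = counit B x \<odot>\<^bsub>B\<^esub> \<one>\<^bsub>B\<^esub>"
      using a by (simp add: f_simps e_counit counit one)
    let ?L = "tensor_eval B (\<lambda>xs. T (xs ! 0) \<otimes>\<^bsub>B\<^esub> xs ! 1)"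
    have "?L (comult B (f a)) = ?L (tensor_map f (comult A a))"
      using a by (intro eval[where g = "\<lambda>x y. T x \<otimes>\<^bsub>B\<^esub> y"])
        (auto simp: T_add T_smult T_closed B.l_distr B.r_distr B.smult_mult_left B.smult_mult_right)
    also have "\<dots> = f (tensor_eval A (\<lambda>xs. S (xs ! 0) \<otimes>\<^bsub>A\<^esub> xs ! 1) (comult A (e a)))"
      using a by (intro T_eval[where h = "\<lambda>x y. T x \<otimes>\<^bsub>B\<^esub> y" and g = "\<lambda>x y. S x \<otimes>\<^bsub>A\<^esub> y"])
        (auto simp: S A.l_distr A.r_distr A.smult_mult_left A.smult_mult_right mult T fe e_simps f_simps idem)
    finally show "?L (comult B x) = counit B x \<odot>\<^bsub>B\<^esub> \<one>\<^bsub>B\<^esub>"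
      by (simp only: S_left e_simps a unit)
    let ?R = "tensor_eval B (\<lambda>xs. xs ! 0 \<otimes>\<^bsub>B\<^esub> T (xs ! 1))"
    have "?R (comult B (f a)) = ?R (tensor_map f (comult A a))"
      using a by (intro eval[where g = "\<lambda>x y. x \<otimes>\<^bsub>B\<^esub> T y"])
        (auto simp: T_add T_smult T_closed B.l_distr B.r_distr B.smult_mult_left B.smult_mult_right)
    also have "\<dots> = f (tensor_eval A (\<lambda>xs. xs ! 0 \<otimes>\<^bsub>A\<^esub> S (xs ! 1)) (comult A (e a)))"
      using a by (intro T_eval[where h = "\<lambda>x y. x \<otimes>\<^bsub>B\<^esub> T y" and g = "\<lambda>x y. x \<otimes>\<^bsub>A\<^esub> S y"])
        (auto simp: S A.l_distr A.r_distr A.smult_mult_left A.smult_mult_right mult T fe e_simps f_simps idem)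
    finally show "?R (comult B x) = counit B x \<odot>\<^bsub>B\<^esub> \<one>\<^bsub>B\<^esub>"
      by (simp only: S_right e_simps a unit)
  qed
  then show ?thesis
    by (intro hopf_algebra.intro bialg hopf_algebra_axioms.intro) blast
qed

section \<open>Packing and shuffles\<close>

text \<open>The alphabet is a parameter so that a subword can be ranked within the alphabet of the
  whole word.\<close>

definition rank :: "'a::linorder set \<Rightarrow> 'a \<Rightarrow> nat"
  where "rank A a = card {b \<in> A. b \<le> a}"

lemma pack_eq_map_rank: "pack w = map (rank (set w)) w"
  by (simp add: pack_def rank_def)

lemma rank_less: "finite A \<Longrightarrow> b \<in> A \<Longrightarrow> a < b \<Longrightarrow> rank A a < rank A b"
proof -
  assume "finite A" "b \<in> A" "a < b"
  then have "b \<in> {c \<in> A. c \<le> b}" "b \<notin> {c \<in> A. c \<le> a}" "{c \<in> A. c \<le> a} \<subseteq> {c \<in> A. c \<le> b}"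
    by auto
  then show ?thesis
    unfolding rank_def using \<open>finite A\<close> by (intro psubset_card_mono psubsetI) auto
qed

lemma rank_le: "finite A \<Longrightarrow> a \<le> b \<Longrightarrow> rank A a \<le> rank A b"
  unfolding rank_def by (intro card_mono) auto

lemma inj_on_rank: "finite A \<Longrightarrow> inj_on (rank A) A"
  by (rule inj_onI) (metis rank_less less_irrefl linorder_neqE)

lemma rank_image: assumes "finite A" shows "rank A ` A = {1..card A}"
proof (rule card_subset_eq)
  show "rank A ` A \<subseteq> {1..card A}"
    using assms by (auto simp: rank_def Suc_le_eq card_gt_0_iff intro: card_mono)
  show "card (rank A ` A) = card {1..card A}"
    using assms by (simp add: card_image inj_on_rank)
qed simp

lemma length_pack [simp]: "length (pack w) = length w"
  by (simp add: pack_def)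

lemma pack_Nil [simp]: "pack [] = []"
  by (simp add: pack_def)

lemma pack_eq_Nil_iff [simp]: "pack w = [] \<longleftrightarrow> w = []"
  by (simp add: pack_def)

lemma set_pack: "set (pack w) = {1..card (set w)}"
  by (simp add: pack_eq_map_rank rank_image)

lemma wmax_eq: "set u = {1..m} \<Longrightarrow> wmax u = m"
  unfolding wmax_def by (rule Max_eqI) auto

lemma wmax_pack [simp]: "wmax (pack w) = card (set w)"
  by (rule wmax_eq[OF set_pack])

lemma packed_pack [simp]: "packed (pack w)"
  unfolding packed_def by (simp add: set_pack)

lemma set_packed: "packed u \<Longrightarrow> set u = {1..wmax u}"
  by (simp add: packed_def)

lemma packedI: "set u = {1..m} \<Longrightarrow> packed u"
  using wmax_eq[of u m] by (simp add: packed_def)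

lemma packed_Nil [simp]: "packed []"
  by (rule packedI[of _ 0]) simp

lemma wmax_Nil [simp]: "wmax [] = 0"
  by (simp add: wmax_def)

lemma rank_map:
  assumes "finite A" and mono: "\<And>a b. a \<in> A \<Longrightarrow> b \<in> A \<Longrightarrow> a < b \<Longrightarrow> f a < f b" and "a \<in> A"
  shows "rank (f ` A) (f a) = rank A a"
proof -
  have less_iff: "f c < f d \<longleftrightarrow> c < d" if "c \<in> A" "d \<in> A" for c d
    using mono that by (metis less_asym linorder_cases)
  then have le_iff: "f c \<le> f d \<longleftrightarrow> c \<le> d" if "c \<in> A" "d \<in> A" for c d
    using that by (metis linorder_not_less)
  have inj: "inj_on f A"
    by (rule inj_onI) (metis less_iff less_irrefl linorder_neqE)
  have "{b \<in> f ` A. b \<le> f a} = f ` {b \<in> A. b \<le> a}"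
    using le_iff \<open>a \<in> A\<close> by auto
  moreover have "inj_on f {b \<in> A. b \<le> a}"
    using inj by (rule inj_on_subset) auto
  ultimately show ?thesis
    by (simp add: rank_def card_image)
qed

text \<open>Ranks depend only on the relative order of the letters. Many identities below come from
  exhibiting a strictly increasing relabelling.\<close>

lemma pack_map:
  assumes "\<And>a b. a \<in> set w \<Longrightarrow> b \<in> set w \<Longrightarrow> a < b \<Longrightarrow> f a < f b"
  shows "pack (map f w) = pack w"
  unfolding pack_eq_map_rank using rank_map[OF finite_set, of w f] assms by simp

lemma pack_map_rank:
  assumes "finite A" "set v \<subseteq> A"
  shows "pack (map (rank A) v) = pack v"
  using assms by (intro pack_map rank_less) auto

lemma pack_packed: assumes "packed u" shows "pack u = u"
proof -
  have "{b \<in> {1..wmax u}. b \<le> a} = {1..a}" if "a \<in> {1..wmax u}" for a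
    using that by auto
  then show ?thesis
    using set_packed[OF assms] by (auto simp: pack_def intro!: map_idI)
qed

lemma pack_pack [simp]: "pack (pack w) = pack w"
  by (simp add: pack_packed)

lemma pack_take_pack [simp]: "pack (take i (pack w)) = pack (take i w)"
  unfolding pack_eq_map_rank[of w] take_map by (rule pack_map_rank) (auto dest: in_set_takeD)

lemma pack_drop_pack [simp]: "pack (drop i (pack w)) = pack (drop i w)"
  unfolding pack_eq_map_rank[of w] drop_map by (rule pack_map_rank) (auto dest: in_set_dropD)

section \<open>Shuffles of words over disjoint alphabets\<close>

lemma map_shuffles: "map f ` shuffles x y = shuffles (map f x) (map f y)"
proof (induction x y rule: shuffles.induct)
  case (3 x xs y ys)
  show ?case using 3[symmetric] by (simp add: image_Un image_image)
qed simp_all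

text \<open>Filtering by a predicate that separates the alphabets recovers the two factors; the
  reindexings of sums over shuffles rest on this.\<close>

lemma in_shuffles_iff:
  assumes "\<And>a. a \<in> set x \<Longrightarrow> P a" "\<And>b. b \<in> set y \<Longrightarrow> \<not> P b"
  shows "s \<in> shuffles x y \<longleftrightarrow> filter P s = x \<and> filter (\<lambda>a. \<not> P a) s = y"
proof -
  have "List.partition P -` {(x, y)} = shuffles x y"
    by (rule inv_image_partition) (use assms in auto)
  then show ?thesis by (auto simp: set_eq_iff vimage_def o_def)
qed

text \<open>Disjointness of the alphabets makes the decomposition of a shuffle unique.\<close>

lemma sum_shuffles_assoc:
  assumes xy: "set x \<inter> set y = {}" and xz: "set x \<inter> set z = {}" and yz: "set y \<inter> set z = {}"
  shows "(\<Sum>w\<in>shuffles x y. \<Sum>s\<in>shuffles w z. g s) = (\<Sum>w\<in>shuffles y z. \<Sum>s\<in>shuffles x w. g s :: 'b::comm_monoid_add)"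
proof -
  have set1: "set w = set x \<union> set y" if "w \<in> shuffles x y" for w
    using that by (rule set_shuffles)
  have set2: "set w = set y \<union> set z" if "w \<in> shuffles y z" for w
    using that by (rule set_shuffles)
  have iff1: "s \<in> shuffles w z \<longleftrightarrow> filter (\<lambda>a. a \<notin> set z) s = w \<and> filter (\<lambda>a. a \<in> set z) s = z"
    if "w \<in> shuffles x y" for s w
    using in_shuffles_iff[of w "\<lambda>a. a \<notin> set z" z s] set1[OF that] xz yz by auto
  have iff2: "s \<in> shuffles x w \<longleftrightarrow> filter (\<lambda>a. a \<in> set x) s = x \<and> filter (\<lambda>a. a \<notin> set x) s = w"
    if "w \<in> shuffles y z" for s w
    using in_shuffles_iff[of x "\<lambda>a. a \<in> set x" w s] set2[OF that] xy xz by auto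
  have iff3: "w \<in> shuffles x y \<longleftrightarrow> filter (\<lambda>a. a \<in> set x) w = x \<and> filter (\<lambda>a. a \<notin> set x) w = y" for w
    using in_shuffles_iff[of x "\<lambda>a. a \<in> set x" y w] xy by auto
  have iff4: "w \<in> shuffles y z \<longleftrightarrow> filter (\<lambda>a. a \<notin> set z) w = y \<and> filter (\<lambda>a. a \<in> set z) w = z" for w
    using in_shuffles_iff[of y "\<lambda>a. a \<notin> set z" z w] yz by auto
  have f1: "filter (\<lambda>a. a \<notin> set z \<and> a \<in> set x) s = filter (\<lambda>a. a \<in> set x) s" for s
    using xz by (intro filter_cong) auto
  have f2: "filter (\<lambda>a. a \<notin> set x \<and> a \<in> set z) s = filter (\<lambda>a. a \<in> set z) s" for s
    using xz by (intro filter_cong) auto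
  have f3: "filter (\<lambda>a. a \<notin> set z \<and> a \<notin> set x) s = filter (\<lambda>a. a \<notin> set x \<and> a \<notin> set z) s" for s
    by (intro filter_cong) auto
  have p1: "s \<in> shuffles x (filter (\<lambda>a. a \<notin> set x) s)" if "filter (\<lambda>a. a \<in> set x) s = x" for s
    using partition_in_shuffles[of s "\<lambda>a. a \<in> set x"] that by simp
  have p2: "s \<in> shuffles (filter (\<lambda>a. a \<notin> set z) s) z" if "filter (\<lambda>a. a \<in> set z) s = z" for s
    using partition_in_shuffles[of s "\<lambda>a. a \<in> set z"] that by (simp add: shuffles_commutes)
  have "(\<Sum>w\<in>shuffles x y. \<Sum>s\<in>shuffles w z. g s) = (\<Sum>(w, s)\<in>Sigma (shuffles x y) (\<lambda>w. shuffles w z). g s)"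
    by (rule sum.Sigma) auto
  also have "\<dots> = (\<Sum>(w, s)\<in>Sigma (shuffles y z) (\<lambda>w. shuffles x w). g s)"
    \<comment> \<open>The final word \<open>s\<close> is kept; deleting from it the letters of
      \<open>x\<close>, or those of \<open>z\<close>, gives the intermediate word of the other
      bracketing.\<close>
    by (rule sum.reindex_bij_witness[where j = "\<lambda>(w, s). (filter (\<lambda>a. a \<notin> set x) s, s)"
        and i = "\<lambda>(w, s). (filter (\<lambda>a. a \<notin> set z) s, s)"])
      (auto simp: iff1 iff2, auto simp: iff3 iff4 f1 f2 f3 p1 p2)
  also have "\<dots> = (\<Sum>w\<in>shuffles y z. \<Sum>s\<in>shuffles x w. g s)"
    by (rule sum.Sigma[symmetric]) auto
  finally show ?thesis .
qed

text \<open>A cut of a shuffle cuts \<open>x\<close> and \<open>y\<close> after the letters that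
  each has contributed so far, \<open>j\<close> and \<open>k\<close> in number. Conversely, shuffles
  of the two front parts and of the two back parts are concatenated, and the cut is the length of
  the first.\<close>

lemma sum_shuffles_split:
  assumes P: "\<And>a. a \<in> set x \<Longrightarrow> P a" "\<And>b. b \<in> set y \<Longrightarrow> \<not> P b"
  shows "(\<Sum>w\<in>shuffles x y. \<Sum>i\<le>length w. g (take i w) (drop i w)) =
    (\<Sum>j\<le>length x. \<Sum>k\<le>length y. \<Sum>a\<in>shuffles (take j x) (take k y).
      \<Sum>b\<in>shuffles (drop j x) (drop k y). g a b :: 'b::comm_monoid_add)"
proof -
  let ?L = "Sigma (shuffles x y) (\<lambda>w. {..length w})"
  let ?R = "Sigma {..length x} (\<lambda>j. Sigma {..length y} (\<lambda>k. shuffles (take j x) (take k y) \<times> shuffles (drop j x) (drop k y)))"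
  let ?Q = "\<lambda>a. \<not> P a"
  let ?j = "\<lambda>(w, i). (length (filter P (take i w)), length (filter ?Q (take i w)), take i w, drop i w)"
    and ?i = "\<lambda>(j, k, a, b). (a @ b, length a)"
  have iff: "w \<in> shuffles x y \<longleftrightarrow> filter P w = x \<and> filter ?Q w = y" for w
    by (rule in_shuffles_iff) (use P in auto)
  have iff1: "w \<in> shuffles (take j x) (take k y) \<longleftrightarrow> filter P w = take j x \<and> filter ?Q w = take k y" for w j k
    by (rule in_shuffles_iff) (use P in \<open>auto dest: in_set_takeD\<close>)
  have iff2: "w \<in> shuffles (drop j x) (drop k y) \<longleftrightarrow> filter P w = drop j x \<and> filter ?Q w = drop k y" for w j k
    by (rule in_shuffles_iff) (use P in \<open>auto dest: in_set_dropD\<close>)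
  have td: "filter p w = filter p (take i w) @ filter p (drop i w)" for p i and w :: "'a list"
    by (metis append_take_drop_id filter_append)
  have "(\<Sum>w\<in>shuffles x y. \<Sum>i\<le>length w. g (take i w) (drop i w)) = (\<Sum>(w, i)\<in>?L. g (take i w) (drop i w))"
    by (rule sum.Sigma) auto
  also have "\<dots> = (\<Sum>(j, k, a, b)\<in>?R. g a b)"
  proof (rule sum.reindex_bij_witness[where j = ?j and i = ?i])
    fix r assume "r \<in> ?R"
    then obtain j k a b where r: "r = (j, k, a, b)" "j \<le> length x" "k \<le> length y"
      "filter P a = take j x" "filter ?Q a = take k y" "filter P b = drop j x" "filter ?Q b = drop k y"
      by (auto simp: iff1 iff2)
    then show "?j (?i r) = r" and "?i r \<in> ?L"
      by (auto simp: iff)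
  next
    fix l assume "l \<in> ?L"
    then obtain w i where l: "l = (w, i)" "filter P w = x" "filter ?Q w = y" "i \<le> length w"
      by (auto simp: iff)
    have *: "take (length (filter p (take i w))) (filter p w) = filter p (take i w)"
      "drop (length (filter p (take i w))) (filter p w) = filter p (drop i w)"
      "length (filter p (take i w)) \<le> length (filter p w)" for p
      by (simp_all add: td[of p w i])
    show "?j l \<in> ?R"
      using *[of P] *[of ?Q] l by (auto intro: partition_in_shuffles)
    show "?i (?j l) = l"
      using l by simp
  qed auto
  also have "\<dots> = (\<Sum>j\<le>length x. \<Sum>k\<le>length y.
      \<Sum>(a, b)\<in>shuffles (take j x) (take k y) \<times> shuffles (drop j x) (drop k y). g a b)"
    by (simp add: sum.Sigma)
  also have "\<dots> = (\<Sum>j\<le>length x. \<Sum>k\<le>length y. \<Sum>a\<in>shuffles (take j x) (take k y).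
      \<Sum>b\<in>shuffles (drop j x) (drop k y). g a b)"
    by (simp add: sum.cartesian_product)
  finally show ?thesis .
qed

section \<open>The Hopf algebra of packed words\<close>

definition Nmult :: "nat list \<Rightarrow> nat list \<Rightarrow> 'k::field wspace"
  where "Nmult u v = (\<Sum>w\<in>shuffles u (map (\<lambda>a. a + wmax u) v). N w)"

lemma Wmult_eq: "Wmult F G = lin (\<lambda>u. lin (Nmult u) G) F"
  unfolding Wmult_def Nmult_def[abs_def] ..

lemma lin_N_single [simp]: "lin f (N u) = f u"
  by (simp add: N_def)

lemma keys_N [simp]: "keys (N u :: 'k::field wspace) = {u}"
  by (simp add: N_def)

lemma lin_N: "lin N F = F"
  unfolding N_def by (rule lin_basis)

lemma Wmult_N: "Wmult (N u) (N v) = Nmult u v"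
  by (simp add: Wmult_eq)

lemma Wmult_add_left: "Wmult (F + G) H = Wmult F H + Wmult G H"
  by (simp add: Wmult_eq lin_add)

lemma Wmult_add_right: "Wmult H (F + G) = Wmult H F + Wmult H G"
  by (simp add: Wmult_eq lin_add lin_fun_add)

lemma Wmult_scale_left: "Wmult (scale c F) G = scale c (Wmult F G)"
  by (simp add: Wmult_eq lin_scale)

lemma Wmult_scale_right: "Wmult F (scale c G) = scale c (Wmult F G)"
  by (simp add: Wmult_eq lin_scale lin_fun_scale)

lemma Wmult_lin_left: "Wmult (lin f F) G = lin (\<lambda>u. Wmult (f u) G) F"
  by (simp add: Wmult_eq lin_lin)

lemma Wmult_lin_right: "Wmult F (lin g G) = lin (\<lambda>v. Wmult F (g v)) G"
  by (simp add: Wmult_eq lin_lin lin_swap[of _ F])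

lemma Wmult_sum_left: "Wmult (sum f X) G = (\<Sum>x\<in>X. Wmult (f x) G)"
  by (simp add: Wmult_eq lin_sum)

lemma Wmult_sum_right: "Wmult F (sum f X) = (\<Sum>x\<in>X. Wmult F (f x))"
  by (simp add: Wmult_eq lin_sum lin_fun_sum)

lemma subspace_Wspace: "pm.subspace Wspace"
  unfolding pm.subspace_def Wspace_def
  by (auto dest!: subsetD[OF keys_add] subsetD[OF keys_scale])

lemma Wspace_simps [simp]:
  "0 \<in> Wspace" "F \<in> Wspace \<Longrightarrow> G \<in> Wspace \<Longrightarrow> F + G \<in> Wspace" "F \<in> Wspace \<Longrightarrow> scale c F \<in> Wspace"
  "F \<in> Wspace \<Longrightarrow> G \<in> Wspace \<Longrightarrow> F - G \<in> Wspace" "F \<in> Wspace \<Longrightarrow> - F \<in> Wspace"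
  by (simp_all add: pm.subspace_0 pm.subspace_add pm.subspace_scale pm.subspace_diff pm.subspace_neg
      subspace_Wspace)

lemma N_in_Wspace [simp]: "N u \<in> Wspace \<longleftrightarrow> packed u"
  by (simp add: Wspace_def)

lemma WspaceD: "F \<in> Wspace \<Longrightarrow> u \<in> keys F \<Longrightarrow> packed u"
  by (simp add: Wspace_def)

lemma lin_Wspace: "(\<And>u. u \<in> keys F \<Longrightarrow> f u \<in> Wspace) \<Longrightarrow> lin f F \<in> Wspace"
  by (rule lin_mem[OF subspace_Wspace])

lemma sum_Wspace: "(\<And>x. x \<in> X \<Longrightarrow> f x \<in> Wspace) \<Longrightarrow> sum f X \<in> Wspace"
  by (rule pm.subspace_sum[OF subspace_Wspace])

lemma shift_image: "(\<lambda>a. a + m) ` {1..n} = {m + 1..m + n :: nat}"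
  using image_add_atLeastAtMost[of m 1 n] by (simp add: add.commute)

lemma set_shuffles_packed:
  assumes "packed u" "packed v" "w \<in> shuffles u (map (\<lambda>a. a + wmax u) v)"
  shows "set w = {1..wmax u + wmax v}"
proof -
  have "set w = set u \<union> (\<lambda>a. a + wmax u) ` set v"
    using set_shuffles[OF assms(3)] by simp
  also have "\<dots> = {1..wmax u} \<union> {wmax u + 1..wmax u + wmax v}"
    using assms(1,2) by (simp only: set_packed shift_image)
  also have "\<dots> = {1..wmax u + wmax v}" by auto
  finally show ?thesis .
qed

lemma packed_shuffles:
  "packed u \<Longrightarrow> packed v \<Longrightarrow> w \<in> shuffles u (map (\<lambda>a. a + wmax u) v) \<Longrightarrow> packed w"
  by (rule packedI[OF set_shuffles_packed])

lemma wmax_shuffles: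
  "packed u \<Longrightarrow> packed v \<Longrightarrow> w \<in> shuffles u (map (\<lambda>a. a + wmax u) v) \<Longrightarrow> wmax w = wmax u + wmax v"
  by (rule wmax_eq[OF set_shuffles_packed])

lemma Nmult_Wspace [simp]: "packed u \<Longrightarrow> packed v \<Longrightarrow> Nmult u v \<in> Wspace"
  unfolding Nmult_def by (intro sum_Wspace) (simp add: packed_shuffles[of u v])

lemma Wmult_Wspace [simp]: "F \<in> Wspace \<Longrightarrow> G \<in> Wspace \<Longrightarrow> Wmult F G \<in> Wspace"
  unfolding Wmult_eq by (intro lin_Wspace Nmult_Wspace WspaceD)

text \<open>A letter of \<open>y\<close> has all letters of \<open>x\<close> below it, which adds
  \<open>card (set x)\<close>, the maximum of \<open>pack x\<close>, to its rank; the rank of a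
  letter of \<open>x\<close> ignores \<open>y\<close>.\<close>

lemma map_rank_Un:
  fixes x y :: "'a::linorder list"
  assumes less: "\<And>a b. a \<in> set x \<Longrightarrow> b \<in> set y \<Longrightarrow> a < b"
  shows "map (rank (set x \<union> set y)) x = pack x"
    and "map (rank (set x \<union> set y)) y = map (\<lambda>a. a + wmax (pack x)) (pack y)"
proof -
  let ?A = "set x \<union> set y"
  have "{b \<in> ?A. b \<le> a} = {b \<in> set x. b \<le> a}" if "a \<in> set x" for a
    using less that by force
  then show "map (rank ?A) x = pack x"
    by (simp add: pack_def rank_def)
  have "rank ?A a = rank (set y) a + card (set x)" if "a \<in> set y" for a
  proof -
    have "{b \<in> ?A. b \<le> a} = {b \<in> set y. b \<le> a} \<union> set x"
      using less that by force
    moreover have "{b \<in> set y. b \<le> a} \<inter> set x = {}"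
      using less by force
    ultimately show ?thesis by (simp add: rank_def card_Un_disjoint)
  qed
  then show "map (rank ?A) y = map (\<lambda>a. a + wmax (pack x)) (pack y)"
    by (simp add: pack_eq_map_rank[of y])
qed

lemma pack_append:
  assumes "\<And>a b. a \<in> set x \<Longrightarrow> b \<in> set y \<Longrightarrow> a < b"
  shows "pack (x @ y) = pack x @ map (\<lambda>a. a + wmax (pack x)) (pack y)"
  using map_rank_Un[OF assms] by (simp add: pack_eq_map_rank[of "x @ y"])

text \<open>Shuffles commute with packing, as the letters of \<open>x\<close> remain below those of \<open>y\<close>.\<close>

lemma sum_N_pack_shuffles:
  fixes x y :: "'a::linorder list"
  assumes less: "\<And>a b. a \<in> set x \<Longrightarrow> b \<in> set y \<Longrightarrow> a < b"
  shows "(\<Sum>w\<in>shuffles x y. N (pack w)) = (Nmult (pack x) (pack y) :: 'k::field wspace)"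
proof -
  let ?A = "set x \<union> set y"
  let ?r = "rank ?A"
  have *: "map ?r ` shuffles x y = shuffles (pack x) (map (\<lambda>a. a + wmax (pack x)) (pack y))"
    by (simp only: map_shuffles map_rank_Un[of x y, OF less])
  have inj: "inj_on (map ?r) (shuffles x y)"
  proof (rule inj_onI)
    fix w w' assume w: "w \<in> shuffles x y" "w' \<in> shuffles x y" and eq: "map ?r w = map ?r w'"
    have "inj_on ?r (set w \<union> set w')"
      by (rule inj_on_subset[OF inj_on_rank[of ?A]]) (use w set_shuffles in auto)
    with eq show "w = w'" by (simp add: inj_on_map_eq_map)
  qed
  have "(\<Sum>w\<in>shuffles x y. N (pack w)) = (\<Sum>w\<in>shuffles x y. N (map ?r w) :: 'k wspace)"
    by (intro sum.cong refl) (simp add: pack_eq_map_rank set_shuffles)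
  then show ?thesis
    using sum.reindex[OF inj, of "N :: _ \<Rightarrow> 'k wspace"] by (simp add: Nmult_def * o_def)
qed

text \<open>Both sides sum over all shuffles of three words with disjoint alphabets:
  \<open>u\<close>, \<open>v\<close> shifted by \<open>wmax u\<close>, and \<open>t\<close> shifted
  by \<open>wmax u + wmax v\<close>.\<close>

lemma Wmult_assoc_N:
  assumes "packed u" "packed v" "packed t"
  shows "Wmult (Nmult u v) (N t) = Wmult (N u) (Nmult v t)"
proof -
  let ?a = "wmax u" and ?b = "wmax v"
  have "Wmult (Nmult u v) (N t) = (\<Sum>w\<in>shuffles u (map (\<lambda>a. a + ?a) v). Nmult w t)"
    by (simp add: Nmult_def Wmult_sum_left Wmult_N)
  also have "\<dots> = (\<Sum>w\<in>shuffles u (map (\<lambda>a. a + ?a) v). \<Sum>s\<in>shuffles w (map (\<lambda>a. a + (?a + ?b)) t). N s)"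
    unfolding Nmult_def using assms by (intro sum.cong refl) (simp add: wmax_shuffles[of u v])
  also have "\<dots> = (\<Sum>w\<in>shuffles (map (\<lambda>a. a + ?a) v) (map (\<lambda>a. a + (?a + ?b)) t). \<Sum>s\<in>shuffles u w. N s)"
    using assms by (intro sum_shuffles_assoc) (auto simp: set_packed)
  also have "shuffles (map (\<lambda>a. a + ?a) v) (map (\<lambda>a. a + (?a + ?b)) t) =
      map (\<lambda>a. a + ?a) ` shuffles v (map (\<lambda>a. a + ?b) t)"
    by (simp add: map_shuffles o_def add.assoc add.commute[of ?b])
  also have "(\<Sum>w\<in>\<dots>. \<Sum>s\<in>shuffles u w. N s) =
      (\<Sum>w\<in>shuffles v (map (\<lambda>a. a + ?b) t). \<Sum>s\<in>shuffles u (map (\<lambda>a. a + ?a) w). N s)"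
    by (subst sum.reindex) (auto intro!: inj_on_subset[OF inj_mapI] simp: inj_def)
  also have "\<dots> = Wmult (N u) (Nmult v t)"
    unfolding Nmult_def[of v] Wmult_sum_right Wmult_N by (simp add: Nmult_def)
  finally show ?thesis .
qed

lemma Wmult_assoc:
  assumes "F \<in> Wspace" "G \<in> Wspace" "H \<in> Wspace"
  shows "Wmult (Wmult F G) H = Wmult F (Wmult G H)"
proof -
  have "Wmult (Wmult F G) H = lin (\<lambda>u. lin (\<lambda>v. Wmult (Nmult u v) H) G) F"
    by (simp add: Wmult_eq[of F G] Wmult_lin_left)
  also have "\<dots> = lin (\<lambda>u. lin (\<lambda>v. lin (\<lambda>t. Wmult (Nmult u v) (N t)) H) G) F"
    by (subst (1) lin_N[of H, symmetric]) (simp add: Wmult_lin_right)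
  also have "\<dots> = lin (\<lambda>u. lin (\<lambda>v. lin (\<lambda>t. Wmult (N u) (Nmult v t)) H) G) F"
    using assms by (intro lin_cong Wmult_assoc_N WspaceD)
  also have "\<dots> = lin (\<lambda>u. Wmult (N u) (Wmult G H)) F"
    by (simp add: Wmult_eq[of G H] Wmult_lin_right)
  also have "\<dots> = Wmult F (Wmult G H)"
    by (subst (2) lin_N[of F, symmetric]) (simp only: Wmult_lin_left)
  finally show ?thesis .
qed

lemma Nmult_Nil_left [simp]: "Nmult [] = N"
  by (simp add: Nmult_def fun_eq_iff)

lemma Nmult_Nil_right [simp]: "Nmult u [] = N u"
  by (simp add: Nmult_def)

lemma Wmult_one_left [simp]: "Wmult (N []) F = F"
  by (simp add: Wmult_eq lin_N)

lemma Wmult_one_right [simp]: "Wmult F (N []) = F"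
  by (simp add: Wmult_eq lin_N)

lemma W_simps [simp]: "carrier W = Wspace" "monoid.mult W = Wmult" "one W = N []" "ring.zero W = 0"
  "add W = (+)" "smult W = scale" "comult W = Wcomult" "counit W F = lookup F []"
  by (simp_all add: W_def)

lemma k_algebra_W: "k_algebra (W :: ('k::field, 'k wspace) bialg)"
proof -
  have ab: "abelian_group (W :: ('k, 'k wspace) bialg)"
  proof (rule abelian_groupI)
    fix F :: "'k wspace" assume "F \<in> carrier W"
    then show "\<exists>G\<in>carrier W. G \<oplus>\<^bsub>W\<^esub> F = \<zero>\<^bsub>W\<^esub>"
      by (intro bexI[of _ "- F"]) auto
  qed (auto simp: algebra_simps)
  have ring: "ring (W :: ('k, 'k wspace) bialg)"
  proof (rule ringI[OF ab])
    show "monoid (W :: ('k, 'k wspace) bialg)"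
      by (rule monoidI) (auto simp: Wmult_assoc)
  qed (auto simp: Wmult_add_left Wmult_add_right)
  have mod: "module scalars (W :: ('k, 'k wspace) bialg)"
    by (rule moduleI[OF cring_scalars ab]) (auto simp: pm.scale_left_distrib pm.scale_right_distrib)
  show ?thesis
    by (intro k_algebra.intro mod ring k_algebra_axioms.intro)
      (auto simp: Wmult_scale_left Wmult_scale_right)
qed

section \<open>The deconcatenation coproduct\<close>

definition deconc :: "nat list \<Rightarrow> ('k::field wspace list \<Rightarrow>\<^sub>0 'k)"
  where "deconc w = (\<Sum>i\<le>length w. single [N (pack (take i w)), N (pack (drop i w))] 1)"

lemma Wcomult_eq: "Wcomult = lin deconc"
  unfolding Wcomult_def deconc_def[abs_def] ..

lemma deconc_tensors: "deconc w \<in> tensors 2 W"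
  unfolding deconc_def by (intro pm.subspace_sum[OF subspace_tensors] tensors_single) auto

lemma lin_deconc: "lin f (deconc w) = (\<Sum>i\<le>length w. f [N (pack (take i w)), N (pack (drop i w))])"
  by (simp add: deconc_def lin_sum)

lemma Wcomult_tensors [simp]: "Wcomult F \<in> tensors 2 W"
  unfolding Wcomult_eq by (intro lin_mem[OF subspace_tensors] deconc_tensors)

lemma tensor_eq_W_sum:
  assumes p: "set p \<subseteq> Wspace" and q: "set q \<subseteq> Wspace" and f: "\<And>a. a \<in> X \<Longrightarrow> f a \<in> Wspace"
  shows "tensor_eq W (single (p @ [sum f X] @ q) 1) (\<Sum>a\<in>X. single (p @ [f a] @ q) 1)"
proof -
  \<comment> \<open>Homogeneity with the scalar 0; it covers the empty sum and infinite
    \<open>X\<close>, where \<open>sum\<close> is 0 as well.\<close>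
  have 0: "tensor_eq W (single (p @ [0] @ q) 1) 0"
    using tensor_null.homogeneous[of p W q 0 0] p q by (simp add: tensor_eq_def)
  show ?thesis using f
  proof (induction X rule: infinite_finite_induct)
    case (insert a X)
    have "tensor_eq W (single (p @ [f a + sum f X] @ q) 1)
        (single (p @ [f a] @ q) 1 + single (p @ [sum f X] @ q) 1)"
      using tensor_null.additive[of p W q "f a" "sum f X"] p q insert
      by (simp add: sum_Wspace tensor_eq_def diff_diff_add)
    also have "tensor_eq W \<dots> (single (p @ [f a] @ q) 1 + (\<Sum>a\<in>X. single (p @ [f a] @ q) 1))"
      using insert by (intro tensor_eq_add) auto
    finally show ?case using insert by simp
  qed (use 0 in simp_all)
qed

lemma tensor_eq_W_sum1:
  assumes "\<And>a. a \<in> X \<Longrightarrow> f a \<in> Wspace" "G \<in> Wspace"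
  shows "tensor_eq W (single [sum f X, G] 1) (\<Sum>a\<in>X. single [f a, G] 1)"
  using tensor_eq_W_sum[of "[]" "[G]" X f] assms by simp

lemma tensor_eq_W_sum2:
  assumes "\<And>a. a \<in> X \<Longrightarrow> f a \<in> Wspace" "G \<in> Wspace"
  shows "tensor_eq W (single [G, sum f X] 1) (\<Sum>a\<in>X. single [G, f a] 1)"
  using tensor_eq_W_sum[of "[G]" "[]" X f] assms by simp

lemma tensor_eq_W_sum_sum:
  assumes "\<And>a. a \<in> X \<Longrightarrow> f a \<in> Wspace" "\<And>b. b \<in> Y \<Longrightarrow> g b \<in> Wspace"
  shows "tensor_eq W (single [sum f X, sum g Y] 1)
    (\<Sum>a\<in>X. \<Sum>b\<in>Y. single [f a, g b] 1)"
proof -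
  have "tensor_eq W (single [sum f X, sum g Y] 1) (\<Sum>a\<in>X. single [f a, sum g Y] 1)"
    using assms by (intro tensor_eq_W_sum1 sum_Wspace)
  also have "tensor_eq W \<dots> (\<Sum>a\<in>X. \<Sum>b\<in>Y. single [f a, g b] 1)"
    using assms by (intro tensor_eq_sum tensor_eq_W_sum2)
  finally show ?thesis .
qed

lemma tensor_mult_lin:
  "tensor_mult A (lin f F) (lin g G) = lin (\<lambda>u. lin (\<lambda>v. tensor_mult A (f u) (g v)) G) F"
  unfolding tensor_mult_def lin_lin by (subst (2) lin_swap) simp

lemma tensor_mult_sum:
  "tensor_mult A (sum f X) (sum g Y) = (\<Sum>x\<in>X. \<Sum>y\<in>Y. tensor_mult A (f x) (g y))"
  unfolding tensor_mult_def lin_sum lin_fun_sum by (rule sum.swap)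

lemma tensor_mult_single:
  "tensor_mult A (single p 1) (single q 1) =
    single (map2 (\<lambda>x y. x \<otimes>\<^bsub>A\<^esub> y) p q) 1"
  by (simp add: tensor_mult_def)

lemma pack_map_add [simp]: "pack (map (\<lambda>a. a + m) w) = pack (w :: nat list)"
  by (rule pack_map) simp

text \<open>Cutting a shuffle leaves a shuffle of the front parts and one of the back parts, and
  after packing each runs through the terms of a product. It is an equality of tensors because the
  sums have to be collected inside the legs.\<close>

lemma comult_Nmult:
  assumes "packed u" "packed v"
  shows "tensor_eq (W :: ('k::field, 'k wspace) bialg) (Wcomult (Nmult u v)) (tensor_mult W (deconc u) (deconc v))"
proof -
  let ?v = "map (\<lambda>a. a + wmax u) v"
  let ?g = "\<lambda>a b. single [N (pack a), N (pack b)] (1 :: 'k)"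
  let ?t = "\<lambda>j k. shuffles (take j u) (take k ?v)" and ?d = "\<lambda>j k. shuffles (drop j u) (drop k ?v)"
  have less: "a < b" if "a \<in> set u" "b \<in> set ?v" for a b
    using that assms by (auto simp: set_packed)
  have "Wcomult (Nmult u v) = (\<Sum>w\<in>shuffles u ?v. \<Sum>i\<le>length w. ?g (take i w) (drop i w))"
    by (simp add: Wcomult_eq Nmult_def lin_sum deconc_def)
  also have "\<dots> = (\<Sum>j\<le>length u. \<Sum>k\<le>length ?v. \<Sum>a\<in>?t j k. \<Sum>b\<in>?d j k. ?g a b)"
    by (rule sum_shuffles_split[where P = "\<lambda>a. a \<le> wmax u"]) (use assms in \<open>auto simp: set_packed\<close>)
  also have "tensor_eq W \<dots> (\<Sum>j\<le>length u. \<Sum>k\<le>length ?v.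
      single [\<Sum>a\<in>?t j k. N (pack a), \<Sum>b\<in>?d j k. N (pack b)] 1)"
    by (intro tensor_eq_sum tensor_eq_W_sum_sum[THEN tensor_eq_sym]) auto
  also have "\<dots> = (\<Sum>j\<le>length u. \<Sum>k\<le>length v. single
      [Nmult (pack (take j u)) (pack (take k v)), Nmult (pack (drop j u)) (pack (drop k v))] 1)"
  proof -
    have "(\<Sum>a\<in>?t j k. N (pack a)) = (Nmult (pack (take j u)) (pack (take k ?v)) :: 'k wspace)"
      "(\<Sum>a\<in>?d j k. N (pack a)) = (Nmult (pack (drop j u)) (pack (drop k ?v)) :: 'k wspace)" for j k
      by (rule sum_N_pack_shuffles; use less in \<open>blast dest: in_set_takeD in_set_dropD\<close>)+
    then have "(\<Sum>a\<in>?t j k. N (pack a)) = (Nmult (pack (take j u)) (pack (take k v)) :: 'k wspace)"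
      "(\<Sum>a\<in>?d j k. N (pack a)) = (Nmult (pack (drop j u)) (pack (drop k v)) :: 'k wspace)" for j k
      by (simp_all only: take_map drop_map pack_map_add)
    then show ?thesis by simp
  qed
  also have "\<dots> = tensor_mult W (deconc u) (deconc v)"
    by (simp add: deconc_def tensor_mult_sum tensor_mult_single Wmult_N)
  finally show ?thesis .
qed

lemma comult_Wmult:
  assumes "F \<in> Wspace" "G \<in> Wspace"
  shows "tensor_eq W (Wcomult (Wmult F G)) (tensor_mult W (Wcomult F) (Wcomult G))"
proof -
  have "Wcomult (Wmult F G) = lin (\<lambda>u. lin (\<lambda>v. Wcomult (Nmult u v)) G) F"
    by (simp add: Wcomult_eq Wmult_eq lin_lin)
  also have "tensor_eq W \<dots> (lin (\<lambda>u. lin (\<lambda>v. tensor_mult W (deconc u) (deconc v)) G) F)"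
    using assms by (intro tensor_eq_lin comult_Nmult WspaceD)
  also have "\<dots> = tensor_mult W (Wcomult F) (Wcomult G)"
    by (simp add: Wcomult_eq tensor_mult_lin)
  finally show ?thesis .
qed

lemma finsum_W:
  assumes "f \<in> A \<rightarrow> Wspace"
  shows "finsum (W :: ('k::field, 'k wspace) bialg) f A = sum f A"
proof -
  interpret W: k_algebra "W :: ('k, 'k wspace) bialg" by (rule k_algebra_W)
  show ?thesis using assms
    by (induction A rule: infinite_finite_induct) (auto simp: W.finsum_insert)
qed

lemma tensor_eval_W:
  assumes "\<And>xs. xs \<in> keys t \<Longrightarrow> f xs \<in> Wspace"
  shows "tensor_eval (W :: ('k::field, 'k wspace) bialg) f t = lin f t"
  unfolding tensor_eval_def lin_def by (subst finsum_W) (auto simp: assms)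

lemma tensor_eval_Wcomult:
  assumes "\<And>x y. x \<in> Wspace \<Longrightarrow> y \<in> Wspace \<Longrightarrow> f x y \<in> Wspace"
  shows "tensor_eval (W :: ('k::field, 'k wspace) bialg) (\<lambda>xs. f (xs ! 0) (xs ! 1)) (Wcomult F) =
    lin (\<lambda>w. \<Sum>i\<le>length w. f (N (pack (take i w))) (N (pack (drop i w)))) F"
proof -
  have "tensor_eval W (\<lambda>xs. f (xs ! 0) (xs ! 1)) (Wcomult F) = lin (\<lambda>xs. f (xs ! 0) (xs ! 1)) (Wcomult F)"
    by (rule tensor_eval_W) (use assms tensors_2D(2,3)[OF Wcomult_tensors[of F]] in simp)
  then show ?thesis
    by (simp add: Wcomult_eq lin_lin lin_deconc)
qed

lemma lookup_N: "lookup (N u) v = (if u = v then 1 else 0)"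
  by (simp add: N_def lookup_single when_def)

lemma lookup_lin: "lookup (lin f F) x =
    (\<Sum>b\<in>keys F. lookup F b * lookup (f b) x)"
  by (simp add: lin_def lookup_sum)

lemma counit_Wmult:
  "lookup (Wmult F G) [] = lookup F [] * lookup G []"
proof -
  have delta: "(\<Sum>b\<in>keys H. lookup H b * (if b = [] then c else 0)) =
      lookup H [] * c" for H :: "'a wspace" and c
    by (simp add: if_distrib[of "(*) _"] sum.delta in_keys_iff cong: if_cong)
  have "lookup (Nmult u v) [] = (if u = [] then if v = [] then 1 else 0 else (0::'a))" for u v
    by (auto simp: Nmult_def lookup_sum lookup_N intro!: sum.neutral)
  then have "lookup (Wmult F G) [] = (\<Sum>u\<in>keys F. lookup F u *
      (if u = [] then (\<Sum>v\<in>keys G. lookup G v * (if v = [] then 1 else 0)) else 0))"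
    unfolding Wmult_eq lookup_lin by (intro sum.cong refl) auto
  also have "\<dots> = lookup F [] * lookup G []"
    unfolding delta by simp
  finally show ?thesis .
qed

text \<open>For coassociativity: \<open>i\<close> and \<open>j\<close> are the positions of two
  cuts, and the right side makes the left cut \<open>j\<close> first and measures \<open>k\<close>
  from there.\<close>

lemma sum_triangle: "(\<Sum>i\<le>n. \<Sum>j\<le>i. g i j) = (\<Sum>j\<le>n. \<Sum>k\<le>n - j. g (j + k) j :: 'b::comm_monoid_add)" for n :: nat
proof -
  have "(\<Sum>i\<le>n. \<Sum>j\<le>i. g i j) = (\<Sum>(i, j)\<in>Sigma {..n} (\<lambda>i. {..i}). g i j)"
    by (rule sum.Sigma) auto
  also have "\<dots> = (\<Sum>(j, k)\<in>Sigma {..n} (\<lambda>j. {..n - j}). g (j + k) j)"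
    by (rule sum.reindex_bij_witness[where j = "\<lambda>(i, j). (j, i - j)" and i = "\<lambda>(j, k). (j + k, j)"]) auto
  also have "\<dots> = (\<Sum>j\<le>n. \<Sum>k\<le>n - j. g (j + k) j)"
    by (rule sum.Sigma[symmetric]) auto
  finally show ?thesis .
qed

lemma tensor_cat_sum_left: "tensor_cat (sum f X) t = (\<Sum>x\<in>X. tensor_cat (f x) t)"
  by (simp add: tensor_cat_def lin_sum)

lemma tensor_cat_sum_right: "tensor_cat t (sum f X) = (\<Sum>x\<in>X. tensor_cat t (f x))"
  by (simp add: tensor_cat_def lin_sum lin_fun_sum)

lemma tensor_cat_single: "tensor_cat (single p 1) (single q 1) = single (p @ q) 1"
  by (simp add: tensor_cat_def)

lemma take_drop_triangle: "drop j (take (j + k) w) = take k (drop j w)"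
  by (simp add: drop_take)

text \<open>Each side sums over all ways to cut a word twice, and packing a piece gives the same
  result whether or not the word was packed before. The legs are basis vectors, so the formal
  tensors agree literally.\<close>

lemma W_coassoc:
  "lin (\<lambda>xs. tensor_cat (Wcomult (xs ! 0)) (single [xs ! 1] 1)) (Wcomult F) =
   lin (\<lambda>xs. tensor_cat (single [xs ! 0] 1) (Wcomult (xs ! 1))) (Wcomult F)"
proof -
  have "lin (\<lambda>xs. tensor_cat (Wcomult (xs ! 0)) (single [xs ! 1] 1)) (deconc w) =
   lin (\<lambda>xs. tensor_cat (single [xs ! 0] 1) (Wcomult (xs ! 1))) (deconc w :: 'a wspace list \<Rightarrow>\<^sub>0 'a)" for w
  proof -
    let ?s = "\<lambda>a b c. single [N (pack a), N (pack b), N (pack c)] (1 :: 'a)"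
    have "lin (\<lambda>xs. tensor_cat (Wcomult (xs ! 0)) (single [xs ! 1] 1)) (deconc w) =
      (\<Sum>i\<le>length w. \<Sum>j\<le>i. ?s (take j (take i w)) (drop j (take i w)) (drop i w))"
      unfolding lin_deconc Wcomult_eq
      by (intro sum.cong refl) (simp add: deconc_def tensor_cat_sum_left tensor_cat_single)
    also have "\<dots> = (\<Sum>j\<le>length w. \<Sum>k\<le>length w - j. ?s (take j w) (take k (drop j w)) (drop k (drop j w)))"
      by (subst sum_triangle) (simp add: take_drop_triangle add.commute)
    also have "\<dots> = lin (\<lambda>xs. tensor_cat (single [xs ! 0] 1) (Wcomult (xs ! 1))) (deconc w)"
      unfolding lin_deconc Wcomult_eq
      by (intro sum.cong refl) (simp add: deconc_def tensor_cat_sum_right tensor_cat_single)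
    finally show ?thesis .
  qed
  then show ?thesis by (simp add: Wcomult_eq lin_lin)
qed

lemma bialgebra_W: "bialgebra (W :: ('k::field, 'k wspace) bialg)"
proof (rule bialgebra.intro[OF k_algebra_W bialgebra_axioms.intro], unfold W_simps)
  fix F G :: "'k wspace" and c :: 'k
  assume F: "F \<in> Wspace"
  show "tensor_eq W (Wcomult (F + G)) (Wcomult F + Wcomult G)"
    by (simp add: Wcomult_eq lin_add)
  show "tensor_eq W (Wcomult (scale c F)) (scale c (Wcomult F))"
    by (simp add: Wcomult_eq lin_scale)
  \<comment> \<open>The counit keeps only the cut at 0, where the first leg is the empty word; for
    \<open>?r\<close> it is the cut at the end.\<close>
  let ?l = "\<lambda>w. \<Sum>i\<le>length w. scale (lookup (N (pack (take i w))) []) (N (pack (drop i w))) :: 'k wspace"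
  have "lin ?l F = lin N F"
  proof (rule lin_cong)
    fix w assume "w \<in> keys F"
    then have w: "packed w" using F by (rule WspaceD[rotated])
    have "?l w =
       (\<Sum>i\<le>length w. if i = 0 then N (pack w) else (0 :: 'k wspace))"
      by (intro sum.cong refl) (auto simp: lookup_N)
    then show "?l w = N w"
      using w by (simp add: pack_packed)
  qed
  then show "tensor_eval W (\<lambda>xs. scale (lookup (xs ! 0) []) (xs ! 1)) (Wcomult F) = F"
    by (subst tensor_eval_Wcomult[where f = "\<lambda>x y. scale (lookup x []) y"]) (simp_all add: lin_N)
  let ?r = "\<lambda>w. \<Sum>i\<le>length w. scale (lookup (N (pack (drop i w))) []) (N (pack (take i w))) :: 'k wspace"
  have "lin ?r F = lin N F"
  proof (rule lin_cong)
    fix w assume "w \<in> keys F"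
    then have w: "packed w" using F by (rule WspaceD[rotated])
    have "?r w =
       (\<Sum>i\<le>length w. if i = length w then N (pack w) else (0 :: 'k wspace))"
      by (intro sum.cong refl) (auto simp: lookup_N)
    then show "?r w = N w"
      using w by (simp add: pack_packed)
  qed
  then show "tensor_eval W (\<lambda>xs. scale (lookup (xs ! 1) []) (xs ! 0)) (Wcomult F) = F"
    by (subst tensor_eval_Wcomult[where f = "\<lambda>x y. scale (lookup y []) x"]) (simp_all add: lin_N)
next
  show "tensor_eq W (Wcomult (N [])) (single [N [], N []] 1)"
    by (simp add: Wcomult_eq deconc_def)
qed (simp_all only: lookup_add W_coassoc comult_Wmult counit_Wmult lookup_N Wcomult_tensors
    lookup_scale tensor_eq_refl simp_thms if_True)

section \<open>Convolution and the antipode of \<open>W\<close>\<close>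

definition conv :: "(nat list \<Rightarrow> 'k::field wspace) \<Rightarrow> (nat list \<Rightarrow> 'k wspace) \<Rightarrow> nat list \<Rightarrow> 'k wspace"
  where "conv f g w = (\<Sum>i\<le>length w. Wmult (f (pack (take i w))) (g (pack (drop i w))))"

definition conv_unit :: "nat list \<Rightarrow> 'k::field wspace"
  where "conv_unit w = (if w = [] then N [] else 0)"

lemma Wmult_zero [simp]: "Wmult 0 F = 0" "Wmult F 0 = 0"
  by (simp_all add: Wmult_eq)

lemma conv_pack [simp]: "conv f g (pack w) = conv f g w"
  by (simp add: conv_def)

lemma conv_unit_right: "conv f conv_unit w = f (pack w)"
proof -
  have "conv f conv_unit w = (\<Sum>i\<le>length w. if i = length w then f (pack w) else 0)"
    unfolding conv_def conv_unit_def by (intro sum.cong refl) auto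
  then show ?thesis by simp
qed

lemma conv_unit_left: "conv conv_unit f w = f (pack w)"
proof -
  have "conv conv_unit f w = (\<Sum>i\<le>length w. if i = 0 then f (pack w) else 0)"
    unfolding conv_def conv_unit_def by (intro sum.cong refl) auto
  then show ?thesis by simp
qed

lemma conv_assoc:
  assumes "\<And>w. packed w \<Longrightarrow> f w \<in> Wspace" "\<And>w. packed w \<Longrightarrow> g w \<in> Wspace" "\<And>w. packed w \<Longrightarrow> h w \<in> Wspace"
  shows "conv (conv f g) h w = conv f (conv g h) w"
proof -
  let ?p = "\<lambda>a b c. Wmult (f (pack a)) (Wmult (g (pack b)) (h (pack c)))"
  have "conv (conv f g) h w = (\<Sum>i\<le>length w. \<Sum>j\<le>i. ?p (take j (take i w)) (drop j (take i w)) (drop i w))"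
    unfolding conv_def using assms by (intro sum.cong refl) (simp add: Wmult_sum_left Wmult_assoc)
  also have "\<dots> = (\<Sum>j\<le>length w. \<Sum>k\<le>length w - j. ?p (take j w) (take k (drop j w)) (drop k (drop j w)))"
    by (subst sum_triangle) (simp add: take_drop_triangle add.commute)
  also have "\<dots> = conv f (conv g h) w"
    unfolding conv_def by (intro sum.cong refl) (simp add: Wmult_sum_right)
  finally show ?thesis .
qed

context
  notes sum.cong [fundef_cong]
begin

text \<open>Solves the equation for a left convolution inverse of the identity for its term at the
  last cut; all other prefixes are shorter. \<open>antipode_right\<close> does the same with the cut
  at 0. The congruence rule for sums hands the range of \<open>i\<close> to the termination
  proof.\<close>

function antipode_left :: "nat list \<Rightarrow> 'k::field wspace" where
  "antipode_left w = (if w = [] then N [] else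
    - (\<Sum>i<length w. Wmult (antipode_left (pack (take i w))) (N (pack (drop i w)))))"
  by auto
termination by (relation "measure length") auto

function antipode_right :: "nat list \<Rightarrow> 'k::field wspace" where
  "antipode_right w = (if w = [] then N [] else
    - (\<Sum>i\<in>{1..length w}. Wmult (N (pack (take i w))) (antipode_right (pack (drop i w)))))"
  by auto
termination by (relation "measure length") auto

end

declare antipode_left.simps [simp del] antipode_right.simps [simp del]

lemma antipode_left_Wspace: "antipode_left w \<in> Wspace"
proof (induction w rule: antipode_left.induct)
  case (1 w)
  show ?case
    by (subst antipode_left.simps) (auto intro!: sum_Wspace Wmult_Wspace 1 Wspace_simps)
qed

lemma antipode_right_Wspace: "antipode_right w \<in> Wspace"
proof (induction w rule: antipode_right.induct)
  case (1 w)
  show ?case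
    by (subst antipode_right.simps) (auto intro!: sum_Wspace Wmult_Wspace 1 Wspace_simps)
qed

lemma conv_antipode_left: "conv antipode_left N w = conv_unit w"
proof (cases "w = []")
  case True
  then show ?thesis
    by (simp add: conv_def conv_unit_def antipode_left.simps[of "[]"])
next
  case False
  \<comment> \<open>The last cut carries the value at the whole word, which the recursion defines as
    minus the rest.\<close>
  have "{..length w} = insert (length w) {..<length w}" by auto
  then have "conv antipode_left N w = antipode_left (pack w) +
      (\<Sum>i<length w. Wmult (antipode_left (pack (take i w))) (N (pack (drop i w))))"
    by (simp add: conv_def)
  also have "\<dots> = 0"
    by (subst antipode_left.simps) (simp add: False)
  finally show ?thesis using False by (simp add: conv_unit_def)
qed

lemma conv_antipode_right: "conv N antipode_right w = conv_unit w"
proof (cases "w = []")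
  case True
  then show ?thesis
    by (simp add: conv_def conv_unit_def antipode_right.simps[of "[]"])
next
  case False
  have "{..length w} = insert 0 {1..length w}" by auto
  then have "conv N antipode_right w = antipode_right (pack w) +
      (\<Sum>i\<in>{1..length w}. Wmult (N (pack (take i w))) (antipode_right (pack (drop i w))))"
    by (simp add: conv_def)
  also have "\<dots> = 0"
    by (subst antipode_right.simps) (simp add: False)
  finally show ?thesis using False by (simp add: conv_unit_def)
qed

text \<open>A left and a right convolution inverse of the identity coincide.\<close>

lemma antipode_left_eq_right: assumes "packed w" shows "antipode_left w = antipode_right w"
proof -
  have "antipode_left w = conv antipode_left (conv N antipode_right) w"
    using assms by (simp add: conv_antipode_right[abs_def] conv_unit_right pack_packed)
  also have "\<dots> = conv (conv antipode_left N) antipode_right w"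
    by (rule conv_assoc[symmetric]) (simp_all add: antipode_left_Wspace antipode_right_Wspace)
  also have "\<dots> = antipode_right w"
    using assms by (simp add: conv_antipode_left[abs_def] conv_unit_left pack_packed)
  finally show ?thesis .
qed

lemma hopf_algebra_W: "hopf_algebra (W :: ('k::field, 'k wspace) bialg)"
proof (rule hopf_algebra.intro[OF bialgebra_W hopf_algebra_axioms.intro])
  let ?S = "lin antipode_left :: 'k wspace \<Rightarrow> _"
  have unit: "lin conv_unit F = scale (lookup F []) (N [])" for F :: "'k wspace"
  proof -
    have "lin conv_unit F = (\<Sum>w\<in>keys F. if w = [] then scale (lookup F []) (N []) else 0)"
      unfolding lin_def conv_unit_def by (intro sum.cong refl) auto
    then show ?thesis by (simp add: in_keys_iff)
  qed
  have S: "?S F \<in> Wspace" for F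
    by (intro lin_Wspace antipode_left_Wspace)
  have left: "tensor_eval W (\<lambda>xs. Wmult (?S (xs ! 0)) (xs ! 1)) (Wcomult F) = scale (lookup F []) (N [])" for F
    using tensor_eval_Wcomult[of "\<lambda>x y. Wmult (?S x) y" F] S
    by (simp add: conv_def[symmetric] conv_antipode_left unit)
  \<comment> \<open>The arguments inside a convolution are packed, and on packed words the two
    inverses agree.\<close>
  have "lin (conv N antipode_left) F = lin conv_unit F" for F :: "'k wspace"
    by (intro lin_cong) (simp add: conv_def antipode_left_eq_right flip: conv_antipode_right)
  then have right: "tensor_eval W (\<lambda>xs. Wmult (xs ! 0) (?S (xs ! 1))) (Wcomult F) = scale (lookup F []) (N [])" for F
    using tensor_eval_Wcomult[of "\<lambda>x y. Wmult x (?S y)" F] S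
    by (simp add: conv_def[symmetric, abs_def] unit)
  have "antipode W ?S"
    unfolding antipode_def using S left right by (simp add: lin_add lin_scale)
  then show "\<exists>S. antipode (W :: ('k, 'k wspace) bialg) S" by blast
qed

section \<open>The internal product\<close>

definition Nstar :: "nat list \<Rightarrow> nat list \<Rightarrow> 'k::field wspace"
  where "Nstar u v = (if length u = length v then N (pack (zip u v)) else 0)"

lemma star_eq: "star F G = lin (\<lambda>u. lin (Nstar u) G) F"
  unfolding star_def Nstar_def[abs_def] ..

lemma star_N_left: "star (N u) G = lin (Nstar u) G"
  by (simp add: star_eq)

lemma star_N [simp]: "star (N u) (N v) = Nstar u v"
  by (simp add: star_eq)

lemma star_zero [simp]: "star 0 F = 0" "star F 0 = 0"
  by (simp_all add: star_eq)

lemma star_add_left: "star (F + G) H = star F H + star G H"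
  by (simp add: star_eq lin_add)

lemma star_add_right: "star H (F + G) = star H F + star H G"
  by (simp add: star_eq lin_add lin_fun_add)

lemma star_diff_right: "star H (F - G) = star H F - star H G"
  by (simp add: star_eq lin_diff lin_fun_diff)

lemma star_scale_left: "star (scale c F) G = scale c (star F G)"
  by (simp add: star_eq lin_scale)

lemma star_scale_right: "star F (scale c G) = scale c (star F G)"
  by (simp add: star_eq lin_scale lin_fun_scale)

lemma star_lin_left: "star (lin f F) G = lin (\<lambda>u. star (f u) G) F"
  by (simp add: star_eq lin_lin)

lemma star_lin_right: "star F (lin g G) = lin (\<lambda>v. star F (g v)) G"
  by (simp add: star_eq lin_lin lin_swap[of _ F])

lemma less_pair_iff: "(a, b) < (c, d) \<longleftrightarrow> a < c \<or> a = c \<and> b < d" for a c :: "'a::linorder" and b d :: "'b::linorder"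
  by (auto simp: less_prod_def)

text \<open>Passing to ranks in the upper row keeps the lexicographic order of the occurring
  biletters.\<close>

lemma pack_zip_pack_left: "pack (zip (pack u) v) = pack (zip u v)"
proof -
  have "zip (pack u) v = map (\<lambda>(a, b). (rank (set u) a, b)) (zip u v)"
    by (simp add: pack_eq_map_rank zip_map1)
  moreover have "pack \<dots> = pack (zip u v)"
  proof (rule pack_map, clarify)
    fix a b c d assume "(a, b) \<in> set (zip u v)" "(c, d) \<in> set (zip u v)" "(a, b) < (c, d)"
    then show "(rank (set u) a, b) < (rank (set u) c, d)"
      unfolding less_pair_iff using rank_less[OF finite_set, of _ u] by (auto dest: set_zip_leftD)
  qed
  ultimately show ?thesis by simp
qed

lemma pack_zip_pack_right: "pack (zip u (pack v)) = pack (zip u v)"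
proof -
  have "zip u (pack v) = map (\<lambda>(a, b). (a, rank (set v) b)) (zip u v)"
    by (simp add: pack_eq_map_rank zip_map2)
  moreover have "pack \<dots> = pack (zip u v)"
  proof (rule pack_map, clarify)
    fix a b c d assume "(a, b) \<in> set (zip u v)" "(c, d) \<in> set (zip u v)" "(a, b) < (c, d)"
    then show "(a, rank (set v) b) < (c, rank (set v) d)"
      unfolding less_pair_iff using rank_less[OF finite_set, of _ v] by (auto dest: set_zip_rightD)
  qed
  ultimately show ?thesis by simp
qed

text \<open>Both nestings order triples lexicographically in the same way; hence the internal
  product is associative.\<close>

lemma pack_zip_assoc: "pack (zip (zip u v) w) = pack (zip u (zip v w))"
  unfolding zip_assoc by (rule pack_map[symmetric]) (auto simp: less_pair_iff)

lemma pack_zip_replicate_left: "length u = n \<Longrightarrow> pack (zip (replicate n c) u) = pack u"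
  for c :: "'a::linorder" and u :: "'b::linorder list"
  unfolding zip_replicate1 by (simp add: pack_map less_pair_iff)

lemma pack_zip_replicate_right: "length u = n \<Longrightarrow> pack (zip u (replicate n c)) = pack u"
  for c :: "'a::linorder" and u :: "'b::linorder list"
  unfolding zip_replicate2 by (simp add: pack_map less_pair_iff)

lemma Nstar_assoc: "star (Nstar u v) (N w) = star (N u) (Nstar v w)"
proof (cases "length u = length v \<and> length v = length w")
  case True
  then show ?thesis
    by (simp add: Nstar_def pack_zip_pack_left pack_zip_pack_right pack_zip_assoc)
next
  case False
  then show ?thesis by (auto simp: Nstar_def)
qed

lemma star_assoc: "star (star F G) H = star F (star G H)"
proof -
  have "star (star F G) H = lin (\<lambda>u. lin (\<lambda>v. star (Nstar u v) H) G) F"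
    by (simp add: star_eq[of F G] star_lin_left)
  also have "\<dots> = lin (\<lambda>u. lin (\<lambda>v. lin (\<lambda>t. star (Nstar u v) (N t)) H) G) F"
    by (subst (1) lin_N[of H, symmetric]) (simp add: star_lin_right)
  also have "\<dots> = lin (\<lambda>u. star (N u) (star G H)) F"
    by (simp add: star_eq[of G H] star_lin_right Nstar_assoc)
  also have "\<dots> = star F (star G H)"
    by (subst (2) lin_N[of F, symmetric]) (simp only: star_lin_left)
  finally show ?thesis .
qed

lemma WnD: "F \<in> Wn n \<Longrightarrow> u \<in> keys F \<Longrightarrow> packed u \<and> length u = n"
  by (auto simp: Wn_def Wspace_def)

lemma subspace_Wn: "pm.subspace (Wn n)"
  unfolding pm.subspace_def Wn_def Wspace_def
  by (auto dest!: subsetD[OF keys_add] subsetD[OF keys_scale])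

lemma Wn_simps [simp]:
  "0 \<in> Wn n" "F \<in> Wn n \<Longrightarrow> G \<in> Wn n \<Longrightarrow> F + G \<in> Wn n" "F \<in> Wn n \<Longrightarrow> scale c F \<in> Wn n"
  "F \<in> Wn n \<Longrightarrow> - F \<in> Wn n"
  by (simp_all add: pm.subspace_0 pm.subspace_add pm.subspace_scale pm.subspace_neg subspace_Wn)

lemma Wn_Wspace: "F \<in> Wn n \<Longrightarrow> F \<in> Wspace"
  by (simp add: Wn_def)

lemma N_in_Wn [simp]: "N u \<in> Wn n \<longleftrightarrow> packed u \<and> length u = n"
  by (simp add: Wn_def)

lemma packed_replicate: "packed (replicate n 1)"
  by (rule packedI[of _ "if n = 0 then 0 else 1"]) auto

declare packed_replicate [simplified, simp]

lemma Nstar_Wspace [simp]: "Nstar u v \<in> Wspace"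
  by (simp add: Nstar_def)

lemma star_Wspace [simp]: "star F G \<in> Wspace"
  unfolding star_eq by (intro lin_Wspace Nstar_Wspace)

lemma star_Wn [simp]: "F \<in> Wn n \<Longrightarrow> G \<in> Wn n \<Longrightarrow> star F G \<in> Wn n"
  unfolding star_eq by (intro lin_mem[OF subspace_Wn]) (simp add: Nstar_def WnD)

text \<open>This vanishing selects, among all cuts in a coproduct, the one at a prescribed
  length.\<close>

lemma star_Wn_length:
  assumes "F \<in> Wn m" "m \<noteq> length u"
  shows "star (N u) F = 0"
proof -
  have "lin (Nstar u) F = lin (\<lambda>v. 0) F"
    using WnD[OF assms(1)] assms(2) by (intro lin_cong) (auto simp: Nstar_def)
  then show ?thesis by (simp add: star_N_left)
qed

lemma star_one_left: "F \<in> Wn n \<Longrightarrow> star (N (replicate n 1)) F = F"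
proof -
  assume F: "F \<in> Wn n"
  have "lin (Nstar (replicate n 1)) F = lin N F"
    using WnD[OF F] by (intro lin_cong) (simp add: Nstar_def pack_zip_replicate_left pack_packed)
  then show ?thesis by (simp add: star_N_left lin_N)
qed

lemma star_one_right: "F \<in> Wn n \<Longrightarrow> star F (N (replicate n 1)) = F"
proof -
  assume F: "F \<in> Wn n"
  have "lin (\<lambda>u. Nstar u (replicate n 1)) F = lin N F"
    using WnD[OF F] by (intro lin_cong) (simp add: Nstar_def pack_zip_replicate_right pack_packed)
  then show ?thesis by (simp add: star_eq lin_N)
qed

lemma star_algebra_simps [simp]: "carrier (star_algebra n) = Wn n" "monoid.mult (star_algebra n) = star"
  "one (star_algebra n) = N (replicate n 1)" "ring.zero (star_algebra n) = 0"
  "add (star_algebra n) = (+)" "smult (star_algebra n) = scale"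
  by (simp_all add: star_algebra_def)

lemma k_algebra_star: "k_algebra (star_algebra n :: ('k::field, 'k wspace) module)"
proof -
  let ?A = "star_algebra n :: ('k, 'k wspace) module"
  have ab: "abelian_group ?A"
  proof (rule abelian_groupI)
    fix F assume "F \<in> carrier ?A"
    then show "\<exists>G\<in>carrier ?A. G \<oplus>\<^bsub>?A\<^esub> F = \<zero>\<^bsub>?A\<^esub>"
      by (intro bexI[of _ "- F"]) auto
  qed (auto simp: algebra_simps)
  have ring: "ring ?A"
  proof (rule ringI[OF ab])
    show "monoid ?A"
      by (rule monoidI) (auto simp: star_assoc star_one_left[simplified] star_one_right[simplified])
  qed (auto simp: star_add_left star_add_right)
  have mod: "module scalars ?A"
    by (rule moduleI[OF cring_scalars ab]) (auto simp: pm.scale_left_distrib pm.scale_right_distrib)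
  show ?thesis
    by (intro k_algebra.intro mod ring k_algebra_axioms.intro)
      (auto simp: star_scale_left star_scale_right)
qed


section \<open>The ideal J\<close>

text \<open>Phrased by positions and not by counting letters, because \<open>zip\<close> and
  \<open>pack\<close> keep positions.\<close>

definition has_single :: "'a list \<Rightarrow> bool"
  where "has_single w \<longleftrightarrow> (\<exists>i<length w. \<forall>j<length w. w ! j = w ! i \<longrightarrow> j = i)"

lemma count_list_eq_1_iff: "count_list w a = 1 \<longleftrightarrow> (\<exists>i<length w. w ! i = a \<and> (\<forall>j<length w. w ! j = a \<longrightarrow> j = i))"
proof -
  have "count_list w a = card {i. i < length w \<and> w ! i = a}"
    by (simp add: count_list_eq_length_filter length_filter_conv_card eq_commute)
  then show ?thesis
    by (auto simp: card_1_singleton_iff)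
qed

lemma has_single_iff_count: "has_single w \<longleftrightarrow> (\<exists>a. count_list w a = 1)"
  unfolding has_single_def count_list_eq_1_iff by blast

lemma has_single_pack: "has_single w \<Longrightarrow> has_single (pack w)"
  unfolding has_single_def pack_eq_map_rank
  using inj_on_rank[of "set w"] by (auto simp: inj_on_def)

text \<open>An equal biletter at another position would repeat the isolated upper letter.\<close>

lemma has_single_zip_left: "has_single u \<Longrightarrow> length u = length v \<Longrightarrow> has_single (zip u v)"
  unfolding has_single_def by auto

lemma has_single_zip_right: "has_single v \<Longrightarrow> length u = length v \<Longrightarrow> has_single (zip u v)"
  unfolding has_single_def by auto

text \<open>The isolated position falls on one side of the cut; this makes \<open>J\<close> a
  coideal.\<close>

lemma has_single_take_drop:
  assumes "has_single w" "i \<le> length w"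
  shows "has_single (take i w) \<or> has_single (drop i w)"
proof -
  obtain k where k: "k < length w" "\<And>j. j < length w \<Longrightarrow> w ! j = w ! k \<Longrightarrow> j = k"
    using assms by (auto simp: has_single_def)
  show ?thesis
  proof (cases "k < i")
    case True
    then have "has_single (take i w)"
      unfolding has_single_def using k by (intro exI[of _ k]) auto
    then show ?thesis ..
  next
    case False
    have "has_single (drop i w)"
      unfolding has_single_def
    proof (intro exI[of _ "k - i"] conjI allI impI)
      show "k - i < length (drop i w)" using False k assms by simp
      fix j assume "j < length (drop i w)" "drop i w ! j = drop i w ! (k - i)"
      then show "j = k - i" using False k(1) k(2)[of "i + j"] by simp
    qed
    then show ?thesis ..
  qed
qed

lemma has_single_shuffles:
  assumes "w \<in> shuffles u v" "set u \<inter> set v = {}" "has_single u \<or> has_single v"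
  shows "has_single w"
proof -
  have "count_list w a = count_list u a + count_list v a" for a
    using mset_shuffles[OF assms(1)] by (metis count_mset count_union)
  moreover have "count_list u a = 0 \<or> count_list v a = 0" for a
    using assms(2) by (auto simp: count_list_0_iff)
  ultimately show ?thesis
    using assms(3) unfolding has_single_iff_count by (metis add.left_neutral add.right_neutral one_neq_zero)
qed

section \<open>The span of the words with an isolated letter\<close>

definition Jspan :: "'k::field wspace set"
  where "Jspan = {F \<in> Wspace. \<forall>u\<in>keys F. has_single u}"

lemma subspace_Jspan: "pm.subspace Jspan"
  unfolding pm.subspace_def Jspan_def
  by (auto dest!: subsetD[OF keys_add] subsetD[OF keys_scale])

lemma N_in_Jspan: "N u \<in> Jspan \<longleftrightarrow> packed u \<and> has_single u"
  by (simp add: Jspan_def)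

lemma JspanD: "F \<in> Jspan \<Longrightarrow> u \<in> keys F \<Longrightarrow> packed u \<and> has_single u"
  by (simp add: Jspan_def Wspace_def)

lemma Nmult_Jspan:
  assumes "packed u" "packed v" "has_single u \<or> has_single v"
  shows "Nmult u v \<in> Jspan"
  unfolding Nmult_def
proof (intro pm.subspace_sum[OF subspace_Jspan])
  fix w assume w: "w \<in> shuffles u (map (\<lambda>a. a + wmax u) v)"
  have "has_single (map (\<lambda>a. a + wmax u) v)" if "has_single v"
    using that unfolding has_single_def by auto
  then have "has_single w"
    using assms by (intro has_single_shuffles[OF w]) (auto simp: set_packed)
  then show "N w \<in> Jspan"
    using packed_shuffles[OF assms(1,2) w] by (simp add: N_in_Jspan)
qed

lemma Wmult_Jspan:
  assumes "F \<in> Wspace" "G \<in> Wspace" "F \<in> Jspan \<or> G \<in> Jspan"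
  shows "Wmult F G \<in> Jspan"
  unfolding Wmult_eq using assms
  by (intro lin_mem[OF subspace_Jspan] Nmult_Jspan) (auto dest: WspaceD JspanD)

lemma star_Jspan: "F \<in> Jspan \<or> G \<in> Jspan \<Longrightarrow> star F G \<in> Jspan"
  unfolding star_eq
  by (intro lin_mem[OF subspace_Jspan])
    (auto simp: Nstar_def N_in_Jspan pm.subspace_0[OF subspace_Jspan] dest!: JspanD
      intro!: has_single_pack intro: has_single_zip_left has_single_zip_right)

lemma ideal_Jspan: "ideal (Jspan :: 'k::field wspace set) W"
proof (rule idealI)
  interpret W: k_algebra "W :: ('k, 'k wspace) bialg" by (rule k_algebra_W)
  show "ring (W :: ('k, 'k wspace) bialg)" by (rule W.ring_axioms)
  have J: "F \<in> Wspace" if "F \<in> Jspan" for F :: "'k wspace"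
    using that by (simp add: Jspan_def)
  show "subgroup (Jspan :: 'k wspace set) (add_monoid W)"
  proof
    fix F G :: "'k wspace"
    assume "F \<in> Jspan" "G \<in> Jspan"
    then show "F \<otimes>\<^bsub>add_monoid W\<^esub> G \<in> Jspan"
      by (simp add: pm.subspace_add[OF subspace_Jspan])
  next
    fix F :: "'k wspace" assume F: "F \<in> Jspan"
    have "\<ominus>\<^bsub>W\<^esub> F = - F"
      by (rule W.minus_equality) (use F J in auto)
    with F show "inv\<^bsub>add_monoid W\<^esub> F \<in> Jspan"
      unfolding a_inv_def[symmetric] by (simp add: pm.subspace_neg[OF subspace_Jspan])
  qed (auto simp: J pm.subspace_0[OF subspace_Jspan])
  fix F G :: "'k wspace" assume "F \<in> Jspan" "G \<in> carrier W"
  then show "G \<otimes>\<^bsub>W\<^esub> F \<in> Jspan" "F \<otimes>\<^bsub>W\<^esub> G \<in> Jspan"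
    using J by (auto intro: Wmult_Jspan)
qed

lemma J_eq_Jspan: "(J :: 'k::field_char_0 wspace set) = Jspan"
proof
  interpret W: k_algebra "W :: ('k, 'k wspace) bialg" by (rule k_algebra_W)
  let ?S = "{N u | u. packed u \<and> (\<exists>a. count_list u a = 1)} :: 'k wspace set"
  show "J \<subseteq> (Jspan :: 'k wspace set)"
    unfolding J_def by (rule W.genideal_minimal[OF ideal_Jspan])
      (auto simp: N_in_Jspan has_single_iff_count)
  have S: "?S \<subseteq> carrier W" by auto
  interpret J: ideal "J :: 'k wspace set" W
    unfolding J_def using S by (rule W.genideal_ideal)
  show "Jspan \<subseteq> (J :: 'k wspace set)"
  proof
    fix F :: "'k wspace" assume F: "F \<in> Jspan"
    have single: "scale c (N u) \<in> J" if "packed u" "has_single u" for c :: 'k and u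
    proof -
      have "N u \<in> (J :: 'k wspace set)"
        unfolding J_def using W.genideal_self[OF S] that by (auto simp: has_single_iff_count)
      \<comment> \<open>A ring ideal is not closed under scalars by definition; multiplying by a
        multiple of the unit supplies this.\<close>
      then have "Wmult (scale c (N [])) (N u) \<in> J"
        using J.I_l_closed[of "N u" "scale c (N [])"] by simp
      then show ?thesis by (simp only: Wmult_scale_left Wmult_one_left)
    qed
    have "(\<Sum>u\<in>K. scale (lookup F u) (N u)) \<in> J" if "K \<subseteq> keys F" for K
      using finite_subset[OF that finite_keys] that
    proof (induction K rule: finite_induct)
      case empty
      show ?case using J.zero_closed by simp
    next
      case (insert u K)
      then show ?case
        using J.a_closed[of "scale (lookup F u) (N u)"] single JspanD[OF F, of u] by simp
    qed
    from this[OF subset_refl] show "F \<in> J"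
      unfolding lin_def[symmetric] lin_N .
  qed
qed

section \<open>The elements \<open>S\<^sub>n\<^sup>\<sharp>\<close>\<close>

text \<open>Indexed by the content of the words, which makes invariance under permutations of
  positions visible in \<open>lookup_Nsym\<close>.\<close>

definition Nsym :: "nat multiset \<Rightarrow> 'k::field wspace"
  where "Nsym M = (\<Sum>w\<in>permutations_of_multiset M. N w)"

lemma lookup_Nsym: "lookup (Nsym M) h = (if mset h = M then 1 else 0)"
proof -
  have "h \<in> permutations_of_multiset M \<longleftrightarrow> mset h = M"
    by (auto intro: permutations_of_multisetI dest: permutations_of_multisetD)
  then show ?thesis by (simp add: Nsym_def lookup_sum lookup_N)
qed

lemma mset_eq_replicate_mset_iff: "mset w = replicate_mset k x \<longleftrightarrow> w = replicate k x"
  by (metis mset_replicate mset_eq_length length_replicate replicate_eqI set_mset_mset in_replicate_mset)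

text \<open>Multiplication by \<open>N_{1^k}\<close> inserts \<open>k\<close> copies of the letter \<open>i + 1\<close> in all possible
  ways.\<close>

lemma Wmult_Nsym_replicate:
  "Wmult (Nsym (mset [1..<Suc i])) (N (replicate k 1)) = Nsym (mset [1..<Suc i] + replicate_mset k (Suc i))"
proof -
  let ?X = "permutations_of_multiset (mset [1..<Suc i])"
  let ?Y = "permutations_of_multiset (mset [1..<Suc i] + replicate_mset k (Suc i))"
  have X: "set u = {1..i}" "wmax u = i" if "u \<in> ?X" for u
  proof -
    show "set u = {1..i}"
      using permutations_of_multisetD[OF that] by (metis atLeastLessThanSuc_atLeastAtMost set_mset_mset set_upt)
    then show "wmax u = i" by (rule wmax_eq)
  qed
  have in_shuf: "w \<in> shuffles u (replicate k (Suc i)) \<longleftrightarrow>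
      filter (\<lambda>a. a \<le> i) w = u \<and> filter (\<lambda>a. \<not> a \<le> i) w = replicate k (Suc i)" if "u \<in> ?X" for u w
    using X[OF that] by (intro in_shuffles_iff) auto
  have "Wmult (Nsym (mset [1..<Suc i])) (N (replicate k 1)) =
      (\<Sum>u\<in>?X. \<Sum>w\<in>shuffles u (replicate k (Suc i)). N w)"
    unfolding Nsym_def Wmult_sum_left Wmult_N Nmult_def using X by (intro sum.cong refl) simp
  also have "\<dots> = (\<Sum>(u, w)\<in>Sigma ?X (\<lambda>u. shuffles u (replicate k (Suc i))). N w)"
    by (rule sum.Sigma) auto
  also have "\<dots> = (\<Sum>w\<in>?Y. N w)"
  \<comment> \<open>The inserted letter is \<open>Suc i\<close> for every \<open>u\<close>, since
    \<open>wmax u = i\<close>; the subword of letters up to \<open>i\<close> gives \<open>u\<close>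
    back.\<close>
  proof (rule sum.reindex_bij_witness[where j = "\<lambda>(u, w). w" and i = "\<lambda>w. (filter (\<lambda>a. a \<le> i) w, w)"])
    fix w assume "w \<in> ?Y"
    then have w: "mset w = mset [1..<Suc i] + replicate_mset k (Suc i)"
      by (rule permutations_of_multisetD)
    have lo: "mset (filter (\<lambda>a. a \<le> i) w) = mset [1..<Suc i]"
    proof -
      have "filter_mset (\<lambda>a. a \<le> i) (mset [1..<Suc i]) = mset [1..<Suc i]"
        by (simp only: filter_mset_eq_conv) auto
      moreover have "filter_mset (\<lambda>a. a \<le> i) (replicate_mset k (Suc i)) = {#}"
        by (simp add: filter_mset_eq_mempty_iff)
      ultimately show ?thesis by (simp add: w del: upt_Suc)
    qed
    have "mset (filter (\<lambda>a. \<not> a \<le> i) w) = replicate_mset k (Suc i)"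
    proof -
      have "filter_mset (\<lambda>a. \<not> a \<le> i) (mset [1..<Suc i]) = {#}"
        by (simp only: filter_mset_eq_mempty_iff) auto
      moreover have "filter_mset (\<lambda>a. \<not> a \<le> i) (replicate_mset k (Suc i)) = replicate_mset k (Suc i)"
        by (simp only: filter_mset_eq_conv) (auto simp: in_replicate_mset)
      ultimately show ?thesis by (simp add: w del: upt_Suc not_le)
    qed
    then have hi: "filter (\<lambda>a. \<not> a \<le> i) w = replicate k (Suc i)"
      by (simp only: mset_eq_replicate_mset_iff)
    have "filter (\<lambda>a. a \<le> i) w \<in> ?X"
      by (rule permutations_of_multisetI[OF lo])
    moreover from this have "w \<in> shuffles (filter (\<lambda>a. a \<le> i) w) (replicate k (Suc i))"
      using hi in_shuf by blast
    ultimately show "(filter (\<lambda>a. a \<le> i) w, w) \<in> Sigma ?X (\<lambda>u. shuffles u (replicate k (Suc i)))"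
      by blast
  next
    fix p assume "p \<in> Sigma ?X (\<lambda>u. shuffles u (replicate k (Suc i)))"
    then obtain u w where p: "p = (u, w)" "u \<in> ?X" "w \<in> shuffles u (replicate k (Suc i))" by auto
    then show "(filter (\<lambda>a. a \<le> i) (case p of (u, w) \<Rightarrow> w), case p of (u, w) \<Rightarrow> w) = p"
      by (simp add: in_shuf)
    show "(case p of (u, w) \<Rightarrow> w) \<in> ?Y"
      using p permutations_of_multisetD[OF p(2)] mset_shuffles[OF p(3)]
      by (auto intro!: permutations_of_multisetI)
  qed auto
  finally show ?thesis by (simp add: Nsym_def)
qed

lemma Nsym_replicate: "Nsym (replicate_mset k x) = N (replicate k x)"
proof (rule poly_mapping_eqI)
  fix h :: "nat list"
  show "lookup (Nsym (replicate_mset k x)) h = lookup (N (replicate k x)) h"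
    by (auto simp: lookup_Nsym lookup_N mset_eq_replicate_mset_iff)
qed

text \<open>Each further factor inserts the next letter once, so the power runs through all
  permutations of 1..i.\<close>

lemma N1_power: "(N [1] :: 'k::field wspace) [^]\<^bsub>W\<^esub> i = Nsym (mset [1..<Suc i])"
proof (induction i)
  case 0
  show ?case by (simp add: Nsym_def)
next
  case (Suc i)
  have "N [1] [^]\<^bsub>W\<^esub> Suc i = Wmult (N [1] [^]\<^bsub>W\<^esub> i) (N [1] :: 'k wspace)"
    by simp
  also have "\<dots> = Wmult (Nsym (mset [1..<Suc i])) (N (replicate 1 1))"
    unfolding Suc.IH by simp
  also have "\<dots> = Nsym (mset [1..<Suc (Suc i)])"
    unfolding Wmult_Nsym_replicate by simp
  finally show ?case .
qed

text \<open>The common content of the words in the i-th summand of \<open>Ssharp n\<close>.\<close>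

definition sharp_mset :: "nat \<Rightarrow> nat \<Rightarrow> nat multiset"
  where "sharp_mset n i = mset [1..<Suc i] + replicate_mset (n - i) (Suc i)"

lemma Ssharp_Nsym: "Ssharp n = (\<Sum>i\<le>n. scale ((-1) ^ i / fact i) (Nsym (sharp_mset n i)))"
  unfolding Ssharp_def N1_power W_simps Wmult_Nsym_replicate sharp_mset_def ..

text \<open>Each summand is a full sum of rearrangements. This is the symmetry on which
  \<open>sharp_Nmult\<close> and \<open>sharp_permute\<close> rely.\<close>

lemma lookup_Ssharp_cong:
  "mset h = mset h' \<Longrightarrow> lookup (Ssharp n) h = lookup (Ssharp n) h'"
  by (simp add: Ssharp_Nsym lookup_sum lookup_Nsym)

text \<open>For \<open>i = n\<close> there is no copy of the letter \<open>Suc i\<close>, so the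
  maximum is one less.\<close>

lemma set_sharp_mset: "i \<le> n \<Longrightarrow> set_mset (sharp_mset n i) = {1..if i = n then i else Suc i}"
  by (auto simp: sharp_mset_def in_replicate_mset simp del: upt_Suc)

lemma Nsym_sharp_mset_Wn: "i \<le> n \<Longrightarrow> Nsym (sharp_mset n i) \<in> Wn n"
  unfolding Nsym_def
proof (intro pm.subspace_sum[OF subspace_Wn])
  fix w assume "i \<le> n" "w \<in> permutations_of_multiset (sharp_mset n i)"
  then have w: "mset w = sharp_mset n i" by (simp add: permutations_of_multisetD)
  have "size (mset w) = n"
    using \<open>i \<le> n\<close> unfolding w by (simp add: sharp_mset_def del: upt_Suc)
  moreover have "packed w"
    using set_sharp_mset[OF \<open>i \<le> n\<close>] w by (metis packedI set_mset_mset)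
  ultimately show "N w \<in> Wn n" by simp
qed

lemma Ssharp_Wn [simp]: "Ssharp n \<in> Wn n"
  unfolding Ssharp_Nsym
  by (intro pm.subspace_sum[OF subspace_Wn] pm.subspace_scale[OF subspace_Wn] Nsym_sharp_mset_Wn) simp

lemma Ssharp_Wspace [simp]: "Ssharp n \<in> Wspace"
  using Ssharp_Wn by (rule Wn_Wspace)

text \<open>The summand for 0 is \<open>N (replicate n 1)\<close>; in all others the letter 1 is one
  of the distinct letters 1..i and is therefore isolated.\<close>

lemma Ssharp_diff_Jspan: "(Ssharp n :: 'k::field_char_0 wspace) - N (replicate n 1) \<in> Jspan"
proof -
  have "Nsym (sharp_mset n 0) = (N (replicate n 1) :: 'k wspace)"
    by (simp add: sharp_mset_def Nsym_replicate)
  then have "Ssharp n = N (replicate n 1) + (\<Sum>i\<in>{1..n}. scale ((-1) ^ i / fact i) (Nsym (sharp_mset n i)) :: 'k wspace)"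
    unfolding Ssharp_Nsym by (simp add: atMost_atLeast0 sum.atLeast_Suc_atMost)
  moreover have "(\<Sum>i\<in>{1..n}. scale ((-1) ^ i / fact i) (Nsym (sharp_mset n i)) :: 'k wspace) \<in> Jspan"
  proof (intro pm.subspace_sum[OF subspace_Jspan] pm.subspace_scale[OF subspace_Jspan])
    fix i assume i: "i \<in> {1..n}"
    show "(Nsym (sharp_mset n i) :: 'k wspace) \<in> Jspan"
      unfolding Nsym_def
    proof (intro pm.subspace_sum[OF subspace_Jspan])
      fix w assume "w \<in> permutations_of_multiset (sharp_mset n i)"
      then have w: "mset w = sharp_mset n i" by (simp add: permutations_of_multisetD)
      have "packed w"
        using set_sharp_mset[of i n] w i by (metis atLeastAtMost_iff packedI set_mset_mset)
      moreover have "count_list w 1 = 1"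
        using i unfolding count_mset[symmetric] w
        by (simp add: sharp_mset_def distinct_count_atmost_1 del: upt_Suc)
      ultimately show "N w \<in> Jspan"
        by (auto simp: N_in_Jspan has_single_iff_count)
    qed
  qed
  ultimately show ?thesis by simp
qed

lemma Ssharp_0 [simp]: "Ssharp 0 = N []"
  by (simp add: Ssharp_def)

lemma Ssharp_1: "Ssharp 1 = 0"
  by (simp add: Ssharp_Nsym sharp_mset_def)

text \<open>The formal series of all \<open>x n\<close> is not an element of \<open>W\<close>; this
  says term by term that its coproduct is its tensor square.\<close>

definition group_like :: "(nat \<Rightarrow> 'k::field wspace) \<Rightarrow> bool"
  where "group_like x \<longleftrightarrow> (\<forall>n. x n \<in> Wspace) \<and>
    (\<forall>n. tensor_eq W (Wcomult (x n)) (\<Sum>i\<le>n. single [x i, x (n - i)] 1))"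

lemma Wcomult_sum: "Wcomult (sum f X) = (\<Sum>x\<in>X. Wcomult (f x))"
  by (simp add: Wcomult_eq lin_sum)

lemma Wcomult_scale: "Wcomult (scale c F) = scale c (Wcomult F)"
  by (simp add: Wcomult_eq lin_scale)

lemma tensor_eq_W_scale1: "F \<in> Wspace \<Longrightarrow> G \<in> Wspace \<Longrightarrow>
    tensor_eq W (single [scale c F, G] 1) (single [F, G] c)"
  using tensor_single_smult1[of F W G c] by simp

lemma tensor_eq_W_scale2: "F \<in> Wspace \<Longrightarrow> G \<in> Wspace \<Longrightarrow>
    tensor_eq W (single [G, scale c F] 1) (single [G, F] c)"
  using tensor_single_smult2[of F W G c] by simp

lemma tensors_W_single: "F \<in> Wspace \<Longrightarrow> G \<in> Wspace \<Longrightarrow> single [F, G] c \<in> tensors 2 W"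
  by (rule tensors_single) auto

text \<open>The coproduct is multiplicative, so a product of group-like series is
  group-like.\<close>

lemma group_like_mult:
  assumes x: "group_like x" and y: "group_like y"
  shows "group_like (\<lambda>n. \<Sum>i\<le>n. Wmult (x i) (y (n - i)))"
  unfolding group_like_def
proof (intro conjI allI)
  have xW: "x i \<in> Wspace" and yW: "y i \<in> Wspace" for i
    using x y by (auto simp: group_like_def)
  have xc: "tensor_eq W (Wcomult (x n)) (\<Sum>i\<le>n. single [x i, x (n - i)] 1)"
    and yc: "tensor_eq W (Wcomult (y n)) (\<Sum>i\<le>n. single [y i, y (n - i)] 1)" for n
    using x y by (auto simp: group_like_def)
  interpret W: k_algebra "W :: ('a, 'a wspace) bialg" by (rule k_algebra_W)
  show "(\<Sum>i\<le>n. Wmult (x i) (y (n - i))) \<in> Wspace" for n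
    using xW yW by (intro sum_Wspace) simp
  show "tensor_eq W (Wcomult (\<Sum>i\<le>n. Wmult (x i) (y (n - i))))
      (\<Sum>m\<le>n. single [\<Sum>i\<le>m. Wmult (x i) (y (m - i)),
        \<Sum>i\<le>n - m. Wmult (x i) (y (n - m - i))] 1)" for n
  proof -
    let ?g = "\<lambda>a b c d. single [Wmult (x a) (y b), Wmult (x c) (y d)] (1 :: 'a)"
    have "tensor_eq W (Wcomult (\<Sum>i\<le>n. Wmult (x i) (y (n - i))))
        (\<Sum>i\<le>n. tensor_mult W (Wcomult (x i)) (Wcomult (y (n - i))))"
      unfolding Wcomult_sum using xW yW by (intro tensor_eq_sum comult_Wmult)
    also have "tensor_eq W \<dots> (\<Sum>i\<le>n. tensor_mult W (\<Sum>j\<le>i. single [x j, x (i - j)] 1)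
        (\<Sum>l\<le>n - i. single [y l, y (n - i - l)] 1))"
      by (intro tensor_eq_sum W.tensor_mult_eq pm.subspace_sum[OF subspace_tensors] tensors_W_single
          Wcomult_tensors xW yW xc yc)
    also have "\<dots> = (\<Sum>i\<le>n. \<Sum>j\<le>i. \<Sum>l\<le>n - i. ?g j l (i - j) (n - i - l))"
      by (simp add: tensor_mult_sum tensor_mult_single)
    also have "\<dots> = (\<Sum>(i, j, l)\<in>Sigma {..n} (\<lambda>i. {..i} \<times> {..n - i}). ?g j l (i - j) (n - i - l))"
      by (simp add: sum.cartesian_product sum.Sigma split_def)
    also have "\<dots> = (\<Sum>(m, a, b)\<in>Sigma {..n} (\<lambda>m. {..m} \<times> {..n - m}). ?g a (m - a) b (n - m - b))"
      \<comment> \<open>\<open>m\<close> is the total index in the left leg, \<open>j\<close> from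
        \<open>x\<close> and \<open>l\<close> from \<open>y\<close>; \<open>i - j\<close> is what
        \<open>x\<close> contributes to the right leg.\<close>
      by (rule sum.reindex_bij_witness[where j = "\<lambda>(i, j, l). (j + l, j, i - j)"
          and i = "\<lambda>(m, a, b). (a + b, a, m - a)"]) (auto simp: algebra_simps)
    also have "\<dots> = (\<Sum>m\<le>n. \<Sum>a\<le>m. \<Sum>b\<le>n - m. ?g a (m - a) b (n - m - b))"
      by (simp add: sum.cartesian_product sum.Sigma split_def)
    also have "tensor_eq W \<dots> (\<Sum>m\<le>n. single [\<Sum>i\<le>m. Wmult (x i) (y (m - i)),
        \<Sum>i\<le>n - m. Wmult (x i) (y (n - m - i))] 1)"
      using xW yW by (intro tensor_eq_sum tensor_eq_W_sum_sum[THEN tensor_eq_sym]) simp_all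
    finally show ?thesis .
  qed
qed

text \<open>Rescales the variable of the series; \<open>c = -1\<close> turns the exponential of N_1
  into that of -N_1.\<close>

lemma group_like_scale:
  assumes x: "group_like x"
  shows "group_like (\<lambda>n. scale (c ^ n) (x n))"
  unfolding group_like_def
proof (intro conjI allI)
  have xW: "x i \<in> Wspace" for i
    using x by (auto simp: group_like_def)
  show "scale (c ^ n) (x n) \<in> Wspace" for n
    using xW by simp
  fix n
  have "tensor_eq W (Wcomult (scale (c ^ n) (x n))) (scale (c ^ n) (\<Sum>i\<le>n. single [x i, x (n - i)] 1))"
    unfolding Wcomult_scale using x by (intro tensor_eq_scale) (simp add: group_like_def)
  also have "\<dots> = (\<Sum>i\<le>n. single [x i, x (n - i)] (c ^ n))"
    by (simp add: pm.scale_sum_right)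
  also have "tensor_eq W \<dots> (\<Sum>i\<le>n. single [scale (c ^ i) (x i), scale (c ^ (n - i)) (x (n - i))] 1)"
  proof (rule tensor_eq_sum, rule tensor_eq_sym)
    fix i assume "i \<in> {..n}"
    then have c: "c ^ n = c ^ (n - i) * c ^ i"
      by (simp flip: power_add)
    have "tensor_eq W (single [scale (c ^ i) (x i), scale (c ^ (n - i)) (x (n - i))] 1)
        (single [scale (c ^ i) (x i), x (n - i)] (c ^ (n - i)))"
      using xW by (intro tensor_eq_W_scale2) simp_all
    also have "\<dots> = scale (c ^ (n - i)) (single [scale (c ^ i) (x i), x (n - i)] 1)"
      by simp
    also have "tensor_eq W \<dots> (scale (c ^ (n - i)) (single [x i, x (n - i)] (c ^ i)))"
      using xW by (intro tensor_eq_scale tensor_eq_W_scale1) simp_all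
    finally show "tensor_eq W (single [scale (c ^ i) (x i), scale (c ^ (n - i)) (x (n - i))] 1)
        (single [x i, x (n - i)] (c ^ n))"
      by (simp add: c)
  qed
  finally show "tensor_eq W (Wcomult (scale (c ^ n) (x n)))
      (\<Sum>i\<le>n. single [scale (c ^ i) (x i), scale (c ^ (n - i)) (x (n - i))] 1)" .
qed

lemma group_like_replicate: "group_like (\<lambda>n. N (replicate n 1))"
proof -
  have "pack (replicate n (1 :: nat)) = replicate n 1" for n
    by (rule pack_packed[OF packed_replicate])
  then show ?thesis
    by (simp add: group_like_def Wcomult_eq deconc_def min_absorb2 cong: sum.cong_simp)
qed

text \<open>\<open>N [1]\<close> is primitive and this series is its exponential. The induction
  writes (n + 1) times the next term as a product with \<open>N [1]\<close> and divides by n + 1,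
  which needs characteristic 0.\<close>

lemma group_like_N1_power:
  "group_like (\<lambda>n. scale (1 / fact n) (N [1] [^]\<^bsub>W\<^esub> n :: 'k::field_char_0 wspace))"
proof -
  interpret W: k_algebra "W :: ('k, 'k wspace) bialg" by (rule k_algebra_W)
  define E where "E n = scale (1 / fact n) (N [1] [^]\<^bsub>W\<^esub> n :: 'k wspace)" for n
  have p1: "packed [1]" using packed_replicate[of 1] by simp
  have N1: "N [1] \<in> (Wspace :: 'k wspace set)"
    using p1 by simp
  have EW: "E n \<in> Wspace" for n
    unfolding E_def using W.nat_pow_closed[of "N [1]" n] N1 by simp
  have E_Suc: "Wmult (E n) (N [1]) = scale (of_nat (Suc n)) (E (Suc n))" for n
  proof -
    have "of_nat (Suc n) * (1 / fact (Suc n)) = (1 / fact n :: 'k)"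
      by (simp add: divide_simps del: of_nat_Suc)
    then show ?thesis
      by (simp add: E_def Wmult_scale_left del: of_nat_Suc fact_Suc)
  qed
  let ?s = "\<lambda>F G. single [F, G] (1 :: 'k)"
  have comult_N1: "Wcomult (N [1]) = ?s (N []) (N [1]) + ?s (N [1]) (N [])"
    using pack_packed[OF p1] by (simp add: Wcomult_eq deconc_def)
  have "tensor_eq W (Wcomult (E n)) (\<Sum>i\<le>n. ?s (E i) (E (n - i)))" for n
  proof (induction n)
    case 0
    show ?case by (simp add: E_def Wcomult_eq deconc_def)
  next
    case (Suc n)
    let ?c = "of_nat (Suc n) :: 'k"
    let ?t = "\<lambda>i. ?s (E i) (E (Suc n - i))"
    have "Wcomult (E (Suc n)) = scale (1 / ?c) (Wcomult (Wmult (E n) (N [1])))"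
      unfolding E_Suc Wcomult_scale by (simp del: of_nat_Suc)
    also have "tensor_eq W \<dots> (scale (1 / ?c) (tensor_mult W (Wcomult (E n)) (Wcomult (N [1]))))"
      using EW N1 by (intro tensor_eq_scale comult_Wmult)
    also have "tensor_eq W \<dots> (scale (1 / ?c) (tensor_mult W (\<Sum>i\<le>n. ?s (E i) (E (n - i)))
        (?s (N []) (N [1]) + ?s (N [1]) (N []))))"
      unfolding comult_N1 using EW N1 Suc.IH
      by (intro tensor_eq_scale W.tensor_mult_eq tensors_add pm.subspace_sum[OF subspace_tensors]
          tensors_W_single Wcomult_tensors tensor_eq_refl) simp_all
    also have "tensor_mult W (\<Sum>i\<le>n. ?s (E i) (E (n - i))) (?s (N []) (N [1]) + ?s (N [1]) (N [])) =
        (\<Sum>i\<le>n. ?s (E i) (Wmult (E (n - i)) (N [1]))) + (\<Sum>i\<le>n. ?s (Wmult (E i) (N [1])) (E (n - i)))"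
      by (simp add: tensor_mult_def lin_add lin_fun_add lin_sum)
    also have "tensor_eq W (scale (1 / ?c) \<dots>)
        (scale (1 / ?c) ((\<Sum>i\<le>n. scale (of_nat (Suc (n - i))) (?s (E i) (E (Suc (n - i))))) +
          (\<Sum>i\<le>n. scale (of_nat (Suc i)) (?s (E (Suc i)) (E (n - i))))))"
      unfolding E_Suc scale_single mult_1_right using EW
      by (intro tensor_eq_scale tensor_eq_add tensor_eq_sum tensor_eq_W_scale1 tensor_eq_W_scale2)
    also have "(\<Sum>i\<le>n. scale (of_nat (Suc (n - i))) (?s (E i) (E (Suc (n - i))))) =
        (\<Sum>i\<le>n. scale (of_nat (Suc n - i)) (?t i))"
      by (intro sum.cong refl) (simp only: atMost_iff Suc_diff_le)
    \<comment> \<open>The added term has coefficient 0, as has the term for 0 in the shifted second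
      sum; the two coefficients of \<open>?t i\<close> then add up to \<open>Suc n\<close>.\<close>
    also have "\<dots> = (\<Sum>i\<le>Suc n. scale (of_nat (Suc n - i)) (?t i))"
      by (simp only: sum.atMost_Suc diff_self_eq_0 of_nat_0 pm.scale_zero_left add_0_right)
    also have "(\<Sum>i\<le>n. scale (of_nat (Suc i)) (?s (E (Suc i)) (E (n - i)))) =
        (\<Sum>i\<le>Suc n. scale (of_nat i) (?t i))"
      by (subst sum.atMost_Suc_shift) (simp del: of_nat_Suc scale_single)
    also have "(\<Sum>i\<le>Suc n. scale (of_nat (Suc n - i)) (?t i)) + (\<Sum>i\<le>Suc n. scale (of_nat i) (?t i)) =
        scale ?c (\<Sum>i\<le>Suc n. ?t i)"
      unfolding sum.distrib[symmetric] pm.scale_left_distrib[symmetric] of_nat_add[symmetric] pm.scale_sum_right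
      by (intro sum.cong refl) (simp del: of_nat_Suc)
    also have "scale (1 / ?c) \<dots> = (\<Sum>i\<le>Suc n. ?t i)"
      by (simp del: of_nat_Suc)
    finally show ?case .
  qed
  then show ?thesis
    using EW by (simp add: group_like_def E_def)
qed

lemma group_like_Ssharp: "group_like (Ssharp :: nat \<Rightarrow> 'k::field_char_0 wspace)"
proof -
  have "group_like (\<lambda>n. \<Sum>i\<le>n. Wmult (scale ((-1) ^ i) (scale (1 / fact i) (N [1] [^]\<^bsub>W\<^esub> i)))
      (N (replicate (n - i) 1) :: 'k wspace))"
    by (rule group_like_mult[OF group_like_scale[OF group_like_N1_power] group_like_replicate])
  moreover have "(\<lambda>n. \<Sum>i\<le>n. Wmult (scale ((-1) ^ i) (scale (1 / fact i) (N [1] [^]\<^bsub>W\<^esub> i)))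
      (N (replicate (n - i) 1))) = (Ssharp :: nat \<Rightarrow> 'k wspace)"
    by (simp add: fun_eq_iff Ssharp_def Wmult_scale_left)
  ultimately show ?thesis by simp
qed

section \<open>The map sharp\<close>

text \<open>The group-like \<open>Ssharp\<close> splits at every cut, but \<open>star\<close>
  vanishes unless lengths agree, so pairing with \<open>u\<close> and \<open>v\<close> selects the
  cut at \<open>length u\<close>. Later \<open>B\<close> is \<open>Wmult\<close> or
  \<open>Wcat\<close>.\<close>

lemma lin_Ssharp_split:
  fixes B :: "'k::field_char_0 wspace \<Rightarrow> 'k wspace \<Rightarrow> 'k wspace"
  assumes add1: "\<And>F G H. B (F + G) H = B F H + B G H" and add2: "\<And>F G H. B H (F + G) = B H F + B H G"
    and scale1: "\<And>c F H. B (scale c F) H = scale c (B F H)" and scale2: "\<And>c F H. B H (scale c F) = scale c (B H F)"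
  shows "lin (\<lambda>h. B (Nstar u (take (length u) h)) (Nstar v (drop (length u) h))) (Ssharp (length u + length v)) =
    B (star (N u) (Ssharp (length u))) (star (N v) (Ssharp (length v)))"
proof -
  let ?p = "length u" and ?n = "length u + length v"
  let ?G = "\<lambda>x y. B (star (N u) x) (star (N v) y)"
  let ?S = "Ssharp :: nat \<Rightarrow> 'k wspace"
  have B0: "B 0 F = 0" for F
    using scale1[of 0 0 F] by simp
  \<comment> \<open>With the subspace {0}, the equality of tensors in
    \<open>group_like_Ssharp\<close> becomes an equation between values of \<open>B\<close>.\<close>
  have "lin (\<lambda>xs. ?G (xs ! 0) (xs ! 1)) (Wcomult (?S ?n)) -
      lin (\<lambda>xs. ?G (xs ! 0) (xs ! 1)) (\<Sum>i\<le>?n. single [?S i, ?S (?n - i)] 1) \<in> {0}"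
    by (rule lin_tensor_eq2[where g = ?G and A = W, OF subspace_zero])
      (use group_like_Ssharp in \<open>auto simp: star_add_right star_scale_right add1 add2 scale1 scale2 group_like_def
        intro!: pm.subspace_sum[OF subspace_tensors] tensors_W_single\<close>)
  then have "lin (\<lambda>xs. ?G (xs ! 0) (xs ! 1)) (Wcomult (?S ?n)) = (\<Sum>i\<le>?n. ?G (?S i) (?S (?n - i)))"
    by (simp add: lin_sum)
  also have "\<dots> = (\<Sum>i\<le>?n. if i = ?p then ?G (?S ?p) (?S (length v)) else 0)"
    by (intro sum.cong refl) (auto simp: B0 star_Wn_length[OF Ssharp_Wn])
  also have "\<dots> = ?G (?S ?p) (?S (length v))"
    by simp
  also have "lin (\<lambda>xs. ?G (xs ! 0) (xs ! 1)) (Wcomult (?S ?n)) =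
      lin (\<lambda>h. B (Nstar u (take ?p h)) (Nstar v (drop ?p h))) (?S ?n)"
    unfolding Wcomult_eq lin_lin lin_deconc
  proof (rule lin_cong)
    fix h assume "h \<in> keys (?S ?n)"
    then have h: "length h = ?n"
      using WnD[OF Ssharp_Wn] by blast
    have "(\<Sum>i\<le>length h. ?G ([N (pack (take i h)), N (pack (drop i h))] ! 0) ([N (pack (take i h)), N (pack (drop i h))] ! 1)) =
        (\<Sum>i\<le>length h. if i = ?p then B (Nstar u (take ?p h)) (Nstar v (drop ?p h)) else 0)"
      by (intro sum.cong refl) (auto simp: h B0 Nstar_def pack_zip_pack_right)
    then show "(\<Sum>i\<le>length h. ?G ([N (pack (take i h)), N (pack (drop i h))] ! 0) ([N (pack (take i h)), N (pack (drop i h))] ! 1)) =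
        B (Nstar u (take ?p h)) (Nstar v (drop ?p h))"
      by (simp add: h)
  qed
  finally show ?thesis .
qed

lemma sharp_N: "sharp (N u) = star (N u) (Ssharp (length u))"
  by (simp add: sharp_def)

lemma sharp_add: "sharp (F + G) = sharp F + sharp G"
  by (simp add: sharp_def lin_add)

lemma sharp_diff: "sharp (F - G) = sharp F - sharp G"
  by (simp add: sharp_def lin_diff)

lemma sharp_scale: "sharp (scale c F) = scale c (sharp F)"
  by (simp add: sharp_def lin_scale)

lemma sharp_eq_lin: "sharp F = lin (\<lambda>u. sharp (N u)) F"
  unfolding sharp_N by (simp add: sharp_def)

lemma sharp_lin: "sharp (lin f F) = lin (\<lambda>u. sharp (f u)) F"
  by (simp add: sharp_def lin_lin)

lemma sharp_sum: "sharp (sum f X) = (\<Sum>x\<in>X. sharp (f x))"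
  by (simp add: sharp_def lin_sum)

lemma sharp_Wspace [simp]: "sharp F \<in> Wspace"
  unfolding sharp_def by (intro lin_Wspace) simp

lemma sharp_eq_star: "F \<in> Wn n \<Longrightarrow> sharp F = star F (Ssharp n)"
proof -
  assume F: "F \<in> Wn n"
  have "sharp F = lin (\<lambda>u. star (N u) (Ssharp n)) F"
    unfolding sharp_def using WnD[OF F] by (intro lin_cong) simp
  also have "\<dots> = star F (Ssharp n)"
    by (subst (2) lin_N[of F, symmetric]) (simp only: star_lin_left)
  finally show ?thesis .
qed

lemma length_keys_Ssharp: "h \<in> keys (Ssharp n) \<Longrightarrow> length h = n"
  using WnD[OF Ssharp_Wn, of h n] by blast

lemma sharp_N_sum:
  assumes "length w = n"
  shows "sharp (N w) = (\<Sum>h\<in>keys (Ssharp n :: 'k::field_char_0 wspace).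
    scale (lookup (Ssharp n) h) (N (pack (zip w h)) :: 'k wspace))"
  unfolding sharp_N star_N_left lin_def assms
proof (intro sum.cong refl)
  fix h assume "h \<in> keys (Ssharp n :: 'k wspace)"
  then have "Nstar w h = (N (pack (zip w h)) :: 'k wspace)"
    by (simp only: length_keys_Ssharp Nstar_def assms simp_thms if_True)
  then show "scale (lookup (Ssharp n :: 'k wspace) h) (Nstar w h) =
      scale (lookup (Ssharp n) h) (N (pack (zip w h)))"
    by (simp only:)
qed

text \<open>\<open>z\<close> is the biword of \<open>w\<close> over \<open>h\<close>. Reading its
  lower row first beneath \<open>x\<close> and then beneath \<open>y\<close> rearranges
  \<open>h\<close> into a word over whose front and back \<open>x\<close> and \<open>y\<close>
  stand. \<open>H\<close> and \<open>f\<close> depend only on the content of \<open>h\<close>, so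
  the two sums agree.\<close>

lemma sum_shuffles_zip:
  fixes f :: "'b list \<Rightarrow> ('a \<times> 'b) list \<Rightarrow> 'c::comm_monoid_add"
  assumes P: "\<And>a. a \<in> set x \<Longrightarrow> P a" "\<And>b. b \<in> set y \<Longrightarrow> \<not> P b"
    and H: "finite H" "\<And>h. h \<in> H \<Longrightarrow> length h = length x + length y"
      "\<And>h h'. mset h = mset h' \<Longrightarrow> h \<in> H \<Longrightarrow> h' \<in> H"
    and f: "\<And>h h' z. mset h = mset h' \<Longrightarrow> f h z = f h' z"
  shows "(\<Sum>w\<in>shuffles x y. \<Sum>h\<in>H. f h (zip w h)) =
    (\<Sum>h\<in>H. \<Sum>z\<in>shuffles (zip x (take (length x) h)) (zip y (drop (length x) h)). f h z)"
proof -
  let ?Q = "\<lambda>p :: 'a \<times> 'b. P (fst p)" and ?Q' = "\<lambda>p :: 'a \<times> 'b. \<not> P (fst p)"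
  let ?Z = "\<lambda>h. shuffles (zip x (take (length x) h)) (zip y (drop (length x) h))"
  let ?h = "\<lambda>z. map snd (filter ?Q z) @ map snd (filter ?Q' z)"
  let ?j = "\<lambda>(w, h). (?h (zip w h), zip w h)" and ?i = "\<lambda>(h, z). (map fst z, map snd z)"
  have iff1: "w \<in> shuffles x y \<longleftrightarrow> filter P w = x \<and> filter (\<lambda>a. \<not> P a) w = y" for w
    by (rule in_shuffles_iff) (use P in auto)
  have iff2: "z \<in> ?Z h \<longleftrightarrow> filter ?Q z = zip x (take (length x) h) \<and> filter ?Q' z = zip y (drop (length x) h)" for z h
    by (rule in_shuffles_iff) (use P in \<open>auto dest: set_zip_leftD\<close>)
  have mset_h: "mset (?h z) = mset (map snd z)" for z
    by (simp only: mset_append mset_map mset_filter image_mset_union[symmetric] multiset_partition[symmetric])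
  have fst_filter: "map fst (filter ?Q z) = filter P (map fst z)"
    "map fst (filter ?Q' z) = filter (\<lambda>a. \<not> P a) (map fst z)" for z
    by (simp_all add: filter_map o_def)
  have "(\<Sum>w\<in>shuffles x y. \<Sum>h\<in>H. f h (zip w h)) = (\<Sum>(w, h)\<in>shuffles x y \<times> H. f h (zip w h))"
    by (rule sum.cartesian_product)
  also have "\<dots> = (\<Sum>(h, z)\<in>Sigma H ?Z. f h z)"
  proof (rule sum.reindex_bij_witness[where j = ?j and i = ?i])
    fix p assume "p \<in> shuffles x y \<times> H"
    then obtain w h where p: "p = (w, h)" "w \<in> shuffles x y" "h \<in> H" by auto
    have len: "length w = length h"
      using H(2)[OF p(3)] length_shuffles[OF p(2)] by simp
    have w: "filter P w = x" "filter (\<lambda>a. \<not> P a) w = y"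
      using p(2) iff1 by auto
    have ms: "mset (?h (zip w h)) = mset h"
      using mset_h[of "zip w h"] len by simp
    have fsts: "map fst (filter ?Q (zip w h)) = x" "map fst (filter ?Q' (zip w h)) = y"
      using fst_filter[of "zip w h"] w len by simp_all
    then have "length (filter ?Q (zip w h)) = length x"
      by (metis length_map)
    then have "filter ?Q (zip w h) = zip x (take (length x) (?h (zip w h)))"
      "filter ?Q' (zip w h) = zip y (drop (length x) (?h (zip w h)))"
      using zip_map_fst_snd[of "filter ?Q (zip w h)"] zip_map_fst_snd[of "filter ?Q' (zip w h)"] fsts by simp_all
    then have "zip w h \<in> ?Z (?h (zip w h))"
      unfolding iff2 by blast
    moreover have "?h (zip w h) \<in> H"
      using H(3)[OF ms[symmetric]] p by blast
    ultimately show "?j p \<in> Sigma H ?Z"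
      unfolding p(1) prod.case by (rule SigmaI[rotated])
    show "?i (?j p) = p"
      using p len by simp
    show "(case ?j p of (h, z) \<Rightarrow> f h z) = (case p of (w, h) \<Rightarrow> f h (zip w h))"
      using f[OF ms] p by simp
  next
    fix p assume "p \<in> Sigma H ?Z"
    then obtain h z where p: "p = (h, z)" "h \<in> H" "z \<in> ?Z h" by auto
    have z: "filter ?Q z = zip x (take (length x) h)" "filter ?Q' z = zip y (drop (length x) h)"
      using p(3) iff2 by blast+
    have hz: "?h z = h"
      unfolding z using H(2)[OF p(2)] by simp
    have "map fst z \<in> shuffles x y"
      unfolding iff1 fst_filter[symmetric] z using H(2)[OF p(2)] by simp
    moreover have "map snd z \<in> H"
      using H(3)[OF mset_h p(2)[folded hz]] .
    ultimately show "?i p \<in> shuffles x y \<times> H"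
      using p by simp
    show "?j (?i p) = p"
      using p hz by (simp add: zip_map_fst_snd)
  qed
  also have "\<dots> = (\<Sum>h\<in>H. \<Sum>z\<in>?Z h. f h z)"
    by (rule sum.Sigma[symmetric]) (use H in auto)
  finally show ?thesis .
qed

lemma pack_zip_shift: "pack (zip (map (\<lambda>a. a + m) v) h) = pack (zip v h)" for v :: "nat list" and h :: "nat list"
  by (metis pack_zip_pack_left pack_map_add)

lemma sharp_Nmult:
  assumes "packed u" "packed v"
  shows "sharp (Nmult u v) = Wmult (sharp (N u)) (sharp (N v) :: 'k::field_char_0 wspace)"
proof -
  let ?n = "length u + length v" and ?v = "map (\<lambda>a. a + wmax u) v" and ?p = "length u"
  let ?S = "Ssharp ?n :: 'k wspace"
  let ?c = "lookup ?S" and ?H = "keys ?S"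
  have len: "length h = ?n" if "h \<in> ?H" for h
    using that by (rule length_keys_Ssharp)
  have lenw: "length w = ?n" if "w \<in> shuffles u ?v" for w
    using length_shuffles[OF that] by simp
  have less: "a < b" if "a \<in> set u" "b \<in> set ?v" for a b
    using that assms by (auto simp: set_packed)
  have "sharp (Nmult u v) = (\<Sum>w\<in>shuffles u ?v. \<Sum>h\<in>?H. scale (?c h) (N (pack (zip w h))))"
    unfolding Nmult_def sharp_sum
  proof (intro sum.cong refl)
    fix w assume "w \<in> shuffles u ?v"
    then have w: "length w = ?n" by (rule lenw)
    show "sharp (N w) = (\<Sum>h\<in>?H. scale (?c h) (N (pack (zip w h))))"
      using w by (rule sharp_N_sum)
  qed
  also have "\<dots> = (\<Sum>h\<in>?H. \<Sum>z\<in>shuffles (zip u (take ?p h)) (zip ?v (drop ?p h)). scale (?c h) (N (pack z)))"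
  proof (rule sum_shuffles_zip[where P = "\<lambda>a. a \<le> wmax u" and f = "\<lambda>h z. scale (?c h) (N (pack z))"])
    fix h h' :: "nat list" assume "mset h = mset h'"
    then have c: "?c h = ?c h'" by (rule lookup_Ssharp_cong)
    show "scale (?c h) (N (pack z)) = scale (?c h') (N (pack z))" for z :: "(nat \<times> nat) list"
      unfolding c ..
    show "h' \<in> ?H" if "h \<in> ?H"
      using that unfolding in_keys_iff c .
  next
    show "a \<le> wmax u" if "a \<in> set u" for a
      using that assms(1) by (simp add: set_packed)
    show "\<not> b \<le> wmax u" if "b \<in> set ?v" for b
      using that assms(2) by (auto simp: set_packed)
  next
    show "length h = length u + length ?v" if "h \<in> ?H" for h
      using len[OF that] by simp
  qed (rule finite_keys)
  also have "\<dots> = (\<Sum>h\<in>?H. scale (?c h) (Wmult (Nstar u (take ?p h)) (Nstar v (drop ?p h))))"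
  proof (intro sum.cong refl)
    fix h assume "h \<in> ?H"
    then have h: "length h = ?n" by (rule len)
    \<comment> \<open>In the lexicographic order the upper letters already decide, so shuffling the
      biwords commutes with packing.\<close>
    have "p < q" if "p \<in> set (zip u (take ?p h))" "q \<in> set (zip ?v (drop ?p h))" for p q
    proof -
      have "fst p \<in> set u" "fst q \<in> set ?v"
        using that by (metis prod.collapse set_zip_leftD)+
      then have "fst p < fst q" by (rule less)
      then show ?thesis by (simp add: less_prod_def)
    qed
    then have "(\<Sum>z\<in>shuffles (zip u (take ?p h)) (zip ?v (drop ?p h)). N (pack z)) =
        (Nmult (pack (zip u (take ?p h))) (pack (zip ?v (drop ?p h))) :: 'k wspace)"
      by (rule sum_N_pack_shuffles)
    also have "\<dots> = Wmult (Nstar u (take ?p h)) (Nstar v (drop ?p h))"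
      unfolding pack_zip_shift using h by (simp add: Nstar_def Wmult_N)
    finally show "(\<Sum>z\<in>shuffles (zip u (take ?p h)) (zip ?v (drop ?p h)). scale (?c h) (N (pack z))) =
        scale (?c h) (Wmult (Nstar u (take ?p h)) (Nstar v (drop ?p h)))"
      by (simp only: pm.scale_sum_right[symmetric])
  qed
  also have "\<dots> = lin (\<lambda>h. Wmult (Nstar u (take ?p h)) (Nstar v (drop ?p h))) ?S"
    by (simp add: lin_def)
  also have "\<dots> = Wmult (sharp (N u)) (sharp (N v))"
    unfolding sharp_N
    by (rule lin_Ssharp_split[where B = Wmult])
      (simp_all only: Wmult_add_left Wmult_add_right Wmult_scale_left Wmult_scale_right)
  finally show ?thesis .
qed

lemma sharp_Wmult:
  assumes "F \<in> Wspace" "G \<in> Wspace"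
  shows "sharp (Wmult F G) = Wmult (sharp F) (sharp G)"
proof -
  have "sharp (Wmult F G) = lin (\<lambda>u. lin (\<lambda>v. sharp (Nmult u v)) G) F"
    by (simp add: Wmult_eq sharp_lin)
  also have "\<dots> = lin (\<lambda>u. lin (\<lambda>v. Wmult (sharp (N u)) (sharp (N v))) G) F"
    using assms by (intro lin_cong sharp_Nmult WspaceD)
  also have "\<dots> = Wmult (sharp F) (sharp G)"
    by (simp add: sharp_eq_lin[of F] sharp_eq_lin[of G] Wmult_lin_left Wmult_lin_right lin_swap[of _ G F])
  finally show ?thesis .
qed

text \<open>The single term of the product \<open>Wmult\<close> in which no letters are interleaved.\<close>

definition Wcat :: "'k::field wspace \<Rightarrow> 'k wspace \<Rightarrow> 'k wspace"
  where "Wcat F G = lin (\<lambda>u. lin (\<lambda>v. N (u @ map (\<lambda>a. a + wmax u) v)) G) F"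

text \<open>The upper letters decide the order, so packing the concatenated biword gives a shifted
  concatenation; splitting \<open>Ssharp\<close> at the same place separates the factors.
  \<open>Wcat\<close> receives packed words, so \<open>x\<close> and \<open>y\<close> may be pieces
  of a packed word.\<close>

lemma sharp_append:
  assumes less: "\<And>a b. a \<in> set x \<Longrightarrow> b \<in> set y \<Longrightarrow> a < b"
  shows "sharp (N (x @ y)) = Wcat (sharp (N x)) (sharp (N y) :: 'k::field_char_0 wspace)"
proof -
  let ?n = "length x + length y" and ?p = "length x"
  have "sharp (N (x @ y)) = lin (\<lambda>h. Wcat (Nstar x (take ?p h)) (Nstar y (drop ?p h))) (Ssharp ?n :: 'k wspace)"
    unfolding sharp_N star_N_left length_append
  proof (rule lin_cong)
    fix h assume "h \<in> keys (Ssharp ?n :: 'k wspace)"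
    then have h: "length h = ?n" using WnD[OF Ssharp_Wn] by blast
    have "zip (x @ y) h = zip x (take ?p h) @ zip y (drop ?p h)"
      by (rule zip_append1)
    moreover have "pack (zip x (take ?p h) @ zip y (drop ?p h)) = pack (zip x (take ?p h)) @
        map (\<lambda>a. a + wmax (pack (zip x (take ?p h)))) (pack (zip y (drop ?p h)))"
      by (rule pack_append) (use less in \<open>auto simp: less_pair_iff dest!: set_zip_leftD\<close>)
    ultimately show "Nstar (x @ y) h = Wcat (Nstar x (take ?p h)) (Nstar y (drop ?p h) :: 'k wspace)"
      using h by (simp add: Nstar_def Wcat_def del: wmax_pack)
  qed
  also have "\<dots> = Wcat (sharp (N x)) (sharp (N y))"
    unfolding sharp_N
    by (rule lin_Ssharp_split[where B = Wcat]) (simp_all add: Wcat_def lin_add lin_fun_add lin_scale lin_fun_scale)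
  finally show ?thesis .
qed

text \<open>Permuting \<open>u\<close> and \<open>h\<close> together permutes the packed biword, and
  permuting \<open>h\<close> keeps its coefficient in \<open>Ssharp\<close>, so the sum over
  \<open>h\<close> can be reindexed.\<close>

lemma sharp_permute:
  assumes p: "p permutes {..<length u}"
  shows "sharp (N (permute_list p u)) = lin (\<lambda>w. N (permute_list p w)) (sharp (N u))"
proof -
  let ?n = "length u"
  let ?S = "Ssharp ?n :: 'a wspace"
  let ?c = "lookup ?S" and ?H = "keys ?S"
  have len: "length h = ?n" if "h \<in> ?H" for h
    using that by (rule length_keys_Ssharp)
  let ?q = "inv_into UNIV p"
  have p': "?q permutes {..<?n}"
    using p by (rule permutes_inv)
  have c: "?c (permute_list q h) = ?c h" if "q permutes {..<?n}" "length h = ?n" for q h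
    using that by (intro lookup_Ssharp_cong) simp
  have inv1: "permute_list p (permute_list (?q) h) = h" "permute_list (?q) (permute_list p h) = h"
    if "length h = ?n" for h :: "nat list"
    using p p' that permute_list_compose[of p h "?q"] permute_list_compose[of "?q" h p]
    by (simp_all add: permutes_inv_o)
  have pack_permute: "pack (permute_list p z) = permute_list p (pack z)" if "length z = ?n" for z :: "(nat \<times> nat) list"
    using that p by (simp add: pack_eq_map_rank permute_list_map)
  have "sharp (N (permute_list p u)) = (\<Sum>h\<in>?H. scale (?c h) (N (pack (zip (permute_list p u) h))))"
    by (rule sharp_N_sum) simp
  also have "\<dots> = (\<Sum>h\<in>?H. scale (?c h) (N (permute_list p (pack (zip u h)))))"
  proof (rule sum.reindex_bij_witness[where j = "permute_list (?q)" and i = "permute_list p"])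
    fix h assume h: "h \<in> ?H"
    then show "permute_list p (permute_list (?q) h) = h" "permute_list (?q) (permute_list p h) = h"
      using inv1 len by blast+
    show "permute_list (?q) h \<in> ?H" "permute_list p h \<in> ?H"
      using h c[OF p len[OF h]] c[OF p' len[OF h]] by (simp_all add: in_keys_iff)
    have "permute_list p (pack (zip u (permute_list (?q) h))) = pack (permute_list p (zip u (permute_list (?q) h)))"
      by (rule pack_permute[symmetric]) (simp add: len[OF h])
    also have "\<dots> = pack (zip (permute_list p u) h)"
      using p len[OF h] by (subst permute_list_zip) (simp_all add: inv1)
    finally show "scale (?c (permute_list (?q) h)) (N (permute_list p (pack (zip u (permute_list (?q) h))))) =
        scale (?c h) (N (pack (zip (permute_list p u) h)))"
      using c[OF p' len[OF h]] by simp
  qed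
  also have "\<dots> = lin (\<lambda>w. N (permute_list p w)) (sharp (N u))"
    unfolding sharp_N star_N_left lin_lin
    unfolding lin_def[of _ "Ssharp _"] by (intro sum.cong refl) (simp add: Nstar_def len)
  finally show ?thesis .
qed

lemma sharp_has_single:
  assumes "has_single u"
  shows "sharp (N u) = (0 :: 'k::field_char_0 wspace)"
proof -
  obtain a where a: "count_list u a = 1"
    using assms by (auto simp: has_single_iff_count)
  \<comment> \<open>It suffices to separate the letters below \<open>a\<close>, the isolated
    \<open>a\<close> and the letters above it; the middle factor is an internal product with
    \<open>Ssharp 1 = 0\<close>.\<close>
  let ?lo = "filter (\<lambda>b. b < a) u" and ?hi = "filter (\<lambda>b. a < b) u"
  have "mset u = mset (?lo @ [a] @ ?hi)"
  proof (rule multiset_eqI)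
    fix b
    have "count (mset u) b = count_list u b" "count (mset (?lo @ [a] @ ?hi)) b =
        (if b < a then count_list u b else 0) + (if b = a then 1 else 0) + (if a < b then count_list u b else 0)"
      by (simp_all add: count_mset[symmetric])
    then show "count (mset u) b = count (mset (?lo @ [a] @ ?hi)) b"
      using a by (cases a b rule: linorder_cases) auto
  qed
  then obtain p where p: "p permutes {..<length (?lo @ [a] @ ?hi)}" "permute_list p (?lo @ [a] @ ?hi) = u"
    by (rule mset_eq_permutation)
  have "sharp (N [a]) = (0 :: 'k wspace)"
    by (simp add: sharp_N Ssharp_1[simplified])
  then have "sharp (N ([a] @ ?hi)) = (0 :: 'k wspace)"
    by (subst sharp_append) (auto simp: Wcat_def)
  then have "sharp (N (?lo @ [a] @ ?hi)) = (0 :: 'k wspace)"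
    by (subst sharp_append) (auto simp: Wcat_def)
  then show ?thesis
    using sharp_permute[OF p(1), where 'a = 'k] p(2) by simp
qed

section \<open>Kernel, idempotence and internal multiplicativity of \<open>sharp\<close>\<close>

lemma sharp_Jspan: "F \<in> Jspan \<Longrightarrow> sharp F = 0"
  using lin_cong[of F "\<lambda>u. sharp (N u)" "\<lambda>u. 0"] JspanD[of F] by (simp add: sharp_eq_lin[of F] sharp_has_single)

lemma sharp_diff_Jspan:
  fixes F :: "'k::field_char_0 wspace"
  assumes "F \<in> Wspace"
  shows "sharp F - F \<in> Jspan"
proof -
  have "lin (\<lambda>u. sharp (N u)) F - lin N F \<in> Jspan"
  proof (rule lin_diff_mem[OF subspace_Jspan])
    fix u assume "u \<in> keys F"
    then have "(N u :: 'k wspace) \<in> Wn (length u)"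
      using WspaceD[OF assms] by simp
    then have "star (N u) (Ssharp (length u) - N (replicate (length u) 1)) = (sharp (N u) - N u :: 'k wspace)"
      by (simp only: star_diff_right star_one_right sharp_N)
    then show "sharp (N u) - N u \<in> (Jspan :: 'k wspace set)"
      using star_Jspan[OF disjI2[OF Ssharp_diff_Jspan[of "length u", where 'k = 'k]], of "N u"] by simp
  qed
  then show ?thesis by (simp add: lin_N flip: sharp_eq_lin)
qed

lemma sharp_sharp: "F \<in> Wspace \<Longrightarrow> sharp (sharp F) = sharp F"
  using sharp_Jspan[OF sharp_diff_Jspan, of F] by (simp add: sharp_diff)

lemma sharp_eq_iff:
  assumes "F \<in> Wspace" "G \<in> Wspace"
  shows "sharp F = sharp G \<longleftrightarrow> F - G \<in> Jspan"
proof
  assume "sharp F = sharp G"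
  then show "F - G \<in> Jspan"
    using sharp_diff_Jspan[of "F - G"] assms pm.subspace_neg[OF subspace_Jspan] by (fastforce simp: sharp_diff)
next
  assume "F - G \<in> Jspan"
  then show "sharp F = sharp G"
    using sharp_Jspan[of "F - G"] by (simp add: sharp_diff)
qed

lemma sharp_one: "sharp (N []) = N []"
  by (simp add: sharp_N Nstar_def)

text \<open>The empty word has no isolated letter, so it does not occur in
  \<open>sharp F - F\<close>.\<close>

lemma sharp_counit:
  assumes "F \<in> Wspace"
  shows "lookup (sharp F) [] = lookup F []"
proof -
  have "[] \<notin> keys (sharp F - F)"
    using JspanD[OF sharp_diff_Jspan[OF assms], of "[]"] by (auto simp: has_single_def)
  then show ?thesis by (simp add: in_keys_iff lookup_minus)
qed

lemma sharp_Wn [simp]: "F \<in> Wn n \<Longrightarrow> sharp F \<in> Wn n"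
  by (simp add: sharp_eq_star)

text \<open>\<open>Ssharp n\<close> differs from the unit by an element of the ideal, which internal
  multiplication by \<open>Ssharp n\<close> on the right kills; so \<open>Ssharp n\<close> is a left
  unit on the image.\<close>

lemma sharp_star_sharp: "F \<in> Wn n \<Longrightarrow> star (Ssharp n) (sharp F) = sharp F"
proof -
  assume F: "F \<in> Wn n"
  have "star (Ssharp n) F - F = star (Ssharp n - N (replicate n 1)) F"
    using star_one_left[OF F] star_add_left[of "Ssharp n - N (replicate n 1)" "N (replicate n 1)" F] by simp
  also have "\<dots> \<in> Jspan"
    by (intro star_Jspan disjI1 Ssharp_diff_Jspan)
  finally have "sharp (star (Ssharp n) F) = sharp F"
    using F by (simp add: sharp_eq_iff Wn_Wspace)
  then show ?thesis
    using F sharp_eq_star[of "star (Ssharp n) F" n] by (simp add: sharp_eq_star[of F n] star_assoc)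
qed

text \<open>With S for \<open>Ssharp n\<close>, the internal product (F S)(G S) loses its inner S,
  because S is a left unit on the image.\<close>

lemma sharp_star:
  assumes "F \<in> Wn n" "G \<in> Wn n"
  shows "sharp (star F G) = star (sharp F) (sharp G)"
  using assms sharp_star_sharp[of G n] sharp_eq_star[of "star F G" n]
  by (simp add: sharp_eq_star[of _ n] star_assoc)

section \<open>Compatibility of \<open>sharp\<close> with the coproduct\<close>

lemma sharp_comult_N:
  "tensor_eq W (Wcomult (sharp (N u))) (tensor_map sharp (deconc u :: 'k::field_char_0 wspace list \<Rightarrow>\<^sub>0 'k))"
proof -
  let ?n = "length u" and ?S = "Ssharp :: nat \<Rightarrow> 'k wspace"
  let ?l = "\<lambda>i. N (pack (take i u)) :: 'k wspace" and ?r = "\<lambda>i. N (pack (drop i u)) :: 'k wspace"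
  let ?s = "\<lambda>F G. single [F, G] (1 :: 'k)"
  \<comment> \<open>The internal product, leg by leg, of the coproduct of \<open>u\<close> with a
    pure tensor. Summing over all cuts of \<open>u\<close> makes it independent of how the second
    factor was cut; \<open>diag\<close> leaves the cut of matching length.\<close>
  let ?B = "\<lambda>F G. \<Sum>i\<le>?n. ?s (star (?l i) F) (star (?r i) G)"
  have s0: "tensor_eq W (?s 0 F) 0" "tensor_eq W (?s F 0) 0" if "F \<in> Wspace" for F :: "'k wspace"
    using tensor_eq_W_sum1[of "{}" id F] tensor_eq_W_sum2[of "{}" id F] that by simp_all
  have diag: "tensor_eq W (?B F G) (?s (star (?l m) F) (star (?r m) G))"
    if "F \<in> Wn m" "m \<le> ?n" for F G :: "'k wspace" and m
  proof -
    have "tensor_eq W (?B F G) (\<Sum>i\<le>?n. if i = m then ?s (star (?l m) F) (star (?r m) G) else 0)"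
    proof (rule tensor_eq_sum)
      fix i assume "i \<in> {..?n}"
      then show "tensor_eq W (?s (star (?l i) F) (star (?r i) G))
          (if i = m then ?s (star (?l m) F) (star (?r m) G) else 0)"
        using star_Wn_length[OF that(1), of "pack (take i u)"] s0 by simp
    qed
    then show ?thesis using that(2) by simp
  qed
  have "Wcomult (sharp (N u)) = lin (\<lambda>h. Wcomult (Nstar u h)) (?S ?n)"
    by (simp add: sharp_N star_N_left Wcomult_eq lin_lin)
  also have "tensor_eq W \<dots> (lin (\<lambda>h. \<Sum>j\<le>length h. ?B (N (pack (take j h))) (N (pack (drop j h)))) (?S ?n))"
  proof (rule tensor_eq_lin)
    fix h assume "h \<in> keys (?S ?n)"
    then have h: "length h = ?n" using WnD[OF Ssharp_Wn] by blast
    have "Wcomult (Nstar u h) = (\<Sum>j\<le>?n. ?s (star (?l j) (N (pack (take j h)))) (star (?r j) (N (pack (drop j h)))))"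
      by (simp add: h Nstar_def Wcomult_eq deconc_def take_zip drop_zip
          pack_zip_pack_left pack_zip_pack_right)
    also have "tensor_eq W \<dots> (\<Sum>j\<le>?n. ?B (N (pack (take j h))) (N (pack (drop j h))))"
      by (intro tensor_eq_sum diag[THEN tensor_eq_sym]) (simp_all add: h)
    finally show "tensor_eq W (Wcomult (Nstar u h))
        (\<Sum>j\<le>length h. ?B (N (pack (take j h))) (N (pack (drop j h))))"
      by (simp only: h)
  qed
  also have "\<dots> = lin (\<lambda>xs. ?B (xs ! 0) (xs ! 1)) (Wcomult (?S ?n))"
    unfolding Wcomult_eq lin_lin lin_deconc by simp
  also have "tensor_eq W \<dots> (lin (\<lambda>xs. ?B (xs ! 0) (xs ! 1)) (\<Sum>m\<le>?n. ?s (?S m) (?S (?n - m))))"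
  proof (rule lin_tensor_eq2_tensor[where g = ?B and A = W])
    show "tensor_eq W (Wcomult (?S ?n)) (\<Sum>m\<le>?n. ?s (?S m) (?S (?n - m)))"
      using group_like_Ssharp by (auto simp: group_like_def)
    show "(\<Sum>m\<le>?n. ?s (?S m) (?S (?n - m))) \<in> tensors 2 W"
      by (intro pm.subspace_sum[OF subspace_tensors] tensors_W_single Ssharp_Wspace)
  next
    fix F G H :: "'k wspace" and c :: 'k
    show "tensor_eq W (?B (F \<oplus>\<^bsub>W\<^esub> G) H) (?B F H + ?B G H)"
      unfolding sum.distrib[symmetric] W_simps star_add_right
      by (intro tensor_eq_sum tensor_single_add1[where A = W, simplified]) simp_all
    show "tensor_eq W (?B H (F \<oplus>\<^bsub>W\<^esub> G)) (?B H F + ?B H G)"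
      unfolding sum.distrib[symmetric] W_simps star_add_right
      by (intro tensor_eq_sum tensor_single_add2[where A = W, simplified]) simp_all
    show "tensor_eq W (?B (c \<odot>\<^bsub>W\<^esub> F) H) (scale c (?B F H))"
      unfolding pm.scale_sum_right W_simps star_scale_right scale_single mult_1_right
      by (intro tensor_eq_sum tensor_eq_W_scale1) simp_all
    show "tensor_eq W (?B H (c \<odot>\<^bsub>W\<^esub> F)) (scale c (?B H F))"
      unfolding pm.scale_sum_right W_simps star_scale_right scale_single mult_1_right
      by (intro tensor_eq_sum tensor_eq_W_scale2) simp_all
  qed simp_all
  also have "\<dots> = (\<Sum>m\<le>?n. ?B (?S m) (?S (?n - m)))"
    by (simp add: lin_sum)
  also have "tensor_eq W \<dots> (\<Sum>m\<le>?n. ?s (star (?l m) (?S m)) (star (?r m) (?S (?n - m))))"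
    by (intro tensor_eq_sum diag) simp_all
  also have "\<dots> = tensor_map sharp (deconc u)"
    by (simp add: tensor_map_def lin_deconc sharp_N min_absorb2)
  finally show ?thesis .
qed

lemma sharp_comult: "tensor_eq W (Wcomult (sharp F)) (tensor_map sharp (Wcomult F))"
proof -
  have "Wcomult (sharp F) = lin (\<lambda>u. Wcomult (sharp (N u))) F"
    by (simp add: sharp_eq_lin[of F] Wcomult_eq lin_lin)
  also have "tensor_eq W \<dots> (lin (\<lambda>u. tensor_map sharp (deconc u)) F)"
    by (intro tensor_eq_lin sharp_comult_N)
  also have "\<dots> = tensor_map sharp (Wcomult F)"
    by (simp add: Wcomult_eq tensor_map_def lin_lin)
  finally show ?thesis .
qed

section \<open>Images and kernels of projections\<close>

text \<open>The image of the idempotent \<open>e\<close> meets each fibre of \<open>f\<close>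
  exactly once. Since \<open>one C = e (one A)\<close>, the unit of \<open>C\<close> may differ from
  that of \<open>A\<close>, as for the internal product.\<close>

lemma k_algebra_iso_image:
  assumes e: "lin_map A C e" "e ` carrier A = carrier C" and sub: "carrier C \<subseteq> carrier A"
    and C: "monoid.mult C = monoid.mult A" "add C = add A" "smult C = smult A" "one C = e (one A)"
    and f: "lin_map A B f" "f ` carrier A = carrier B"
    and mult: "\<And>x y. \<lbrakk>x \<in> carrier A; y \<in> carrier A\<rbrakk> \<Longrightarrow> f (x \<otimes>\<^bsub>A\<^esub> y) = f x \<otimes>\<^bsub>B\<^esub> f y"
    and one: "f \<one>\<^bsub>A\<^esub> = \<one>\<^bsub>B\<^esub>" "\<one>\<^bsub>A\<^esub> \<in> carrier A"
    and idem: "\<And>x. x \<in> carrier A \<Longrightarrow> e (e x) = e x"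
    and ker: "\<And>x y. \<lbrakk>x \<in> carrier A; y \<in> carrier A\<rbrakk> \<Longrightarrow> f x = f y \<longleftrightarrow> e x = e y"
  shows "f \<in> k_algebra_iso C B"
proof -
  have e_closed: "e x \<in> carrier A" if "x \<in> carrier A" for x
    using that e(2) sub by auto
  have fe: "f (e x) = f x" if "x \<in> carrier A" for x
    using that ker[of "e x" x] idem e_closed by simp
  have e_id: "e x = x" if "x \<in> carrier C" for x
    using that idem unfolding e(2)[symmetric] by auto
  have "inj_on f (carrier C)"
    by (rule inj_onI) (metis e_id ker sub subsetD)
  moreover have "f ` carrier C = carrier B"
    unfolding e(2)[symmetric] f(2)[symmetric] image_image by (intro image_cong refl fe)
  moreover have "f \<in> ring_hom C B"
    using sub lin_mapD[OF f(1)] mult one fe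
    by (intro ring_hom_memI) (auto simp: C subset_iff)
  ultimately show ?thesis
    using sub lin_mapD[OF f(1)] by (auto simp: k_algebra_iso_def ring_iso_def bij_betw_def C)
qed

text \<open>Serves both \<open>quot_bialgebra\<close> and \<open>quot_algebra\<close>; these have
  different record types, so \<open>B\<close> is described by its fields.\<close>

lemma quotient_map:
  fixes A :: "('k::field, 'b \<Rightarrow>\<^sub>0 'k, 'm) module_scheme" and B :: "('k, ('b \<Rightarrow>\<^sub>0 'k) set, 'n) module_scheme"
  assumes I: "ideal I A" and A: "add A = (+)" "smult A = scale" and sub: "pm.subspace I"
    and scale: "\<And>c x. x \<in> carrier A \<Longrightarrow> scale c x \<in> carrier A"
    and B: "carrier B = carrier (A Quot I)" "monoid.mult B = monoid.mult (A Quot I)"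
      "one B = one (A Quot I)" "ring.zero B = ring.zero (A Quot I)" "add B = add (A Quot I)" "smult B = quot_smult A I"
  defines "q \<equiv> \<lambda>x. I +>\<^bsub>A\<^esub> x"
  shows quotient_map_mem: "y \<in> q x \<longleftrightarrow> y - x \<in> I"
    and quotient_map_eq: "q x = q y \<longleftrightarrow> x - y \<in> I"
    and quotient_map_lin: "lin_map A B q"
    and quotient_map_surj: "q ` carrier A = carrier B"
    and quotient_map_mult: "\<lbrakk>x \<in> carrier A; y \<in> carrier A\<rbrakk> \<Longrightarrow> q (x \<otimes>\<^bsub>A\<^esub> y) = q x \<otimes>\<^bsub>B\<^esub> q y"
    and quotient_map_one: "q \<one>\<^bsub>A\<^esub> = \<one>\<^bsub>B\<^esub>"
    and quotient_map_zero: "q \<zero>\<^bsub>A\<^esub> = \<zero>\<^bsub>B\<^esub>"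
proof -
  interpret I: ideal I A by fact
  have mem: "y \<in> q x \<longleftrightarrow> y - x \<in> I" for x y
  proof -
    have "y \<in> q x \<longleftrightarrow> (\<exists>i\<in>I. y = i + x)"
      by (auto simp: q_def a_r_coset_def' A)
    also have "\<dots> \<longleftrightarrow> y - x \<in> I"
      by (auto intro: bexI[of _ "y - x"])
    finally show ?thesis .
  qed
  then show "y \<in> q x \<longleftrightarrow> y - x \<in> I" .
  have eq: "q x = q y \<longleftrightarrow> x - y \<in> I" for x y
  proof
    assume "q x = q y"
    then show "x - y \<in> I"
      using mem[of x x] mem[of x y] pm.subspace_0[OF sub] by simp
  next
    assume xy: "x - y \<in> I"
    have "z - x \<in> I \<longleftrightarrow> z - y \<in> I" for z
      using pm.subspace_add[OF sub, of "z - x" "x - y"] pm.subspace_diff[OF sub, of "z - y" "x - y"] xy by auto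
    then show "q x = q y"
      by (auto simp: mem)
  qed
  then show "q x = q y \<longleftrightarrow> x - y \<in> I" .
  \<comment> \<open>\<open>quot_smult\<close> is a union over all representatives; each of them
    gives the same coset, so the union collapses.\<close>
  have smult: "q (scale c x) = quot_smult A I c (q x)" for c x
  proof -
    have "q (scale c y) = q (scale c x)" if "y \<in> q x" for y
      using that pm.subspace_scale[OF sub, of "y - x" c] by (simp add: mem eq pm.scale_right_diff_distrib)
    moreover have "x \<in> q x"
      using pm.subspace_0[OF sub] by (simp add: mem)
    ultimately show ?thesis
      unfolding quot_smult_def A q_def[symmetric] by blast
  qed
  show surj: "q ` carrier A = carrier B"
    by (auto simp: B FactRing_simps q_def)
  show "lin_map A B q"
    unfolding lin_map_def
  proof (intro conjI ballI allI)
    show "q ` carrier A \<subseteq> carrier B" using surj by simp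
    show "q (x \<oplus>\<^bsub>A\<^esub> y) = q x \<oplus>\<^bsub>B\<^esub> q y" if "x \<in> carrier A" "y \<in> carrier A" for x y
      using I.a_rcos_sum[OF that] by (simp add: B FactRing_def q_def)
    show "q (c \<odot>\<^bsub>A\<^esub> x) = c \<odot>\<^bsub>B\<^esub> q x" for c x
      by (simp add: B A smult)
  qed
  show "q (x \<otimes>\<^bsub>A\<^esub> y) = q x \<otimes>\<^bsub>B\<^esub> q y" if "x \<in> carrier A" "y \<in> carrier A"
    using I.rcoset_mult_add[OF that] by (simp add: B FactRing_def q_def)
  show "q \<one>\<^bsub>A\<^esub> = \<one>\<^bsub>B\<^esub>"
    by (simp add: B FactRing_def q_def)
  show "q \<zero>\<^bsub>A\<^esub> = \<zero>\<^bsub>B\<^esub>"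
    using I.a_rcos_const[of "\<zero>\<^bsub>A\<^esub>"] I.zero_closed by (simp add: B FactRing_def q_def)
qed


section \<open>The Hopf algebras \<open>W\<^sup>\<sharp>\<close> and \<open>W / J\<close>\<close>

lemma sharp_0: "sharp 0 = 0"
  by (simp add: sharp_def)

lemma lin_map_sharp: "lin_map W W sharp"
  by (auto simp: lin_map_def sharp_add sharp_scale)

lemma Wsharp_subset: "Wsharp \<subseteq> Wspace"
  by (auto simp: Wsharp_def)

lemma sharp_Wsharp: "F \<in> Wsharp \<Longrightarrow> sharp F = F"
  by (auto simp: Wsharp_def sharp_sharp)

lemma sharp_in_Wsharp: "F \<in> Wspace \<Longrightarrow> sharp F \<in> Wsharp"
  by (simp add: Wsharp_def)

lemma W_minus: "F \<in> Wspace \<Longrightarrow> \<ominus>\<^bsub>W\<^esub> F = - (F :: 'k::field wspace)"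
proof -
  interpret W: k_algebra "W :: ('k, 'k wspace) bialg" by (rule k_algebra_W)
  show "F \<in> Wspace \<Longrightarrow> \<ominus>\<^bsub>W\<^esub> F = - F"
    by (rule W.minus_equality) auto
qed

lemma sub_bialgebra_Wsharp: "sub_bialgebra (Wsharp :: 'k::field_char_0 wspace set) W"
proof -
  interpret W: k_algebra "W :: ('k, 'k wspace) bialg" by (rule k_algebra_W)
  have in_W: "F \<in> Wspace" if "F \<in> Wsharp" for F :: "'k wspace"
    using that Wsharp_subset by blast
  \<comment> \<open>The image of an idempotent is its set of fixed points, which reduces closure to
    the homomorphism laws of \<open>sharp\<close>.\<close>
  have closed: "F \<in> Wsharp" if "F \<in> Wspace" "sharp F = F" for F :: "'k wspace"
    using sharp_in_Wsharp[OF that(1)] that(2) by simp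
  have minus: "\<ominus>\<^bsub>W\<^esub> F \<in> Wsharp" if "F \<in> Wsharp" for F :: "'k wspace"
    using in_W[OF that] sharp_Wsharp[OF that] sharp_scale[of "-1" F] by (intro closed) (simp_all add: W_minus)
  have zero: "(0 :: 'k wspace) \<in> Wsharp"
    by (rule closed) (simp_all add: sharp_def)
  have one: "(N [] :: 'k wspace) \<in> Wsharp"
    by (rule closed) (simp_all add: sharp_one)
  have add: "F + G \<in> Wsharp" if "F \<in> Wsharp" "G \<in> Wsharp" for F G :: "'k wspace"
    using that[THEN in_W] that[THEN sharp_Wsharp] by (intro closed) (simp_all add: sharp_add)
  have mult: "Wmult F G \<in> Wsharp" if "F \<in> Wsharp" "G \<in> Wsharp" for F G :: "'k wspace"
    using that[THEN in_W] that[THEN sharp_Wsharp] by (intro closed) (simp_all add: sharp_Wmult)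
  have smult: "scale c F \<in> Wsharp" if "F \<in> Wsharp" for c and F :: "'k wspace"
    using that[THEN in_W] that[THEN sharp_Wsharp] by (intro closed) (simp_all add: sharp_scale)
  have "subring (Wsharp :: 'k wspace set) W"
    using Wsharp_subset minus one add mult by (intro W.subringI) simp_all
  moreover have "submodule (Wsharp :: 'k wspace set) scalars W"
    using Wsharp_subset minus zero add smult by (intro W.submoduleI) simp_all
  moreover have "\<exists>t \<in> tensors 2 (W\<lparr>carrier := Wsharp\<rparr>). tensor_eq W t (comult W F)"
    if "F \<in> Wsharp" for F :: "'k wspace"
  proof (intro bexI)
    \<comment> \<open>\<open>F\<close> is fixed by \<open>sharp\<close>, so applying
      \<open>sharp\<close> to both legs represents the same coproduct with legs in
      \<open>Wsharp\<close>.\<close>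
    show "tensor_eq W (tensor_map sharp (Wcomult F)) (comult W F)"
      using sharp_comult[of F, THEN tensor_eq_sym] that by (simp add: sharp_Wsharp)
    show "tensor_map sharp (Wcomult F) \<in> tensors 2 (W\<lparr>carrier := Wsharp\<rparr>)"
      by (rule tensor_map_tensors[of _ 2 W]) (auto intro: sharp_in_Wsharp)
  qed
  ultimately show ?thesis
    unfolding sub_bialgebra_def by blast
qed

section \<open>The restricted structure on the image of \<open>sharp\<close>\<close>

lemma restrict_simps [simp]:
  "carrier (bialg_restrict A C) = C" "monoid.mult (bialg_restrict A C) = monoid.mult A"
  "one (bialg_restrict A C) = one A" "ring.zero (bialg_restrict A C) = ring.zero A"
  "add (bialg_restrict A C) = add A" "smult (bialg_restrict A C) = smult A"
  "counit (bialg_restrict A C) = counit A"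
  by (simp_all add: bialg_restrict_def)

abbreviation W_sharp :: "('k::field_char_0, 'k wspace) bialg"
  where "W_sharp \<equiv> bialg_restrict W Wsharp"

lemma comult_W_sharp:
  fixes F :: "'k::field_char_0 wspace"
  assumes "F \<in> Wsharp"
  shows "comult W_sharp F \<in> tensors 2 W_sharp" "tensor_eq W (comult W_sharp F) (Wcomult F)"
proof -
  let ?P = "\<lambda>t. t \<in> tensors 2 (W\<lparr>carrier := Wsharp\<rparr>) \<and> tensor_eq W t (comult W F)"
  have "\<exists>t. ?P t"
    using sub_bialgebra_Wsharp assms unfolding sub_bialgebra_def by blast
  then have "?P (SOME t. ?P t)" by (rule someI_ex)
  moreover have "comult W_sharp F = (SOME t. ?P t)"
    unfolding bialg_restrict_def by simp
  moreover have "tensors 2 (W\<lparr>carrier := Wsharp\<rparr>) = tensors 2 (W_sharp :: ('k, 'k wspace) bialg)"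
    unfolding tensors_def by simp
  ultimately show "comult W_sharp F \<in> tensors 2 W_sharp" "tensor_eq W (comult W_sharp F) (Wcomult F)"
    unfolding W_simps by metis+
qed

lemma lin_map_W_sharp: "lin_map W W_sharp sharp" "sharp ` carrier W = carrier W_sharp"
  by (auto simp: lin_map_def sharp_add sharp_scale Wsharp_def)

text \<open>Equalities over \<open>W\<close> become equalities over \<open>W_sharp\<close> once
  \<open>sharp\<close> is applied to both sides, and this changes nothing on tensors whose legs
  already lie in \<open>Wsharp\<close>.\<close>

lemma comult_W_sharp_sharp:
  assumes "F \<in> Wspace"
  shows "tensor_eq W_sharp (comult W_sharp (sharp F)) (tensor_map sharp (Wcomult F))"
proof -
  have S: "sharp F \<in> Wsharp" using assms by (rule sharp_in_Wsharp)
  have "comult W_sharp (sharp F) = tensor_map sharp (comult W_sharp (sharp F))"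
    using comult_W_sharp(1)[OF S] by (rule tensor_map_id[symmetric]) (simp add: sharp_Wsharp)
  also have "tensor_eq W_sharp \<dots> (tensor_map sharp (Wcomult (sharp F)))"
    using comult_W_sharp(2)[OF S] by (rule tensor_map_eq[OF lin_map_W_sharp(1)])
  also have "tensor_eq W_sharp \<dots> (tensor_map sharp (tensor_map sharp (Wcomult F)))"
    using sharp_comult by (rule tensor_map_eq[OF lin_map_W_sharp(1)])
  also have "\<dots> = tensor_map sharp (Wcomult F)"
    unfolding tensor_map_map by (rule tensor_map_cong[of _ 2 W]) (simp_all add: sharp_sharp)
  finally show ?thesis .
qed

lemma hopf_algebra_W_sharp: "hopf_algebra (W_sharp :: ('k::field_char_0, 'k wspace) bialg)"
proof (rule hopf_algebra_image[OF hopf_algebra_W lin_map_W_sharp _ _ _ lin_map_sharp])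
  fix F :: "'k wspace"
  show "tensor_eq W_sharp (comult W_sharp (sharp F)) (tensor_map sharp (comult W F))" if "F \<in> carrier W"
    using comult_W_sharp_sharp[of F] that by simp
  show "comult W_sharp F \<in> tensors 2 W_sharp" if "F \<in> carrier W_sharp"
    using comult_W_sharp(1) that by simp
qed (simp_all add: sharp_Wmult sharp_one sharp_comult sharp_counit sharp_sharp sharp_0)

lemma bi_ideal_J: "bi_ideal (J :: 'k::field_char_0 wspace set) W"
proof -
  interpret W: k_algebra "W :: ('k, 'k wspace) bialg" by (rule k_algebra_W)
  have J: "F \<in> Wspace" if "F \<in> Jspan" for F :: "'k wspace"
    using that by (simp add: Jspan_def)
  have "submodule (Jspan :: 'k wspace set) scalars W"
    using J by (intro W.submoduleI)
      (auto simp: W_minus pm.subspace_0 pm.subspace_neg pm.subspace_add pm.subspace_scale subspace_Jspan)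
  moreover have "lookup F [] = 0" if "F \<in> Jspan" for F :: "'k wspace"
    using JspanD[OF that, of "[]"] by (auto simp: has_single_def in_keys_iff)
  moreover have "\<exists>t \<in> tensors 2 W. tensor_eq W t (Wcomult F) \<and>
      (\<forall>xs\<in>keys t. xs ! 0 \<in> Jspan \<or> xs ! 1 \<in> Jspan)" if F: "F \<in> Jspan" for F :: "'k wspace"
  \<comment> \<open>The coproduct itself is a suitable representative: every cut leaves an isolated
    letter on one side.\<close>
  proof (intro bexI[of _ "Wcomult F"] conjI ballI)
    fix xs assume "xs \<in> keys (Wcomult F)"
    then obtain u where u: "u \<in> keys F" "xs \<in> keys (deconc u :: 'k wspace list \<Rightarrow>\<^sub>0 'k)"
      using keys_lin[of deconc F] by (auto simp: Wcomult_eq)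
    have "\<exists>i\<le>length u. xs = [N (pack (take i u)), N (pack (drop i u))]"
    proof (rule ccontr)
      assume "\<not> ?thesis"
      then have "lookup (deconc u) xs = (0 :: 'k)"
        by (auto simp: deconc_def lookup_sum lookup_single when_def intro!: sum.neutral)
      with u(2) show False by (simp add: in_keys_iff)
    qed
    then obtain i where "i \<le> length u" and xs: "xs = [N (pack (take i u)), N (pack (drop i u))]" by blast
    moreover have "has_single u" using JspanD[OF F u(1)] by simp
    ultimately have "has_single (take i u) \<or> has_single (drop i u)"
      by (intro has_single_take_drop)
    then show "xs ! 0 \<in> Jspan \<or> xs ! 1 \<in> Jspan"
      by (auto simp: xs N_in_Jspan has_single_pack)
  qed simp_all
  ultimately show ?thesis
    using ideal_Jspan by (simp add: bi_ideal_def J_eq_Jspan)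
qed

section \<open>The quotient by \<open>J\<close>\<close>

abbreviation W_mod_J :: "('k::field_char_0, 'k wspace set) bialg"
  where "W_mod_J \<equiv> quot_bialgebra W J"

abbreviation J_coset :: "'k::field_char_0 wspace \<Rightarrow> 'k wspace set"
  where "J_coset \<equiv> (\<lambda>F. J +>\<^bsub>W\<^esub> F)"

lemma
  fixes F G :: "'k::field_char_0 wspace"
  shows J_coset_mem: "G \<in> J_coset F \<longleftrightarrow> G - F \<in> Jspan"
    and J_coset_eq: "J_coset F = J_coset G \<longleftrightarrow> F - G \<in> Jspan"
    and J_coset_lin: "lin_map W (W_mod_J :: ('k, 'k wspace set) bialg) J_coset"
    and J_coset_surj: "J_coset ` carrier W = carrier (W_mod_J :: ('k, 'k wspace set) bialg)"
    and J_coset_mult: "\<lbrakk>F \<in> Wspace; G \<in> Wspace\<rbrakk> \<Longrightarrow> J_coset (Wmult F G) = J_coset F \<otimes>\<^bsub>W_mod_J\<^esub> J_coset G"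
    and J_coset_one: "J_coset (N [] :: 'k wspace) = \<one>\<^bsub>W_mod_J\<^esub>"
    and J_coset_zero: "J_coset (0 :: 'k wspace) = \<zero>\<^bsub>W_mod_J\<^esub>"
  using quotient_map[of "Jspan :: 'k wspace set" W "W_mod_J :: ('k, 'k wspace set) bialg", OF ideal_Jspan _ _ subspace_Jspan]
  by (simp_all add: quot_bialgebra_def J_eq_Jspan)

lemma J_coset_eq_iff_sharp: "\<lbrakk>F \<in> Wspace; G \<in> Wspace\<rbrakk> \<Longrightarrow> J_coset F = J_coset G \<longleftrightarrow> sharp F = sharp G"
  by (simp add: J_coset_eq sharp_eq_iff)

text \<open>The quotient structure is computed at a chosen representative \<open>G\<close> of the
  coset of \<open>F\<close>. The choice is harmless because \<open>sharp G = sharp F\<close>, which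
  determines the counit and the projected coproduct.\<close>

lemma W_mod_J_comult_counit:
  fixes F :: "'k::field_char_0 wspace"
  assumes F: "F \<in> Wspace"
  shows "tensor_eq W_mod_J (comult W_mod_J (J_coset F)) (tensor_map J_coset (Wcomult F))"
    and "comult W_mod_J (J_coset F) \<in> tensors 2 W_mod_J"
    and "counit W_mod_J (J_coset F) = lookup F []"
proof -
  define G where "G = (SOME G. G \<in> J_coset F)"
  have "F \<in> J_coset F"
    by (simp add: J_coset_mem pm.subspace_0[OF subspace_Jspan])
  then have "G \<in> J_coset F"
    unfolding G_def by (rule someI)
  then have GF: "G - F \<in> Jspan" by (simp add: J_coset_mem)
  then have "G - F \<in> Wspace" by (simp add: Jspan_def)
  then have G: "G \<in> Wspace"
    using Wspace_simps(2)[of "G - F" F] F by simp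
  have sharp_eq: "sharp G = sharp F"
    using GF by (simp add: sharp_eq_iff F G)
  have comult: "comult W_mod_J (J_coset F) = tensor_map J_coset (Wcomult G)"
    and counit: "counit W_mod_J (J_coset F) = lookup G []"
    by (simp_all add: quot_bialgebra_def G_def)
  have "lookup G [] = lookup F []"
    using sharp_counit[OF F] sharp_counit[OF G] sharp_eq by simp
  then show "counit W_mod_J (J_coset F) = lookup F []"
    unfolding counit .
  show "comult W_mod_J (J_coset F) \<in> tensors 2 W_mod_J"
    unfolding comult using J_coset_surj by (intro tensor_map_tensors[OF Wcomult_tensors]) auto
  \<comment> \<open>The projection factors through \<open>sharp\<close>, which moves past the
    coproduct; so the projected coproduct of \<open>H\<close> depends only on
    \<open>sharp H\<close>.\<close>
  have *: "tensor_eq W_mod_J (tensor_map J_coset (Wcomult H)) (tensor_map J_coset (Wcomult (sharp H)))"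
    if "H \<in> Wspace" for H
  proof -
    have "tensor_map J_coset (Wcomult H) = tensor_map (J_coset \<circ> sharp) (Wcomult H)"
      by (rule tensor_map_cong[of _ 2 W]) (simp_all add: J_coset_eq_iff_sharp sharp_sharp)
    also have "\<dots> = tensor_map J_coset (tensor_map sharp (Wcomult H))"
      by (simp add: tensor_map_map)
    also have "tensor_eq W_mod_J \<dots> (tensor_map J_coset (Wcomult (sharp H)))"
      by (rule tensor_map_eq[OF J_coset_lin tensor_eq_sym[OF sharp_comult]])
    finally show ?thesis .
  qed
  have "tensor_eq W_mod_J (tensor_map J_coset (Wcomult G)) (tensor_map J_coset (Wcomult F))"
    using *[OF G] *[OF F, THEN tensor_eq_sym] unfolding sharp_eq by (rule tensor_eq_trans)
  then show "tensor_eq W_mod_J (comult W_mod_J (J_coset F)) (tensor_map J_coset (Wcomult F))"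
    unfolding comult .
qed

text \<open>The projection onto cosets plays the part of \<open>f\<close> and \<open>sharp\<close>
  that of \<open>e\<close>, their fibres being equal.\<close>

lemma hopf_algebra_W_mod_J: "hopf_algebra (W_mod_J :: ('k::field_char_0, 'k wspace set) bialg)"
proof (rule hopf_algebra_image[OF hopf_algebra_W J_coset_lin J_coset_surj _ _ _ lin_map_sharp])
  fix X :: "'k wspace set" assume "X \<in> carrier W_mod_J"
  then obtain F where "F \<in> Wspace" "X = J_coset F"
    using J_coset_surj by auto
  then show "comult W_mod_J X \<in> tensors 2 W_mod_J"
    using W_mod_J_comult_counit(2) by simp
qed (simp_all add: J_coset_mult J_coset_one J_coset_zero sharp_comult sharp_counit sharp_sharp
    J_coset_eq_iff_sharp W_mod_J_comult_counit)

lemma hopf_iso_W_sharp: "J_coset \<in> hopf_iso W_sharp (W_mod_J :: ('k::field_char_0, 'k wspace set) bialg)"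
proof -
  have "J_coset \<in> k_algebra_iso W_sharp (W_mod_J :: ('k, 'k wspace set) bialg)"
    by (rule k_algebra_iso_image[OF lin_map_W_sharp _ _ _ _ _ J_coset_lin J_coset_surj])
      (use Wsharp_subset in \<open>auto simp: J_coset_mult J_coset_one sharp_one sharp_sharp J_coset_eq_iff_sharp\<close>)
  moreover have "counit W_mod_J (J_coset F) = counit W_sharp F"
    "tensor_eq W_mod_J (comult W_mod_J (J_coset F)) (tensor_map J_coset (comult W_sharp F))"
    if F: "F \<in> Wsharp" for F :: "'k wspace"
  proof -
    have FW: "F \<in> Wspace" using F Wsharp_subset by blast
    then show "counit W_mod_J (J_coset F) = counit W_sharp F"
      by (simp add: W_mod_J_comult_counit)
    show "tensor_eq W_mod_J (comult W_mod_J (J_coset F)) (tensor_map J_coset (comult W_sharp F))"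
      using W_mod_J_comult_counit(1)[OF FW]
        tensor_map_eq[OF J_coset_lin comult_W_sharp(2)[OF F, THEN tensor_eq_sym]]
      by (rule tensor_eq_trans)
  qed
  ultimately show ?thesis by (simp add: hopf_iso_def)
qed


section \<open>The algebras for the internal product\<close>

lemma Jn_eq: "Jn n = Jspan \<inter> Wn n"
  by (simp add: Jn_def J_eq_Jspan)

lemma subspace_Jn: "pm.subspace (Jn n)"
  unfolding Jn_eq by (intro pm.subspace_inter subspace_Jspan subspace_Wn)

lemma ideal_Jn: "ideal (Jn n :: 'k::field_char_0 wspace set) (star_algebra n)"
proof (rule idealI)
  interpret A: k_algebra "star_algebra n :: ('k, 'k wspace) module" by (rule k_algebra_star)
  show "ring (star_algebra n :: ('k, 'k wspace) module)" by (rule A.ring_axioms)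
  have minus: "\<ominus>\<^bsub>star_algebra n\<^esub> F = - F" if "F \<in> Wn n" for F :: "'k wspace"
    by (rule A.minus_equality) (use that in auto)
  show "subgroup (Jn n :: 'k wspace set) (add_monoid (star_algebra n))"
  proof (rule A.add.subgroupI)
    fix F :: "'k wspace" assume F: "F \<in> Jn n"
    then have "\<ominus>\<^bsub>star_algebra n\<^esub> F = - F"
      by (intro minus) (simp add: Jn_def)
    with pm.subspace_neg[OF subspace_Jn F] show "\<ominus>\<^bsub>star_algebra n\<^esub> F \<in> Jn n"
      by simp
  qed (use pm.subspace_0[OF subspace_Jn] pm.subspace_add[OF subspace_Jn] in \<open>auto simp: Jn_def\<close>)
  fix F G :: "'k wspace" assume "F \<in> Jn n" "G \<in> carrier (star_algebra n)"
  then show "G \<otimes>\<^bsub>star_algebra n\<^esub> F \<in> Jn n" "F \<otimes>\<^bsub>star_algebra n\<^esub> G \<in> Jn n"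
    by (auto simp: Jn_eq intro: star_Jspan)
qed

lemma sharp_replicate: "sharp (N (replicate n 1)) = D n"
  using star_one_left[OF Ssharp_Wn] by (simp add: sharp_N D_def)

lemma sharp_star_simps [simp]: "carrier (sharp_star_algebra n) = Wsharp_n n"
  "monoid.mult (sharp_star_algebra n) = star" "one (sharp_star_algebra n) = D n"
  "ring.zero (sharp_star_algebra n) = 0" "add (sharp_star_algebra n) = (+)" "smult (sharp_star_algebra n) = scale"
  by (simp_all add: sharp_star_algebra_def)

lemma lin_map_sharp_star: "lin_map (star_algebra n) (sharp_star_algebra n) sharp"
    "sharp ` carrier (star_algebra n) = carrier (sharp_star_algebra n)"
  by (auto simp: lin_map_def sharp_add sharp_scale Wsharp_n_def)

lemma k_algebra_sharp_star: "k_algebra (sharp_star_algebra n :: ('k::field_char_0, 'k wspace) module)"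
  by (rule k_algebra_image[OF k_algebra_star lin_map_sharp_star])
    (simp_all add: sharp_star sharp_replicate[simplified] sharp_0)

lemma
  fixes n :: nat
  defines "q \<equiv> \<lambda>F. Jn n +>\<^bsub>star_algebra n\<^esub> F"
  shows k_algebra_quot_star: "k_algebra (quot_algebra (star_algebra n) (Jn n) :: ('k::field_char_0, 'k wspace set) module)"
    and k_algebra_iso_sharp_star: "q \<in> k_algebra_iso (sharp_star_algebra n)
      (quot_algebra (star_algebra n) (Jn n) :: ('k, 'k wspace set) module)"
proof -
  let ?B = "quot_algebra (star_algebra n) (Jn n) :: ('k, 'k wspace set) module"
  note Q = quotient_map[of "Jn n" "star_algebra n" ?B, OF ideal_Jn _ _ subspace_Jn, folded q_def]
  have eq: "q F = q G \<longleftrightarrow> F - G \<in> Jn n" for F G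
    by (rule Q(2)) (simp_all add: quot_algebra_def)
  have lin: "lin_map (star_algebra n) ?B q"
    by (rule Q(3)) (simp_all add: quot_algebra_def)
  have surj: "q ` carrier (star_algebra n) = carrier ?B"
    by (rule Q(4)) (simp_all add: quot_algebra_def)
  have mult: "q (F \<otimes>\<^bsub>star_algebra n\<^esub> G) = q F \<otimes>\<^bsub>?B\<^esub> q G"
    if "F \<in> carrier (star_algebra n)" "G \<in> carrier (star_algebra n)" for F G
    by (rule Q(5)) (use that in \<open>simp_all add: quot_algebra_def\<close>)
  have one: "q \<one>\<^bsub>star_algebra n\<^esub> = \<one>\<^bsub>?B\<^esub>"
    by (rule Q(6)) (simp_all add: quot_algebra_def)
  have zero: "q \<zero>\<^bsub>star_algebra n\<^esub> = \<zero>\<^bsub>?B\<^esub>"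
    by (rule Q(7)) (simp_all add: quot_algebra_def)
  \<comment> \<open>A difference of elements of \<open>Wn n\<close> stays in \<open>Wn n\<close>, so
    it lies in \<open>Jn n\<close> as soon as it lies in \<open>Jspan\<close>.\<close>
  have ker: "q F = q G \<longleftrightarrow> sharp F = sharp G"
    if "F \<in> carrier (star_algebra n)" "G \<in> carrier (star_algebra n)" for F G
    using that pm.subspace_diff[OF subspace_Wn, of F n G] by (simp add: eq Jn_eq sharp_eq_iff Wn_Wspace)
  show "k_algebra ?B"
    by (rule k_algebra_image[OF k_algebra_star lin surj mult one zero])
  show "q \<in> k_algebra_iso (sharp_star_algebra n) ?B"
    by (rule k_algebra_iso_image[OF lin_map_sharp_star _ _ _ _ _ lin surj mult one _ _ ker])
      (auto simp: Wsharp_n_def sharp_replicate[simplified] sharp_sharp Wn_Wspace)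
qed

text \<open>Multiplication by \<open>D n\<close> on the right is the idempotent \<open>sharp\<close>
  itself; on the left it is \<open>sharp_star_sharp\<close>.\<close>

lemma D_neutral:
  assumes "F \<in> Wsharp_n n"
  shows "star (D n) F = F" "star F (D n) = F"
proof -
  obtain G where G: "G \<in> Wn n" "F = sharp G"
    using assms by (auto simp: Wsharp_n_def)
  then show "star (D n) F = F"
    by (simp add: D_def sharp_star_sharp)
  have "star F (D n) = sharp F"
    using G by (simp add: D_def sharp_eq_star[of "sharp G" n])
  then show "star F (D n) = F"
    using G by (simp add: sharp_sharp Wn_Wspace)
qed

theorem proposition3p4:
  shows "sub_bialgebra (Wsharp :: 'k::field_char_0 wspace set) W
    \<and> hopf_algebra (bialg_restrict W (Wsharp :: 'k wspace set))
    \<and> bi_ideal (J :: 'k wspace set) W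
    \<and> hopf_algebra (quot_bialgebra W (J :: 'k wspace set))
    \<and> (\<exists>\<phi>. \<phi> \<in> hopf_iso (bialg_restrict W (Wsharp :: 'k wspace set)) (quot_bialgebra W J))
    \<and> (\<forall>n.
        k_algebra (sharp_star_algebra n :: ('k, 'k wspace) module)
      \<and> ideal (Jn n :: 'k wspace set) (star_algebra n)
      \<and> k_algebra (quot_algebra (star_algebra n) (Jn n :: 'k wspace set))
      \<and> (\<exists>\<psi>. \<psi> \<in> k_algebra_iso (sharp_star_algebra n :: ('k, 'k wspace) module)
                (quot_algebra (star_algebra n) (Jn n)))
      \<and> (D n :: 'k wspace) = Ssharp n
      \<and> (D n :: 'k wspace) = sharp (N (replicate n 1))
      \<and> (D n :: 'k wspace) \<in> Wsharp_n n
      \<and> (\<forall>F \<in> (Wsharp_n n :: 'k wspace set). star (D n) F = F \<and> star F (D n) = F))"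
proof (intro conjI allI ballI)
  fix n
  show "(D n :: 'k wspace) = Ssharp n"
    by (rule D_def)
  show "(D n :: 'k wspace) = sharp (N (replicate n 1))"
    by (rule sharp_replicate[symmetric])
  show "(D n :: 'k wspace) \<in> Wsharp_n n"
    unfolding sharp_replicate[symmetric] Wsharp_n_def by (intro imageI) (simp add: packed_replicate)
qed (fact sub_bialgebra_Wsharp hopf_algebra_W_sharp bi_ideal_J hopf_algebra_W_mod_J
    exI[of "\<lambda>\<phi>. \<phi> \<in> hopf_iso _ _", OF hopf_iso_W_sharp] k_algebra_sharp_star ideal_Jn k_algebra_quot_star
    exI[of "\<lambda>\<psi>. \<psi> \<in> k_algebra_iso _ _", OF k_algebra_iso_sharp_star] D_neutral)+

end
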